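(* Let $\lambda$ be an $(m|n)$-hook partition of $r$. Then the $\mathbb Z$-span $A_{\lambda,\mathbb{Z}}$ of all modified symmetrizers $T\{i:j\}$, $i,j\in I(m|n,r)$, of shape $\lambda$ is a $\mathbb{Z}$-form of the $S(m|n,r)_{\mathbb Q}$-superbimodule $A_{\lambda,\mathbb{Q}}$ under the left and right actions of $S(m|n,r)_{\mathbb{Z}}$.
   Context: Symbols and multiindices. Fix $m,n,r$. The symbols $1,\dots,m$ are even and $m+1,\dots,m+n$ are odd; $|a|\in\{0,1\}$ denotes the parity of $a$. $I(m|n,r)$ is the set of multiindices $i=(i_1,\dots,i_r)$ with entries in $\{1,\dots,m+n\}$. The symmetric group $\Sigma_r$ acts on the right on multiindices by $(j\pi)_a=j_{\pi(a)}$. The signed action is $j*\pi=(-1)^{s(j,\pi)}\,j\pi$, where $s(j,\pi)$ is the number of pairs $a<b$ with $\pi(a)>\pi(b)$ and $j_{\pi(a)},j_{\pi(b)}>m$; expressions in signed multiindices are extended linearly, e.g. $\chi_{i,-j}=-\chi_{i,j}$ and $\chi_{-i,j}=-\chi_{i,j}$. Write $(i,j)\sim(k,l)$ if $k=i\pi$, $l=j\pi$ for some $\pi\in\Sigma_r$. The space $A(m|n,r)$ over $\mathbb Q$. $A(m|n)$ is the free supercommutative $\mathbb Q$-superalgebra on generators $c_{ab}$, $1\le a,b\le m+n$, of parity $|a|+|b|$, and $A(m|n,r)$ is its degree $r$ part. It is spanned by the elements $$\chi_{i,j}=(-1)^{\sum_{t=1}^r |i_t|(|i_{t+1}|+|j_{t+1}|+\dots+|i_r|+|j_r|)}c_{i_1j_1}c_{i_2j_2}\cdots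 c_{i_rj_r},$$ which satisfy $\chi_{i*\pi,j*\pi}=\chi_{i,j}$ for $\pi\in\Sigma_r$. The Schur superalgebra. $S(m|n,r)_{\mathbb Q}$ is the dual space of $A(m|n,r)$, with product determined by $(\xi\eta)(\chi_{p,q})=\sum_{s\in I(m|n,r)}\xi(\chi_{p,s})\,\eta(\chi_{s,q})$. It acts on $A(m|n,r)$ on the left and right by $\xi\chi_{i,j}=\sum_{a\in I(m|n,r)}\xi(\chi_{a,j})\chi_{i,a}$ and $\chi_{i,j}\xi=\sum_{b\in I(m|n,r)}\xi(\chi_{i,b})\chi_{b,j}$. For $(i,j)$ with $\chi_{i,j}\ne0$, $\xi_{i,j}$ is the functional with $\xi_{i,j}(\chi_{i,j})=1$ and $\xi_{i,j}(\chi_{k,l})=0$ whenever $(k,l)\not\sim(i,j)$. $S(m|n,r)_{\mathbb Z}$ is the $\mathbb Z$-span of the $\xi_{i,j}$; it is closed under multiplication. Tableaux. $\lambda$ is an $(m|n)$-hook partition of $r$ if it is a partition of $r$ with $\lambda_{m+1}\le n$. Fix a basic tableau $T$, i.e. a bijection from the diagram $[\lambda]$ to $\{1,\dots,r\}$; $C(T)$ and $R(T)$ are the subgroups of $\Sigma_r$ preserving each column, respectively each row, of $T$. For $i\in I(m|n,r)$, $T_i$ is the tableau of shape $\lambda$ with entry $i_{T(b)}$ in box $b$. Symmetrizers. $T[i:j]=T^\lambda[i:j]=\sum_{\rho\in R(T)}\sum_{\kappa\in C(T)}\mathrm{sgn}(\kappa)\,\chi_{i*\rho,\,j*\kappa}$,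 and $A_{\lambda,\mathbb Q}$ is the $\mathbb Q$-span of all $T[i:j]$; it is an $S(m|n,r)_{\mathbb Q}$-subsuperbimodule of $A(m|n,r)$. Modified symmetrizers. For a tableau $T_j$ let $m_{aq}(j)$ be the number of occurrences of the symbol $a$ ($1\le a\le m$) in the $q$-th row of $T_j$ and $n_{ad}(j)$ the number of occurrences of the symbol $a$ ($m+1\le a\le m+n$) in the $d$-th column of $T_j$. Put $r(T_j)=\prod_{a=1}^m\prod_q m_{aq}(j)!$ and $c(T_j)=\prod_{a=m+1}^{m+n}\prod_d n_{ad}(j)!$, and $$T\{i:j\}=T^\lambda\{i:j\}=\frac{1}{r(T_i)\,c(T_j)}\,T[i:j].$$ $\mathbb Z$-form. A $\mathbb Z$-form of an $S(m|n,r)_{\mathbb Q}$-superbimodule $V_{\mathbb Q}$ is a nonzero $\mathbb Z$-subsupermodule $V_{\mathbb Z}$ of $V_{\mathbb Q}$ that is closed under the left and right actions of $S(m|n,r)_{\mathbb Z}$. *)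

theory Defs
  imports
    Complex_Main
    "HOL-Library.Poly_Mapping"
    "HOL-Library.FuncSet"
    "HOL-Library.Function_Algebras"
    "HOL-Combinatorics.Permutations"
begin

section \<open>The free supercommutative algebra over the rationals\<close>

datatype 'g word = Word (letters: "'g list")

instantiation word :: (type) monoid_add
begin
definition zero_word where "0 = Word []"
definition plus_word where "u + v = Word (letters u @ letters v)"
instance by standard (simp_all add: zero_word_def plus_word_def)
end

text \<open>
  With concatenation as addition of exponents, \<open>'g word \<Rightarrow>\<^sub>0 rat\<close> with the convolution product
  is the free associative algebra on \<open>'g\<close>. A generator is a pair of its parity (\<open>True\<close> for odd)
  and a label.
\<close>

definition letter :: "bool \<times> 'g \<Rightarrow> (bool \<times> 'g) word \<Rightarrow>\<^sub>0 rat" where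
  "letter x = Poly_Mapping.single (Word [x]) 1"

text \<open>
  The two-sided ideal generated by the supercommutators of the generators. For an odd
  generator \<open>x\<close> it contains \<open>2 x\<^sup>2\<close>, hence \<open>x\<^sup>2\<close>.
\<close>

inductive_set scomm_ideal :: "((bool \<times> 'g) word \<Rightarrow>\<^sub>0 rat) set" where
  supercommutator:
    "letter x * letter y - (if fst x \<and> fst y then - 1 else 1) * letter y * letter x \<in> scomm_ideal"
| zero: "0 \<in> scomm_ideal"
| add: "p \<in> scomm_ideal \<Longrightarrow> q \<in> scomm_ideal \<Longrightarrow> p + q \<in> scomm_ideal"
| mult_left: "p \<in> scomm_ideal \<Longrightarrow> a * p \<in> scomm_ideal"
| mult_right: "p \<in> scomm_ideal \<Longrightarrow> p * a \<in> scomm_ideal"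

definition scomm_rel ::
    "((bool \<times> 'g) word \<Rightarrow>\<^sub>0 rat) \<Rightarrow> ((bool \<times> 'g) word \<Rightarrow>\<^sub>0 rat) \<Rightarrow> bool" where
  "scomm_rel p q \<longleftrightarrow> p - q \<in> scomm_ideal"

lemma scomm_ideal_uminus: "p \<in> scomm_ideal \<Longrightarrow> - p \<in> scomm_ideal"
  using scomm_ideal.mult_left[of p "- 1"] by simp

lemma equivp_scomm_rel: "equivp scomm_rel"
proof (rule equivpI)
  show "reflp scomm_rel"
    by (auto intro!: reflpI simp: scomm_rel_def scomm_ideal.zero)
  show "symp scomm_rel"
    using scomm_ideal_uminus by (fastforce intro!: sympI simp: scomm_rel_def)
  show "transp scomm_rel"
    using scomm_ideal.add by (fastforce intro!: transpI simp: scomm_rel_def)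
qed

quotient_type 'g salg = "(bool \<times> 'g) word \<Rightarrow>\<^sub>0 rat" / scomm_rel
  by (rule equivp_scomm_rel)

instantiation salg :: (type) ring
begin

lift_definition zero_salg :: "'g salg" is 0 .
lift_definition plus_salg :: "'g salg \<Rightarrow> 'g salg \<Rightarrow> 'g salg" is "(+)"
  unfolding scomm_rel_def by (metis add_diff_add scomm_ideal.add)
lift_definition uminus_salg :: "'g salg \<Rightarrow> 'g salg" is uminus
  unfolding scomm_rel_def using scomm_ideal_uminus by (metis minus_diff_minus)
lift_definition minus_salg :: "'g salg \<Rightarrow> 'g salg \<Rightarrow> 'g salg" is "(-)"
  unfolding scomm_rel_def
  by (metis (no_types, lifting) add_diff_add diff_conv_add_uminus minus_diff_minus
      scomm_ideal.add scomm_ideal_uminus)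
lift_definition times_salg :: "'g salg \<Rightarrow> 'g salg \<Rightarrow> 'g salg" is "(*)"
proof -
  fix p p' q q' :: "(bool \<times> 'g) word \<Rightarrow>\<^sub>0 rat"
  assume "scomm_rel p p'" "scomm_rel q q'"
  then have "(p - p') * q + p' * (q - q') \<in> scomm_ideal"
    unfolding scomm_rel_def
    by (intro scomm_ideal.add scomm_ideal.mult_left scomm_ideal.mult_right)
  then show "scomm_rel (p * q) (p' * q')"
    by (simp add: scomm_rel_def algebra_simps)
qed

instance
  by standard (transfer; simp add: scomm_rel_def algebra_simps scomm_ideal.zero)+

end

text \<open>
  The class \<open>ring_1\<close> requires \<open>0 \<noteq> 1\<close>: the ideal is proper because its members have constant
  coefficient zero.
\<close>

lemma lookup_times_empty_word:
  fixes p q :: "'h word \<Rightarrow>\<^sub>0 rat"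
  shows "Poly_Mapping.lookup (p * q) 0 = Poly_Mapping.lookup p 0 * Poly_Mapping.lookup q 0"
proof -
  have split: "(0 = u + v) = (u = 0 \<and> v = 0)" for u v :: "'h word"
    by (cases u; cases v) (auto simp: zero_word_def plus_word_def)
  have "Poly_Mapping.lookup (p * q) 0 =
      (\<Sum>u. Poly_Mapping.lookup p u * (\<Sum>v. Poly_Mapping.lookup q v when u = 0 \<and> v = 0))"
    by (simp add: lookup_mult split)
  also have "\<dots> = (\<Sum>u. (Poly_Mapping.lookup p u * Poly_Mapping.lookup q 0) when u = 0)"
    by (rule arg_cong[of _ _ Sum_any], rule ext) (auto simp: when_def)
  also have "\<dots> = Poly_Mapping.lookup p 0 * Poly_Mapping.lookup q 0"
    by simp
  finally show ?thesis .
qed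

lemma scomm_ideal_constant: "p \<in> scomm_ideal \<Longrightarrow> Poly_Mapping.lookup p 0 = 0"
proof (induction rule: scomm_ideal.induct)
  case (supercommutator x y)
  have "Poly_Mapping.lookup (letter z) 0 = 0" for z :: "bool \<times> 'a"
    by (simp add: letter_def lookup_single zero_word_def)
  then show ?case
    by (simp add: lookup_minus lookup_times_empty_word)
qed (simp_all add: lookup_add lookup_times_empty_word)

instantiation salg :: (type) ring_1
begin
lift_definition one_salg :: "'g salg" is 1 .
instance
proof
  show "(0 :: 'a salg) \<noteq> 1"
  proof (transfer, unfold scomm_rel_def)
    show "0 - 1 \<notin> (scomm_ideal :: ((bool \<times> 'a) word \<Rightarrow>\<^sub>0 rat) set)"
      using scomm_ideal_constant[of "0 - 1 :: (bool \<times> 'a) word \<Rightarrow>\<^sub>0 rat"]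
      by (auto simp: lookup_minus lookup_one)
  qed
qed (transfer; simp add: scomm_rel_def scomm_ideal.zero)+
end

lift_definition salg_gen :: "bool \<times> 'g \<Rightarrow> 'g salg" is letter .

lift_definition salg_const :: "rat \<Rightarrow> 'g salg" is "Poly_Mapping.single 0" .

definition qscale :: "rat \<Rightarrow> 'g salg \<Rightarrow> 'g salg" where
  "qscale q x = salg_const q * x"

lemma salg_const_add: "salg_const (a + b) = salg_const a + salg_const b"
  by transfer (simp add: single_add scomm_rel_def scomm_ideal.zero)

lemma salg_const_mult: "salg_const (a * b) = salg_const a * salg_const b"
  by transfer (simp add: mult_single scomm_rel_def scomm_ideal.zero)

lemma salg_const_one: "salg_const 1 = 1"
  by transfer (simp add: scomm_rel_def scomm_ideal.zero)

global_interpretation q_mod: vector_space qscale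
  by standard (simp_all add: qscale_def salg_const_add salg_const_mult salg_const_one
      algebra_simps)

text \<open>Both the algebra and the pointwise ring of rational functionals on it are of class \<open>ring_1\<close>.\<close>

global_interpretation z_mod: module "\<lambda>(k::int) (x::'a::ring_1). of_int k * x"
  by standard (simp_all add: algebra_simps)


section \<open>The spaces A(m|n,r)\<close>

definition odd_sym :: "nat \<Rightarrow> nat \<Rightarrow> bool" where
  "odd_sym m a \<longleftrightarrow> m < a"

definition par :: "nat \<Rightarrow> nat \<Rightarrow> nat" where
  "par m a = of_bool (odd_sym m a)"

definition c :: "nat \<Rightarrow> nat \<Rightarrow> nat \<Rightarrow> (nat \<times> nat) salg" where
  "c m a b = salg_gen (odd (par m a + par m b), (a, b))"

text \<open>
  \<open>A(m|n)\<close> is the subalgebra of \<open>(nat \<times> nat) salg\<close> generated by the \<open>c m a b\<close> with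
  \<open>a, b \<in> {1..m + n}\<close>; being generated by part of a free generating set, it is itself the free
  supercommutative algebra on these. \<open>A_part m n r e\<close> is spanned by the monomials of degree
  \<open>r\<close> and parity \<open>e\<close> (\<open>True\<close> for odd).
\<close>

definition A_deg :: "nat \<Rightarrow> nat \<Rightarrow> nat \<Rightarrow> (nat \<times> nat) salg set" where
  "A_deg m n r = q_mod.span {prod_list (map (\<lambda>(a, b). c m a b) w) | w.
     length w = r \<and> set w \<subseteq> {1..m + n} \<times> {1..m + n}}"

definition A_part :: "nat \<Rightarrow> nat \<Rightarrow> nat \<Rightarrow> bool \<Rightarrow> (nat \<times> nat) salg set" where
  "A_part m n r e = q_mod.span {prod_list (map (\<lambda>(a, b). c m a b) w) | w.
     length w = r \<and> set w \<subseteq> {1..m + n} \<times> {1..m + n} \<and>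
     odd (\<Sum>(a, b)\<leftarrow>w. par m a + par m b) = e}"

definition multiindices :: "nat \<Rightarrow> nat \<Rightarrow> nat \<Rightarrow> (nat \<Rightarrow> nat) set" where
  "multiindices m n r = {1..r} \<rightarrow>\<^sub>E {1..m + n}"

definition chi :: "nat \<Rightarrow> nat \<Rightarrow> (nat \<Rightarrow> nat) \<Rightarrow> (nat \<Rightarrow> nat) \<Rightarrow> (nat \<times> nat) salg" where
  "chi m r i j =
     (- 1) ^ (\<Sum>t = 1..r. par m (i t) * (\<Sum>u = t + 1..r. par m (i u) + par m (j u))) *
     prod_list (map (\<lambda>t. c m (i t) (j t)) [1..<r + 1])"

definition equiv_pair ::
    "nat \<Rightarrow> (nat \<Rightarrow> nat) \<Rightarrow> (nat \<Rightarrow> nat) \<Rightarrow> (nat \<Rightarrow> nat) \<Rightarrow> (nat \<Rightarrow> nat) \<Rightarrow> bool" where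
  "equiv_pair r i j k l \<longleftrightarrow> (\<exists>\<pi>. \<pi> permutes {1..r} \<and> k = i \<circ> \<pi> \<and> l = j \<circ> \<pi>)"

text \<open>A signed multiindex is a pair of a sign and a multiindex.\<close>

definition star ::
    "nat \<Rightarrow> nat \<Rightarrow> (nat \<Rightarrow> nat) \<Rightarrow> (nat \<Rightarrow> nat) \<Rightarrow> int \<times> (nat \<Rightarrow> nat)" where
  "star m r j \<pi> =
     ((- 1) ^ card {(a, b). a \<in> {1..r} \<and> b \<in> {1..r} \<and> a < b \<and> \<pi> a > \<pi> b \<and>
                            odd_sym m (j (\<pi> a)) \<and> odd_sym m (j (\<pi> b))},
      j \<circ> \<pi>)"

definition chi_signed ::
    "nat \<Rightarrow> nat \<Rightarrow> int \<times> (nat \<Rightarrow> nat) \<Rightarrow> int \<times> (nat \<Rightarrow> nat) \<Rightarrow> (nat \<times> nat) salg" where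
  "chi_signed m r x y = of_int (fst x * fst y) * chi m r (snd x) (snd y)"


section \<open>The Schur superalgebra and its actions\<close>

text \<open>
  A linear map on a subspace \<open>V\<close> is represented by its extension by zero off \<open>V\<close> (which is in
  general not linear on the whole type), so that equality of functions is equality of maps on
  \<open>V\<close>.
\<close>

definition linear_on ::
    "(rat \<Rightarrow> 'b \<Rightarrow> 'b) \<Rightarrow> 'g salg set \<Rightarrow> ('g salg \<Rightarrow> 'b::ab_group_add) \<Rightarrow> bool" where
  "linear_on scale V f \<longleftrightarrow>
     (\<forall>x\<in>V. \<forall>y\<in>V. f (x + y) = f x + f y) \<and>
     (\<forall>q. \<forall>x\<in>V. f (qscale q x) = scale q (f x)) \<and>
     (\<forall>x. x \<notin> V \<longrightarrow> f x = 0)"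

definition S_Q :: "nat \<Rightarrow> nat \<Rightarrow> nat \<Rightarrow> ((nat \<times> nat) salg \<Rightarrow> rat) set" where
  "S_Q m n r = {\<xi>. linear_on (*) (A_deg m n r) \<xi>}"

definition xi ::
    "nat \<Rightarrow> nat \<Rightarrow> nat \<Rightarrow> (nat \<Rightarrow> nat) \<Rightarrow> (nat \<Rightarrow> nat) \<Rightarrow> (nat \<times> nat) salg \<Rightarrow> rat" where
  "xi m n r i j = (THE \<xi>. \<xi> \<in> S_Q m n r \<and> \<xi> (chi m r i j) = 1 \<and>
     (\<forall>k\<in>multiindices m n r. \<forall>l\<in>multiindices m n r.
        \<not> equiv_pair r k l i j \<longrightarrow> \<xi> (chi m r k l) = 0))"

definition S_Z :: "nat \<Rightarrow> nat \<Rightarrow> nat \<Rightarrow> ((nat \<times> nat) salg \<Rightarrow> rat) set" where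
  "S_Z m n r = z_mod.span {xi m n r i j | i j.
     i \<in> multiindices m n r \<and> j \<in> multiindices m n r \<and> chi m r i j \<noteq> 0}"

definition left_act ::
    "nat \<Rightarrow> nat \<Rightarrow> nat \<Rightarrow> ((nat \<times> nat) salg \<Rightarrow> rat) \<Rightarrow> (nat \<times> nat) salg \<Rightarrow> (nat \<times> nat) salg" where
  "left_act m n r \<xi> = (THE F. linear_on qscale (A_deg m n r) F \<and>
     (\<forall>i\<in>multiindices m n r. \<forall>j\<in>multiindices m n r.
        F (chi m r i j) = (\<Sum>a\<in>multiindices m n r. qscale (\<xi> (chi m r a j)) (chi m r i a))))"

definition right_act ::
    "nat \<Rightarrow> nat \<Rightarrow> nat \<Rightarrow> (nat \<times> nat) salg \<Rightarrow> ((nat \<times> nat) salg \<Rightarrow> rat) \<Rightarrow> (nat \<times> nat) salg" where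
  "right_act m n r x \<xi> = (THE F. linear_on qscale (A_deg m n r) F \<and>
     (\<forall>i\<in>multiindices m n r. \<forall>j\<in>multiindices m n r.
        F (chi m r i j) = (\<Sum>b\<in>multiindices m n r. qscale (\<xi> (chi m r i b)) (chi m r b j)))) x"

definition bi_closed ::
    "nat \<Rightarrow> nat \<Rightarrow> nat \<Rightarrow> ((nat \<times> nat) salg \<Rightarrow> rat) set \<Rightarrow> (nat \<times> nat) salg set \<Rightarrow> bool" where
  "bi_closed m n r S V \<longleftrightarrow>
     (\<forall>\<xi>\<in>S. \<forall>x\<in>V. left_act m n r \<xi> x \<in> V \<and> right_act m n r x \<xi> \<in> V)"

definition graded :: "nat \<Rightarrow> nat \<Rightarrow> nat \<Rightarrow> (nat \<times> nat) salg set \<Rightarrow> bool" where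
  "graded m n r V \<longleftrightarrow>
     (\<forall>x\<in>V. \<exists>x0 \<in> V \<inter> A_part m n r False. \<exists>x1 \<in> V \<inter> A_part m n r True. x = x0 + x1)"

definition subsuperbimodule :: "nat \<Rightarrow> nat \<Rightarrow> nat \<Rightarrow> (nat \<times> nat) salg set \<Rightarrow> bool" where
  "subsuperbimodule m n r V \<longleftrightarrow>
     V \<subseteq> A_deg m n r \<and> q_mod.subspace V \<and> graded m n r V \<and> bi_closed m n r (S_Q m n r) V"

definition Z_form ::
    "nat \<Rightarrow> nat \<Rightarrow> nat \<Rightarrow> (nat \<times> nat) salg set \<Rightarrow> (nat \<times> nat) salg set \<Rightarrow> bool" where
  "Z_form m n r V L \<longleftrightarrow>
     subsuperbimodule m n r V \<and>
     L \<subseteq> V \<and> L \<noteq> {0} \<and> z_mod.subspace L \<and> graded m n r L \<and> bi_closed m n r (S_Z m n r) L"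


section \<open>Tableaux and symmetrizers\<close>

text \<open>
  A partition is the list of its positive parts; rows, columns and parts are numbered from 1.
  A box is a pair (row, column).
\<close>

definition part :: "nat list \<Rightarrow> nat \<Rightarrow> nat" where
  "part lam q = (if 1 \<le> q \<and> q \<le> length lam then lam ! (q - 1) else 0)"

definition is_partition :: "nat \<Rightarrow> nat list \<Rightarrow> bool" where
  "is_partition r lam \<longleftrightarrow> sorted_wrt (\<ge>) lam \<and> (\<forall>x\<in>set lam. 0 < x) \<and> sum_list lam = r"

definition hook_partition :: "nat \<Rightarrow> nat \<Rightarrow> nat \<Rightarrow> nat list \<Rightarrow> bool" where
  "hook_partition m n r lam \<longleftrightarrow> is_partition r lam \<and> part lam (m + 1) \<le> n"

definition diagram :: "nat list \<Rightarrow> (nat \<times> nat) set" where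
  "diagram lam = {(q, d). 1 \<le> q \<and> q \<le> length lam \<and> 1 \<le> d \<and> d \<le> part lam q}"

definition basic_tableau :: "nat \<Rightarrow> nat list \<Rightarrow> (nat \<times> nat \<Rightarrow> nat) \<Rightarrow> bool" where
  "basic_tableau r lam T \<longleftrightarrow> bij_betw T (diagram lam) {1..r}"

definition row_group ::
    "nat \<Rightarrow> nat list \<Rightarrow> (nat \<times> nat \<Rightarrow> nat) \<Rightarrow> (nat \<Rightarrow> nat) set" where
  "row_group r lam T = {\<pi>. \<pi> permutes {1..r} \<and>
     (\<forall>b\<in>diagram lam. \<exists>b'\<in>diagram lam. fst b' = fst b \<and> \<pi> (T b) = T b')}"

definition col_group ::
    "nat \<Rightarrow> nat list \<Rightarrow> (nat \<times> nat \<Rightarrow> nat) \<Rightarrow> (nat \<Rightarrow> nat) set" where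
  "col_group r lam T = {\<pi>. \<pi> permutes {1..r} \<and>
     (\<forall>b\<in>diagram lam. \<exists>b'\<in>diagram lam. snd b' = snd b \<and> \<pi> (T b) = T b')}"

definition symmetrizer ::
    "nat \<Rightarrow> nat \<Rightarrow> nat list \<Rightarrow> (nat \<times> nat \<Rightarrow> nat) \<Rightarrow> (nat \<Rightarrow> nat) \<Rightarrow> (nat \<Rightarrow> nat) \<Rightarrow>
      (nat \<times> nat) salg" where
  "symmetrizer m r lam T i j =
     (\<Sum>\<rho>\<in>row_group r lam T. \<Sum>\<kappa>\<in>col_group r lam T.
        of_int (sign \<kappa>) * chi_signed m r (star m r i \<rho>) (star m r j \<kappa>))"

definition row_count ::
    "nat list \<Rightarrow> (nat \<times> nat \<Rightarrow> nat) \<Rightarrow> (nat \<Rightarrow> nat) \<Rightarrow> nat \<Rightarrow> nat \<Rightarrow> nat" where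
  "row_count lam T j a q = card {b \<in> diagram lam. fst b = q \<and> j (T b) = a}"

definition col_count ::
    "nat list \<Rightarrow> (nat \<times> nat \<Rightarrow> nat) \<Rightarrow> (nat \<Rightarrow> nat) \<Rightarrow> nat \<Rightarrow> nat \<Rightarrow> nat" where
  "col_count lam T j a d = card {b \<in> diagram lam. snd b = d \<and> j (T b) = a}"

definition row_fact ::
    "nat \<Rightarrow> nat list \<Rightarrow> (nat \<times> nat \<Rightarrow> nat) \<Rightarrow> (nat \<Rightarrow> nat) \<Rightarrow> nat" where
  "row_fact m lam T j = (\<Prod>a = 1..m. \<Prod>q = 1..length lam. fact (row_count lam T j a q))"

text \<open>The number of columns is the first part.\<close>

definition col_fact ::
    "nat \<Rightarrow> nat \<Rightarrow> nat list \<Rightarrow> (nat \<times> nat \<Rightarrow> nat) \<Rightarrow> (nat \<Rightarrow> nat) \<Rightarrow> nat" where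
  "col_fact m n lam T j =
     (\<Prod>a = m + 1..m + n. \<Prod>d = 1..part lam 1. fact (col_count lam T j a d))"

definition modified_symmetrizer ::
    "nat \<Rightarrow> nat \<Rightarrow> nat \<Rightarrow> nat list \<Rightarrow> (nat \<times> nat \<Rightarrow> nat) \<Rightarrow> (nat \<Rightarrow> nat) \<Rightarrow> (nat \<Rightarrow> nat) \<Rightarrow>
      (nat \<times> nat) salg" where
  "modified_symmetrizer m n r lam T i j =
     qscale (1 / of_nat (row_fact m lam T i * col_fact m n lam T j)) (symmetrizer m r lam T i j)"

definition A_lam_Q ::
    "nat \<Rightarrow> nat \<Rightarrow> nat \<Rightarrow> nat list \<Rightarrow> (nat \<times> nat \<Rightarrow> nat) \<Rightarrow> (nat \<times> nat) salg set" where
  "A_lam_Q m n r lam T = q_mod.span {symmetrizer m r lam T i j | i j.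
     i \<in> multiindices m n r \<and> j \<in> multiindices m n r}"

definition A_lam_Z ::
    "nat \<Rightarrow> nat \<Rightarrow> nat \<Rightarrow> nat list \<Rightarrow> (nat \<times> nat \<Rightarrow> nat) \<Rightarrow> (nat \<times> nat) salg set" where
  "A_lam_Z m n r lam T = z_mod.span {modified_symmetrizer m n r lam T i j | i j.
     i \<in> multiindices m n r \<and> j \<in> multiindices m n r}"

end

theory Submission
  imports Defs
begin

text \<open>
  A functional or a linear map on \<open>A(m|n,r)\<close> may be prescribed on the elements \<open>\<chi>\<^bsub>i,j\<^esub>\<close> as soon as
  the prescription is compatible with \<open>\<chi>\<^bsub>i*\<pi>,j*\<pi>\<^esub> = \<chi>\<^bsub>i,j\<^esub>\<close>. Hence the actions are well defined,
  elements of \<open>S(m|n,r)\<^bsub>\<int>\<^esub>\<close> take integral values on the \<open>\<chi>\<^bsub>i,j\<^esub>\<close>, and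
  \<open>\<xi> T[i:j] = \<Sum>\<^sub>a \<xi>(\<chi>\<^bsub>a,j\<^esub>) T[i:a]\<close>, and dually on the right.

  The factor \<open>c(T\<^sub>j)\<close> is the order of the group \<open>H\<^sub>j\<close> of column permutations that stabilize \<open>j\<close> and
  fix all boxes with an even entry of \<open>T\<^sub>j\<close>. Every summand is invariant under \<open>a \<mapsto> a\<kappa>\<close> for
  \<open>\<kappa> \<in> H\<^sub>j\<close>, so the orbit of \<open>a\<close> contributes \<open>\<xi>(\<chi>\<^bsub>a,j\<^esub>) c(T\<^sub>a) / |Stab(a)|\<close> times \<open>T{i:a}\<close> to
  \<open>\<xi> T{i:j}\<close>. If \<open>\<chi>\<^bsub>a,j\<^esub> \<noteq> 0\<close>, then \<open>Stab(a)\<close> is a subgroup of \<open>H\<^sub>a\<close>, and the coefficient is integral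
  by Lagrange's theorem.

  To see that the lattice is nonzero, evaluate the counit \<open>\<chi>\<^bsub>k,l\<^esub> \<mapsto> \<delta>\<^bsub>k,l\<^esub>\<close> at \<open>T[i:i]\<close>, where \<open>T\<^sub>i\<close>
  has entry \<open>q\<close> in the rows \<open>q \<le> m\<close> and \<open>m + d\<close> in the rest of column \<open>d\<close>: all nonzero terms equal \<open>1\<close>.
\<close>

section \<open>Signs of permutations on signed multiindices\<close>

definition star_sign :: "nat \<Rightarrow> nat \<Rightarrow> (nat \<Rightarrow> nat) \<Rightarrow> (nat \<Rightarrow> nat) \<Rightarrow> int" where
  "star_sign m r j \<pi> = fst (star m r j \<pi>)"

definition index_pairs :: "nat \<Rightarrow> (nat \<times> nat) set" where
  "index_pairs r = {(a, b). a \<in> {1..r} \<and> b \<in> {1..r} \<and> a < b}"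

lemma finite_index_pairs [simp]: "finite (index_pairs r)"
  by (rule finite_subset[of _ "{1..r} \<times> {1..r}"]) (auto simp: index_pairs_def)

text \<open>The sign of the signed action becomes a product of local factors, one per pair of
  positions, so that identities between signs can be checked pair by pair after reindexing.\<close>

definition inversion_sign :: "nat \<Rightarrow> (nat \<Rightarrow> nat) \<Rightarrow> (nat \<Rightarrow> nat) \<Rightarrow> nat \<times> nat \<Rightarrow> int" where
  "inversion_sign m j \<pi> = (\<lambda>(a, b).
     if \<pi> a > \<pi> b \<and> odd_sym m (j (\<pi> a)) \<and> odd_sym m (j (\<pi> b)) then - 1 else 1)"

lemma prod_if_eq_power_card:
  fixes x :: "'b::comm_monoid_mult"
  assumes "finite A"
  shows "(\<Prod>a\<in>A. if Q a then x else 1) = x ^ card {a\<in>A. Q a}"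
  using assms by (simp add: prod.inter_filter[symmetric])

lemma star_sign_eq_power:
  "star_sign m r j \<pi> = (- 1) ^ card {x\<in>index_pairs r. \<pi> (fst x) > \<pi> (snd x) \<and>
     odd_sym m (j (\<pi> (fst x))) \<and> odd_sym m (j (\<pi> (snd x)))}"
  unfolding star_sign_def star_def fst_conv
  by (rule arg_cong[where f="\<lambda>A. (- 1) ^ card A"]) (auto simp: index_pairs_def)

lemma star_sign_eq_prod: "star_sign m r j \<pi> = (\<Prod>x\<in>index_pairs r. inversion_sign m j \<pi> x)"
  unfolding star_sign_eq_power inversion_sign_def case_prod_unfold
  by (rule prod_if_eq_power_card[symmetric]) simp

lemma neg_one_power_cases: "(- 1 :: int) ^ k = 1 \<or> (- 1 :: int) ^ k = - 1"
  by (cases "even k") simp_all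

lemma star_sign_cong:
  assumes "\<And>t. t \<in> {1..r} \<Longrightarrow> odd_sym m (j (\<pi> t)) = odd_sym m (j' (\<pi> t))"
  shows "star_sign m r j \<pi> = star_sign m r j' \<pi>"
  unfolding star_sign_eq_prod
  by (rule prod.cong) (auto simp: inversion_sign_def index_pairs_def assms)

lemma star_sign_mult_self [simp]: "star_sign m r j \<pi> * star_sign m r j \<pi> = 1"
  by (simp add: star_sign_def star_def power_add[symmetric])

lemma star_sign_cases: "star_sign m r j \<pi> = 1 \<or> star_sign m r j \<pi> = - 1"
  unfolding star_sign_eq_power by (rule neg_one_power_cases)

lemma star_sign_id [simp]: "star_sign m r j id = 1"
  unfolding star_sign_eq_prod
  by (rule prod.neutral) (auto simp: inversion_sign_def index_pairs_def)

text \<open>Pairs are reindexed by \<sigma>: the composite inverts a pair exactly when one, but not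
  both, of \<sigma> on the pair and \<pi> on its image does, and all three factors look at the
  parities of the same two symbols. This cocycle rule makes \<open>star\<close> a right
  action.\<close>

lemma star_sign_compose:
  assumes "\<pi> permutes {1..r}" "\<sigma> permutes {1..r}"
  shows "star_sign m r j (\<pi> \<circ> \<sigma>) = star_sign m r j \<pi> * star_sign m r (j \<circ> \<pi>) \<sigma>"
proof -
  \<comment> \<open>\<open>h\<close> sorts the image pair, so that it permutes
    \<open>index_pairs r\<close>.\<close>
  define h where "h = (\<lambda>(a, b). if \<sigma> a < \<sigma> b then (\<sigma> a, \<sigma> b) else (\<sigma> b, \<sigma> a))"
  note inj = permutes_inj[OF assms(1), THEN inj_eq] permutes_inj[OF assms(2), THEN inj_eq]
  have "inj_on h (index_pairs r)"
  proof (rule inj_onI, clarify)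
    fix a b a' b'
    assume "(a, b) \<in> index_pairs r" "(a', b') \<in> index_pairs r" "h (a, b) = h (a', b')"
    then have "a < b" "a' < b'" "a = a' \<and> b = b' \<or> a = b' \<and> b = a'"
      by (simp_all add: index_pairs_def h_def inj split: if_splits)
    then show "a = a' \<and> b = b'" by auto
  qed
  moreover have sub: "h ` index_pairs r \<subseteq> index_pairs r"
  proof clarify
    fix a b a' b'
    assume ab: "(a, b) \<in> index_pairs r" and h: "(a', b') = h (a, b)"
    then have "\<sigma> a \<in> {1..r}" "\<sigma> b \<in> {1..r}" "\<sigma> a \<noteq> \<sigma> b"
      by (simp_all only: index_pairs_def permutes_in_image[OF assms(2)] inj(2)) auto
    with h show "(a', b') \<in> index_pairs r"
      by (simp add: index_pairs_def h_def split: if_splits)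
  qed
  ultimately have bij: "bij_betw h (index_pairs r) (index_pairs r)"
    by (simp add: bij_betw_def endo_inj_surj)
  have eq: "inversion_sign m j (\<pi> \<circ> \<sigma>) x =
      inversion_sign m j \<pi> (h x) * inversion_sign m (j \<circ> \<pi>) \<sigma> x" if mem: "x \<in> index_pairs r" for x
  proof -
    obtain a b where x: "x = (a, b)" "a < b"
      using mem by (cases x) (simp add: index_pairs_def)
    then have "\<sigma> a \<noteq> \<sigma> b" "\<pi> (\<sigma> a) \<noteq> \<pi> (\<sigma> b)"
      by (auto simp: inj)
    then show ?thesis
      using x(2) by (cases "\<sigma> a < \<sigma> b"; cases "\<pi> (\<sigma> a) < \<pi> (\<sigma> b)")
        (simp_all add: x(1) inversion_sign_def h_def)
  qed
  show ?thesis
    unfolding star_sign_eq_prod prod.distrib[symmetric]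
      prod.reindex_bij_betw[OF bij, of "inversion_sign m j \<pi>", symmetric]
    by (rule prod.cong[OF refl eq])
qed

text \<open>Besides \<open>(t, u)\<close> itself, the transposition inverts \<open>(t, x)\<close>
  and \<open>(x, u)\<close> for each \<open>x\<close> strictly between. An odd position
  \<open>x\<close> contributes both inversions and an even one neither, so the count is odd.\<close>

lemma star_sign_transpose_aux:
  assumes "t \<in> {1..r}" "u \<in> {1..r}" "t < u" "odd_sym m (j t)" "odd_sym m (j u)"
  shows "star_sign m r j (transpose t u) = - 1"
proof -
  define M where "M = {x. t < x \<and> x < u \<and> odd_sym m (j x)}"
  let ?S = "{x\<in>index_pairs r. transpose t u (fst x) > transpose t u (snd x) \<and>
      odd_sym m (j (transpose t u (fst x))) \<and> odd_sym m (j (transpose t u (snd x)))}"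
  have fin: "finite M"
    by (rule finite_subset[of _ "{..<u}"]) (auto simp: M_def)
  have "?S = insert (t, u) ((\<lambda>x. (t, x)) ` M \<union> (\<lambda>x. (x, u)) ` M)"
  proof (rule set_eqI)
    fix x :: "nat \<times> nat"
    obtain a b where x: "x = (a, b)" by (cases x)
    show "x \<in> ?S \<longleftrightarrow> x \<in> insert (t, u) ((\<lambda>x. (t, x)) ` M \<union> (\<lambda>x. (x, u)) ` M)"
      using assms unfolding x
      by (cases "a = t"; cases "a = u"; cases "b = t"; cases "b = u")
        (auto simp: M_def index_pairs_def transpose_apply_other)
  qed
  moreover have "card ((\<lambda>x. (t, x)) ` M \<union> (\<lambda>x. (x, u)) ` M) = card M + card M"
    using fin by (subst card_Un_disjoint) (auto simp: card_image inj_on_def M_def)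
  moreover have "(t, u) \<notin> (\<lambda>x. (t, x)) ` M \<union> (\<lambda>x. (x, u)) ` M"
    by (auto simp: M_def)
  ultimately have "card ?S = Suc (card M + card M)"
    using fin by simp
  then show ?thesis
    unfolding star_sign_eq_power by simp
qed

lemma star_sign_transpose:
  assumes "t \<in> {1..r}" "u \<in> {1..r}" "t \<noteq> u" "odd_sym m (j t)" "odd_sym m (j u)"
  shows "star_sign m r j (transpose t u) = - 1"
proof (cases "t < u")
  case True
  then show ?thesis
    using star_sign_transpose_aux[of t r u m j] assms by simp
next
  case False
  then show ?thesis
    using star_sign_transpose_aux[of u r t m j] assms by (simp add: transpose_commute)
qed

lemma star_sign_adjacent:
  assumes "t \<in> {1..r}" "Suc t \<in> {1..r}"
  shows "star_sign m r j (transpose t (Suc t)) = (- 1) ^ (par m (j t) * par m (j (Suc t)))"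
proof (cases "odd_sym m (j t) \<and> odd_sym m (j (Suc t))")
  case True
  then show ?thesis
    using star_sign_transpose[of t r "Suc t" m j] assms by (simp add: par_def)
next
  case False
  have "star_sign m r j (transpose t (Suc t)) = 1"
    unfolding star_sign_eq_prod using False
    by (intro prod.neutral) (auto simp: inversion_sign_def index_pairs_def transpose_def)
  then show ?thesis
    using False by (auto simp: par_def)
qed

text \<open>Every transposition of odd positions contributes \<open>- 1\<close>, as it does to
  \<open>sign\<close>. This lets the alternating sign of the symmetrizer cancel for column
  permutations that move odd symbols only.\<close>

lemma star_sign_odd_permutes:
  assumes "\<pi> permutes {t\<in>{1..r}. odd_sym m (j t)}"
  shows "star_sign m r j \<pi> = sign \<pi>"
proof -
  let ?O = "{t\<in>{1..r}. odd_sym m (j t)}"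
  have "finite ?O" by simp
  with assms show ?thesis
  proof (induction rule: permutes_induct)
    case id
    show ?case using star_sign_id[of m r j] by (simp add: id_def)
  next
    case (swap a b p)
    have pO: "p permutes {1..r}"
      by (rule permutes_subset[OF swap.hyps(4)]) auto
    have tr: "transpose a b permutes {1..r}"
      using swap by (intro permutes_swap_id) auto
    \<comment> \<open>The cocycle rule leaves the second factor at
      \<open>j \<circ> transpose a b\<close>; both exchanged entries are odd, so the parity at every
      position is unchanged.\<close>
    have "star_sign m r (j \<circ> transpose a b) p = star_sign m r j p"
      using swap permutes_in_image[OF swap.hyps(4)]
      by (intro star_sign_cong) (auto simp: transpose_def)
    moreover have "permutation p" "permutation (transpose a b)"
      using pO permutes_imp_permutation by (auto simp: permutation_swap_id)
    moreover have "star_sign m r j (transpose a b) = sign (transpose a b)"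
      using swap.hyps star_sign_transpose[of a r b m j] by (simp add: sign_swap_id)
    ultimately show ?case
      by (simp only: star_sign_compose[OF tr pO] sign_compose swap.IH)
  qed
qed

text \<open>Both symbols of a counted inversion would sit at fixed positions, whose order is not
  reversed.\<close>

lemma star_sign_fixes_odd:
  assumes "\<pi> permutes {1..r}" "\<And>t. t \<in> {1..r} \<Longrightarrow> odd_sym m (j t) \<Longrightarrow> \<pi> t = t"
  shows "star_sign m r j \<pi> = 1"
proof -
  \<comment> \<open>\<open>\<pi> t\<close> is an odd position, hence a fixed point, and injectivity
    gives \<open>\<pi> t = t\<close>.\<close>
  have fixed: "\<pi> t = t" if "t \<in> {1..r}" "odd_sym m (j (\<pi> t))" for t
    using assms that permutes_in_image[OF assms(1)] permutes_inj[OF assms(1)] inj_eq by metis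
  show ?thesis
    unfolding star_sign_eq_prod
  proof (rule prod.neutral, clarify)
    fix a b assume "(a, b) \<in> index_pairs r"
    then have "a \<in> {1..r}" "b \<in> {1..r}" "a < b"
      by (auto simp: index_pairs_def)
    then show "inversion_sign m j \<pi> (a, b) = 1"
      using fixed[of a] fixed[of b] by (auto simp: inversion_sign_def)
  qed
qed

section \<open>Generation of the symmetric group by adjacent transpositions\<close>

text \<open>The effect on a word in the supercommutative algebra is known directly only for
  neighbouring letters. Longer transpositions arise from adjacent ones by conjugation.\<close>

lemma permutes_adjacent_induct [consumes 1, case_names id adjacent compose]:
  assumes "\<pi> permutes {1..r}"
    and id: "P id"
    and adj: "\<And>t. t \<in> {1..r} \<Longrightarrow> Suc t \<in> {1..r} \<Longrightarrow> P (transpose t (Suc t))"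
    and comp: "\<And>p q. p permutes {1..r} \<Longrightarrow> q permutes {1..r} \<Longrightarrow> P p \<Longrightarrow> P q \<Longrightarrow> P (p \<circ> q)"
  shows "P \<pi>"
proof -
  have dist: "P (transpose a (a + Suc d))" if "1 \<le> a" "a + Suc d \<le> r" for a d
    using that
  proof (induction d)
    case 0
    then show ?case using adj[of a] by simp
  next
    case (Suc d)
    let ?s = "transpose (a + Suc d) (a + Suc (Suc d))" and ?t = "transpose a (a + Suc d)"
    have s: "P ?s" "?s permutes {1..r}" and t: "P ?t" "?t permutes {1..r}"
      using Suc adj[of "a + Suc d"] by (auto intro!: permutes_swap_id)
    \<comment> \<open>Conjugating by the adjacent swap at the upper end lengthens the transposition
      by one.\<close>
    have "transpose a (a + Suc (Suc d)) = ?s \<circ> (?t \<circ> ?s)"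
      by (auto simp: fun_eq_iff transpose_def)
    then show ?case
      using comp[OF s(2) permutes_compose[OF s(2) t(2)] s(1) comp[OF t(2) s(2) t(1) s(1)]]
      by (simp only:)
  qed
  have tr: "P (transpose a b)" if "a \<in> {1..r}" "b \<in> {1..r}" "a \<noteq> b" for a b
  proof (cases "a < b")
    case True
    then show ?thesis using dist[of a "b - Suc a"] that by simp
  next
    case False
    then show ?thesis using dist[of b "a - Suc b"] that by (simp add: transpose_commute)
  qed
  have "finite {1..r}" by simp
  with \<open>\<pi> permutes {1..r}\<close> show ?thesis
  proof (induction rule: permutes_induct)
    case id
    show ?case by (rule assms)
  next
    case (swap a b p)
    then show ?case by (intro comp tr permutes_swap_id)
  qed
qed

section \<open>Monomials and the spanning elements\<close>

definition monomial :: "nat \<Rightarrow> (nat \<times> nat) list \<Rightarrow> (nat \<times> nat) salg" where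
  "monomial m w = prod_list (map (\<lambda>(a, b). c m a b) w)"

definition index_word :: "nat \<Rightarrow> (nat \<Rightarrow> nat) \<Rightarrow> (nat \<Rightarrow> nat) \<Rightarrow> (nat \<times> nat) list" where
  "index_word r i j = map (\<lambda>t. (i t, j t)) [1..<r + 1]"

text \<open>The Koszul exponent in \<open>chi\<close> as a recursion over the word of index pairs;
  in this form the effect of exchanging two adjacent letters can be read off from the rule for
  appending.\<close>

fun chi_exponent :: "nat \<Rightarrow> (nat \<times> nat) list \<Rightarrow> nat" where
  "chi_exponent m [] = 0"
| "chi_exponent m (x # w) =
     par m (fst x) * (\<Sum>y\<leftarrow>w. par m (fst y) + par m (snd y)) + chi_exponent m w"

lemma chi_exponent_append:
  "chi_exponent m (u @ v) = chi_exponent m u +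
     (\<Sum>y\<leftarrow>u. par m (fst y)) * (\<Sum>y\<leftarrow>v. par m (fst y) + par m (snd y)) + chi_exponent m v"
  by (induction u) (simp_all add: algebra_simps)

text \<open>The lower end \<open>k\<close> is general because the induction adds letters at the
  front, going down from the empty range at \<open>k = r + 1\<close>.\<close>

lemma chi_exponent_index_word_aux:
  assumes "k \<le> r + 1"
  shows "(\<Sum>t = k..r. par m (i t) * (\<Sum>u = t + 1..r. par m (i u) + par m (j u))) =
    chi_exponent m (map (\<lambda>t. (i t, j t)) [k..<r + 1])"
  using assms
proof (induction k rule: inc_induct)
  case base
  then show ?case by simp
next
  case (step k)
  have "{k..r} = insert k {Suc k..r}"
    using step by auto
  moreover have "(\<Sum>u = k + 1..r. par m (i u) + par m (j u)) =
      (\<Sum>y\<leftarrow>map (\<lambda>t. (i t, j t)) [Suc k..<r + 1]. par m (fst y) + par m (snd y))"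
    by (simp add: comp_def atLeastLessThanSuc_atLeastAtMost interv_sum_list_conv_sum_set_nat
        del: upt_Suc)
  moreover have "[k..<r + 1] = k # [Suc k..<r + 1]"
    using step by (simp add: upt_conv_Cons)
  ultimately show ?case
    using step.IH by (simp del: upt_Suc)
qed

lemma chi_eq: "chi m r i j = (- 1) ^ chi_exponent m (index_word r i j) * monomial m (index_word r i j)"
  using chi_exponent_index_word_aux[of 1 r m i j]
  unfolding chi_def monomial_def index_word_def by (simp add: comp_def del: upt_Suc)

section \<open>Supercommutation and the sign rule for \<open>chi\<close>\<close>

lemma salg_gen_commute:
  "salg_gen x * salg_gen y = (if fst x \<and> fst y then - 1 else 1) * salg_gen y * salg_gen x"
proof (transfer, unfold scomm_rel_def)
  fix x y :: "bool \<times> 'a"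
  show "letter x * letter y - (if fst x \<and> fst y then - 1 else 1) * letter y * letter x
      \<in> (scomm_ideal :: ((bool \<times> 'a) word \<Rightarrow>\<^sub>0 rat) set)"
    by (rule scomm_ideal.supercommutator)
qed

lemma c_commute:
  "c m (fst x) (snd x) * c m (fst y) (snd y) =
    (- 1) ^ ((par m (fst x) + par m (snd x)) * (par m (fst y) + par m (snd y))) *
      (c m (fst y) (snd y) * c m (fst x) (snd x))"
  unfolding c_def by (subst salg_gen_commute) (auto simp: minus_one_power_iff mult.assoc)

lemma monomial_swap:
  "monomial m (u @ x # y # v) =
    (- 1) ^ ((par m (fst x) + par m (snd x)) * (par m (fst y) + par m (snd y))) *
      monomial m (u @ y # x # v)"
proof -
  have "monomial m (u @ x # y # v) =
      monomial m u * (c m (fst x) (snd x) * c m (fst y) (snd y)) * monomial m v"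
    by (simp add: monomial_def case_prod_unfold mult.assoc)
  also have "\<dots> = (- 1) ^ ((par m (fst x) + par m (snd x)) * (par m (fst y) + par m (snd y))) *
      (monomial m u * (c m (fst y) (snd y) * c m (fst x) (snd x)) * monomial m v)"
    unfolding c_commute[of m x y] by (simp add: minus_one_power_iff)
  finally show ?thesis
    by (simp add: monomial_def case_prod_unfold mult.assoc)
qed

text \<open>With parities \<open>x1, x2, y1, y2\<close>, only the contribution of the two exchanged
  letters changes, by \<open>x1 * y2 + x2 * y1\<close> modulo 2. Writing this as the product of
  \<open>x1 + x2\<close> and \<open>y1 + y2\<close>, plus \<open>x1 * y1 + x2 * y2\<close>,
  separates the sign of commuting the generators from the two action signs on \<open>i\<close> and
  \<open>j\<close>.\<close>

lemma chi_exponent_swap: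
  "(- 1 :: 'a::ring_1) ^ chi_exponent m (u @ x # y # v) =
    (- 1) ^ ((par m (fst x) + par m (snd x)) * (par m (fst y) + par m (snd y)) +
      par m (fst x) * par m (fst y) + par m (snd x) * par m (snd y)) *
    (- 1) ^ chi_exponent m (u @ y # x # v)"
proof -
  have "even (chi_exponent m (u @ x # y # v)) =
    even ((par m (fst x) + par m (snd x)) * (par m (fst y) + par m (snd y)) +
      par m (fst x) * par m (fst y) + par m (snd x) * par m (snd y) +
      chi_exponent m (u @ y # x # v))"
    by (auto simp: chi_exponent_append)
  then show ?thesis
    unfolding power_add[symmetric] by (simp add: minus_one_power_iff)
qed

text \<open>The length of the prefix is recorded because this splitting is later matched with a
  given one, and equal prefix lengths identify all parts.\<close>

lemma index_word_adjacent:
  assumes "t \<in> {1..r}" "Suc t \<in> {1..r}"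
  obtains u v where "index_word r i j = u @ (i t, j t) # (i (Suc t), j (Suc t)) # v"
    and "index_word r (i \<circ> transpose t (Suc t)) (j \<circ> transpose t (Suc t)) =
      u @ (i (Suc t), j (Suc t)) # (i t, j t) # v"
    and "length u = t - 1"
proof
  let ?f = "\<lambda>t. (i t, j t)"
  have split: "[1..<r + 1] = [1..<t] @ t # Suc t # [Suc (Suc t)..<r + 1]"
    using assms upt_add_eq_append[of 1 t "r + 1 - t"] by (simp add: upt_conv_Cons del: upt_Suc)
  show "index_word r i j =
      map ?f [1..<t] @ (i t, j t) # (i (Suc t), j (Suc t)) # map ?f [Suc (Suc t)..<r + 1]"
    unfolding index_word_def split by simp
  show "index_word r (i \<circ> transpose t (Suc t)) (j \<circ> transpose t (Suc t)) =
      map ?f [1..<t] @ (i (Suc t), j (Suc t)) # (i t, j t) # map ?f [Suc (Suc t)..<r + 1]"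
    unfolding index_word_def split by (simp add: transpose_apply_other del: upt_Suc)
  show "length (map ?f [1..<t]) = t - 1"
    by simp
qed

text \<open>The sign of commuting the generators cancels against the first summand in
  \<open>chi_exponent_swap\<close>; what is left is one action sign for \<open>i\<close> and one for
  \<open>j\<close>.\<close>

lemma chi_adjacent:
  assumes "t \<in> {1..r}" "Suc t \<in> {1..r}"
  shows "chi m r (i \<circ> transpose t (Suc t)) (j \<circ> transpose t (Suc t)) =
    of_int (star_sign m r i (transpose t (Suc t)) * star_sign m r j (transpose t (Suc t))) *
      chi m r i j"
proof -
  obtain u v where uv: "index_word r i j = u @ (i t, j t) # (i (Suc t), j (Suc t)) # v"
    "index_word r (i \<circ> transpose t (Suc t)) (j \<circ> transpose t (Suc t)) =
      u @ (i (Suc t), j (Suc t)) # (i t, j t) # v"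
    using index_word_adjacent[OF assms, of i j] by metis
  show ?thesis
    unfolding chi_eq uv star_sign_adjacent[OF assms]
      chi_exponent_swap[where 'a="(nat \<times> nat) salg", of m u "(i t, j t)"]
      monomial_swap[of m u "(i t, j t)"]
    by (auto simp: minus_one_power_iff par_def)
qed

text \<open>Adjacent transpositions generate the group and both signs are cocycles, so the adjacent
  case suffices. Since signs square to one, this is the invariance of \<open>chi\<close> under the
  signed action.\<close>

lemma chi_permutes:
  assumes "\<pi> permutes {1..r}"
  shows "chi m r (i \<circ> \<pi>) (j \<circ> \<pi>) = of_int (star_sign m r i \<pi> * star_sign m r j \<pi>) * chi m r i j"
  using assms
proof (induction arbitrary: i j rule: permutes_adjacent_induct)
  case id
  show ?case using star_sign_id[of m r] by (simp add: id_def)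
next
  case (adjacent t)
  then show ?case by (rule chi_adjacent)
next
  case (compose p q)
  have "chi m r (i \<circ> (p \<circ> q)) (j \<circ> (p \<circ> q)) =
      of_int (star_sign m r (i \<circ> p) q * star_sign m r (j \<circ> p) q) *
      (of_int (star_sign m r i p * star_sign m r j p) * chi m r i j)"
    using compose.IH(2)[of "i \<circ> p" "j \<circ> p"] compose.IH(1)[of i j] by (simp only: o_assoc)
  then show ?case
    by (simp only: star_sign_compose[OF compose.hyps] of_int_mult[symmetric] mult.assoc[symmetric])
      (simp only: ac_simps)
qed

lemma multiindices_compose:
  assumes "i \<in> multiindices m n r" "\<pi> permutes {1..r}"
  shows "i \<circ> \<pi> \<in> multiindices m n r"
  using assms permutes_in_image[OF assms(2)]
  by (auto simp: multiindices_def PiE_iff extensional_def permutes_def simp del: atLeastAtMost_iff)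

lemma finite_multiindices [simp]: "finite (multiindices m n r)"
  by (simp add: multiindices_def finite_PiE)

lemma multiindices_range: "i \<in> multiindices m n r \<Longrightarrow> t \<in> {1..r} \<Longrightarrow> i t \<in> {1..m + n}"
  by (auto simp: multiindices_def PiE_iff)

lemma index_word_range:
  assumes "i \<in> multiindices m n r" "j \<in> multiindices m n r"
  shows "length (index_word r i j) = r" "set (index_word r i j) \<subseteq> {1..m + n} \<times> {1..m + n}"
  using multiindices_range[OF assms(1)] multiindices_range[OF assms(2)]
  by (auto simp: index_word_def simp del: upt_Suc)

section \<open>Words and pairs of multiindices\<close>

text \<open>Together with \<open>word_right\<close> this inverts \<open>index_word\<close>.
  Positions count from 1 and list entries from 0; \<open>restrict\<close> lands in the extensional
  functions that make up \<open>multiindices\<close>.\<close>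

definition word_left :: "('a \<times> 'a) list \<Rightarrow> nat \<Rightarrow> 'a" where
  "word_left w = restrict (\<lambda>t. fst (w ! (t - 1))) {1..length w}"

definition word_right :: "('a \<times> 'a) list \<Rightarrow> nat \<Rightarrow> 'a" where
  "word_right w = restrict (\<lambda>t. snd (w ! (t - 1))) {1..length w}"

lemma word_left_right_mem:
  assumes "length w = r" "set w \<subseteq> {1..m + n} \<times> {1..m + n}"
  shows "word_left w \<in> multiindices m n r" "word_right w \<in> multiindices m n r"
proof -
  have "w ! (t - 1) \<in> {1..m + n} \<times> {1..m + n}" if "t \<in> {1..r}" for t
  proof -
    have "w ! (t - 1) \<in> set w" using that assms(1) by (intro nth_mem) auto
    with assms(2) show ?thesis by blast
  qed
  then show "word_left w \<in> multiindices m n r" "word_right w \<in> multiindices m n r"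
    by (auto simp: word_left_def word_right_def multiindices_def assms(1) mem_Times_iff simp del: atLeastAtMost_iff)
qed

lemma index_word_of_word: "index_word (length w) (word_left w) (word_right w) = w"
  by (rule nth_equalityI) (simp_all add: index_word_def word_left_def word_right_def del: upt_Suc)

lemma word_of_index_word:
  assumes "i \<in> multiindices m n r" "j \<in> multiindices m n r"
  shows "word_left (index_word r i j) = i" "word_right (index_word r i j) = j"
  using assms
  by (auto simp: fun_eq_iff word_left_def word_right_def index_word_def multiindices_def PiE_iff
      restrict_def extensional_def simp del: upt_Suc)

lemma monomial_eq_chi:
  assumes "length w = r"
  shows "monomial m w = (- 1) ^ chi_exponent m w * chi m r (word_left w) (word_right w)"
  using index_word_of_word[of w]
  by (simp add: chi_eq assms mult.assoc[symmetric] power_add[symmetric])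

section \<open>Linear maps prescribed on the spanning elements\<close>

text \<open>The linear map on the free associative algebra with values \<open>g\<close> on the basis
  of words. The target stays arbitrary because both rational functionals and operators are
  constructed this way.\<close>

definition word_extension ::
    "(rat \<Rightarrow> 'b \<Rightarrow> 'b::ab_group_add) \<Rightarrow> ('h list \<Rightarrow> 'b) \<Rightarrow> ('h word \<Rightarrow>\<^sub>0 rat) \<Rightarrow> 'b" where
  "word_extension scale g p =
     (\<Sum>w\<in>Poly_Mapping.keys p. scale (Poly_Mapping.lookup p w) (g (letters w)))"

lemma poly_mapping_single_induct [case_names single add]:
  assumes single: "\<And>k v. P (Poly_Mapping.single k v)"
    and add: "\<And>p q. P p \<Longrightarrow> P q \<Longrightarrow> P (p + q)"
  shows "P (p :: 'k \<Rightarrow>\<^sub>0 'v::comm_monoid_add)"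
proof (induction p rule: update_induct)
  case const
  then show ?case using single[of _ 0] by simp
next
  case (update f a b)
  have "Poly_Mapping.update a b f = f + Poly_Mapping.single a b"
    using update.hyps
    by (intro poly_mapping_eqI) (auto simp: update.rep_eq lookup_add lookup_single in_keys_iff when_def)
  then show ?case using update.IH single add by simp
qed

lemma word_extension_superset:
  assumes "vector_space scale" "finite S" "Poly_Mapping.keys p \<subseteq> S"
  shows "word_extension scale g p = (\<Sum>w\<in>S. scale (Poly_Mapping.lookup p w) (g (letters w)))"
proof -
  interpret vector_space scale by fact
  show ?thesis
    unfolding word_extension_def
    by (rule sum.mono_neutral_left) (use assms in \<open>auto simp: in_keys_iff\<close>)
qed

lemma word_extension_add:
  assumes "vector_space scale"
  shows "word_extension scale g (p + q) = word_extension scale g p + word_extension scale g q"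
proof -
  interpret vector_space scale by fact
  let ?S = "Poly_Mapping.keys p \<union> Poly_Mapping.keys q"
  show ?thesis
    using Poly_Mapping.keys_add[of p q]
    by (simp add: word_extension_superset[of scale ?S] vector_space_axioms lookup_add scale_left_distrib sum.distrib)
qed

lemma word_extension_single:
  assumes "vector_space scale"
  shows "word_extension scale g (Poly_Mapping.single w q) = scale q (g (letters w))"
proof -
  interpret vector_space scale by fact
  show ?thesis
    by (simp add: word_extension_superset[of scale "{w}"] vector_space_axioms)
qed

lemma word_extension_scale:
  assumes "vector_space scale"
  shows "word_extension scale g (Poly_Mapping.single 0 a * p) = scale a (word_extension scale g p)"
proof -
  interpret vector_space scale by fact
  show ?thesis
    by (induction p rule: poly_mapping_single_induct)
      (simp_all add: mult_single word_extension_single word_extension_add distrib_left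
        scale_right_distrib vector_space_axioms)
qed

lemma word_extension_minus:
  assumes "vector_space scale"
  shows "word_extension scale g (p - q) = word_extension scale g p - word_extension scale g q"
  using word_extension_add[OF assms, of g "p - q" q] by simp

text \<open>By bilinearity it suffices to put words around a supercommutator, and there the value
  vanishes precisely by \<open>swap\<close>. The factors \<open>a\<close> and \<open>b\<close> on
  both sides let the induction absorb multiplication by arbitrary elements.\<close>

lemma word_extension_ideal:
  fixes g :: "(bool \<times> 'g) list \<Rightarrow> 'b::ab_group_add"
  assumes vs: "vector_space scale"
    and swap: "\<And>u x y v. g (u @ x # y # v) =
      scale (if fst x \<and> fst y then - 1 else 1) (g (u @ y # x # v))"
    and "p \<in> scomm_ideal"
  shows "word_extension scale g (a * p * b) = 0"
  using assms(3)
proof (induction arbitrary: a b rule: scomm_ideal.induct)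
  case (supercommutator x y)
  interpret vector_space scale by fact
  let ?e = "if fst x \<and> fst y then - 1 else 1 :: (bool \<times> 'g) word \<Rightarrow>\<^sub>0 rat"
  let ?p = "letter x * letter y - ?e * letter y * letter x"
  show ?case
  proof (induction a rule: poly_mapping_single_induct)
    case (single w q)
    show ?case
    proof (induction b rule: poly_mapping_single_induct)
      case (single w' q')
      have e: "?e = Poly_Mapping.single 0 (if fst x \<and> fst y then - 1 else 1)"
        by (simp add: single_uminus)
      have "Poly_Mapping.single w q * ?p * Poly_Mapping.single w' q' =
          Poly_Mapping.single (w + Word [x] + Word [y] + w') (q * q') -
          Poly_Mapping.single (w + Word [y] + Word [x] + w')
            (q * (if fst x \<and> fst y then - 1 else 1) * q')"
        unfolding e letter_def
        by (simp add: left_diff_distrib right_diff_distrib mult_single add.assoc mult.assoc)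
      then show ?case
        using swap[of "letters w" x y "letters w'"]
        by (simp only: word_extension_minus[OF vs] word_extension_single[OF vs])
          (simp add: plus_word_def mult.commute mult.left_commute)
    next
      case (add p q)
      then show ?case
        by (simp only: distrib_left word_extension_add[OF vs]) simp
    qed
  next
    case (add p q)
    then show ?case
      by (simp only: distrib_right word_extension_add[OF vs]) simp
  qed
next
  case zero
  show ?case by (simp add: word_extension_def)
next
  case (add p q)
  then show ?case
    by (simp add: distrib_left distrib_right word_extension_add[OF vs])
next
  case (mult_left p d)
  show ?case using mult_left.IH[of "a * d" b] by (simp add: mult.assoc)
next
  case (mult_right p d)
  show ?case using mult_right.IH[of a "d * b"] by (simp add: mult.assoc)
qed

text \<open>The universal property of the quotient: the relations only exchange neighbouring
  letters, so a map on words obeying the exchange rule descends.\<close>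

lemma linear_map_from_words:
  fixes g :: "(bool \<times> 'g) list \<Rightarrow> 'b::ab_group_add"
  assumes vs: "vector_space scale"
    and swap: "\<And>u x y v. g (u @ x # y # v) =
      scale (if fst x \<and> fst y then - 1 else 1) (g (u @ y # x # v))"
  obtains G :: "'g salg \<Rightarrow> 'b" where "\<And>x y. G (x + y) = G x + G y"
    and "\<And>q x. G (qscale q x) = scale q (G x)"
    and "\<And>w. G (prod_list (map salg_gen w)) = g w"
proof -
  \<comment> \<open>\<open>rep_salg\<close> picks a representative. Two representatives differ by an
    element of the ideal, where the extension vanishes, so \<open>abs\<close> holds for every
    choice.\<close>
  define G where "G x = word_extension scale g (rep_salg x)" for x
  have abs: "G (abs_salg p) = word_extension scale g p" for p
  proof -
    have "scomm_rel (rep_salg (abs_salg p)) p"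
      by (rule Quotient_rep_abs[OF Quotient_salg]) (simp add: scomm_rel_def scomm_ideal.zero)
    then show ?thesis
      using word_extension_ideal[OF vs swap, of "rep_salg (abs_salg p) - p" 1 1]
      by (simp add: G_def scomm_rel_def word_extension_minus[OF vs])
  qed
  show thesis
  proof (rule that)
    show "G (x + y) = G x + G y" for x y
    proof (induction x rule: salg.abs_induct, induction y rule: salg.abs_induct)
      fix p q
      show "G (abs_salg q + abs_salg p) = G (abs_salg q) + G (abs_salg p)"
        by (simp add: plus_salg.abs_eq abs word_extension_add[OF vs])
    qed
    show "G (qscale q x) = scale q (G x)" for q x
    proof (induction x rule: salg.abs_induct)
      fix p
      show "G (qscale q (abs_salg p)) = scale q (G (abs_salg p))"
        by (simp add: qscale_def salg_const.abs_eq times_salg.abs_eq abs word_extension_scale[OF vs])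
    qed
    show "G (prod_list (map salg_gen w)) = g w" for w
    proof -
      interpret vector_space scale by fact
      have "prod_list (map salg_gen w) = abs_salg (Poly_Mapping.single (Word w) 1)"
      proof (induction w)
        case Nil
        show ?case by (simp add: one_salg.abs_eq zero_word_def[symmetric])
      next
        case (Cons x w)
        then show ?case
          by (simp add: salg_gen.abs_eq letter_def times_salg.abs_eq mult_single plus_word_def)
      qed
      then show ?thesis
        by (simp add: abs word_extension_single[OF vs])
    qed
  qed
qed

lemma qscale_neg_one_power: "(- 1) ^ k * x = qscale ((- 1) ^ k) x"
  by (cases "even k") (simp_all add: q_mod.scale_minus_left)

section \<open>Linear maps on the degree \<open>r\<close> part, determined by the spanning
  elements\<close>

lemma A_deg_eq_span_chi:
  "A_deg m n r = q_mod.span {chi m r i j | i j. i \<in> multiindices m n r \<and> j \<in> multiindices m n r}"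
    (is "_ = q_mod.span ?C")
proof (rule antisym)
  show "A_deg m n r \<subseteq> q_mod.span ?C"
    unfolding A_deg_def monomial_def[symmetric]
  proof (rule q_mod.span_minimal, clarify)
    fix w :: "(nat \<times> nat) list"
    assume w: "set w \<subseteq> {1..m + n} \<times> {1..m + n}" "r = length w"
    then have "chi m r (word_left w) (word_right w) \<in> ?C"
      using word_left_right_mem[of w r m n] by blast
    then show "monomial m w \<in> q_mod.span {chi m (length w) i j | i j.
        i \<in> multiindices m n (length w) \<and> j \<in> multiindices m n (length w)}"
      using w(2) by (simp only: monomial_eq_chi[OF refl] qscale_neg_one_power)
        (intro q_mod.span_scale q_mod.span_base)
  qed simp
  show "q_mod.span ?C \<subseteq> A_deg m n r"
    unfolding A_deg_def monomial_def[symmetric]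
  proof (rule q_mod.span_minimal, clarify)
    fix i j assume "i \<in> multiindices m n r" "j \<in> multiindices m n r"
    then show "chi m r i j \<in> q_mod.span {monomial m w | w.
        length w = r \<and> set w \<subseteq> {1..m + n} \<times> {1..m + n}}"
      unfolding chi_eq qscale_neg_one_power using index_word_range
      by (intro q_mod.span_scale q_mod.span_base) blast
  qed simp
qed

lemma chi_in_A_deg:
  "i \<in> multiindices m n r \<Longrightarrow> j \<in> multiindices m n r \<Longrightarrow> chi m r i j \<in> A_deg m n r"
  unfolding A_deg_eq_span_chi by (rule q_mod.span_base) blast

lemma subspace_A_deg: "q_mod.subspace (A_deg m n r)"
  unfolding A_deg_def by simp

lemma linear_on_add:
  "linear_on scale V F \<Longrightarrow> x \<in> V \<Longrightarrow> y \<in> V \<Longrightarrow> F (x + y) = F x + F y"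
  by (simp add: linear_on_def)

lemma linear_on_scale: "linear_on scale V F \<Longrightarrow> x \<in> V \<Longrightarrow> F (qscale q x) = scale q (F x)"
  by (simp add: linear_on_def)

lemma linear_on_zero:
  assumes "linear_on scale V F" "q_mod.subspace V"
  shows "F 0 = 0"
  using linear_on_add[OF assms(1), of 0 0] q_mod.subspace_0[OF assms(2)] by simp

lemma linear_on_sum:
  assumes "linear_on scale V F" "q_mod.subspace V" "\<And>a. a \<in> A \<Longrightarrow> f a \<in> V"
  shows "F (\<Sum>a\<in>A. f a) = (\<Sum>a\<in>A. F (f a))"
  using assms(3)
proof (induction A rule: infinite_finite_induct)
  case (insert a A)
  then have "F (f a + (\<Sum>a\<in>A. f a)) = F (f a) + F (\<Sum>a\<in>A. f a)"
    by (intro linear_on_add[OF assms(1)] q_mod.subspace_sum[OF assms(2)]) auto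
  then show ?case using insert by simp
qed (simp_all add: linear_on_zero[OF assms(1,2)])

text \<open>The set of agreement is a subspace containing a spanning set; outside
  \<open>A_deg m n r\<close> both maps are zero by convention, so they agree as functions.\<close>

lemma linear_on_eqI:
  assumes F: "linear_on scale (A_deg m n r) F" and G: "linear_on scale (A_deg m n r) G"
    and eq: "\<And>i j. i \<in> multiindices m n r \<Longrightarrow> j \<in> multiindices m n r \<Longrightarrow>
      F (chi m r i j) = G (chi m r i j)"
  shows "F = G"
proof -
  let ?E = "{x\<in>A_deg m n r. F x = G x}"
  have "q_mod.subspace ?E"
    using subspace_A_deg[of m n r]
    by (intro q_mod.subspaceI)
      (auto simp: linear_on_zero[OF F] linear_on_zero[OF G] linear_on_add[OF F] linear_on_add[OF G]
        linear_on_scale[OF F] linear_on_scale[OF G]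
        intro: q_mod.subspace_0 q_mod.subspace_add q_mod.subspace_scale)
  moreover have "{chi m r i j | i j. i \<in> multiindices m n r \<and> j \<in> multiindices m n r} \<subseteq> ?E"
    using eq chi_in_A_deg by blast
  ultimately have "A_deg m n r \<subseteq> ?E"
    unfolding A_deg_eq_span_chi[of m n r] by (rule q_mod.span_minimal[rotated])
  then have "F x = G x" for x
    using F G by (cases "x \<in> A_deg m n r") (auto simp: linear_on_def)
  then show ?thesis by blast
qed

text \<open>The word is compared with the splitting of its \<open>index_word\<close> at position
  \<open>t\<close>. The shift in \<open>t\<close> turns the list index of \<open>x\<close> into a
  position counted from 1.\<close>

lemma word_left_right_swap:
  fixes u v :: "(nat \<times> nat) list"
  defines "t \<equiv> Suc (length u)"
  assumes "length (u @ x # y # v) = r" "set (u @ x # y # v) \<subseteq> {1..m + n} \<times> {1..m + n}"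
  shows "word_left (u @ y # x # v) = word_left (u @ x # y # v) \<circ> transpose t (Suc t)" (is ?L)
    and "word_right (u @ y # x # v) = word_right (u @ x # y # v) \<circ> transpose t (Suc t)" (is ?R)
    and "x = (word_left (u @ x # y # v) t, word_right (u @ x # y # v) t)" (is ?x)
    and "y = (word_left (u @ x # y # v) (Suc t), word_right (u @ x # y # v) (Suc t))" (is ?y)
proof -
  define i j where ij: "i = word_left (u @ x # y # v)" "j = word_right (u @ x # y # v)"
  have t: "t \<in> {1..r}" "Suc t \<in> {1..r}"
    using assms by auto
  have iw: "index_word r i j = u @ x # y # v"
    unfolding ij using index_word_of_word assms(2) by blast
  obtain u' v' where uv: "index_word r i j = u' @ (i t, j t) # (i (Suc t), j (Suc t)) # v'"
    "index_word r (i \<circ> transpose t (Suc t)) (j \<circ> transpose t (Suc t)) =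
      u' @ (i (Suc t), j (Suc t)) # (i t, j t) # v'" "length u' = t - 1"
    using index_word_adjacent[OF t] by metis
  have "u @ x # y # v = u' @ (i t, j t) # (i (Suc t), j (Suc t)) # v'"
    using uv(1) iw by (rule trans[OF sym, rotated])
  moreover have "length u = length u'"
    using uv(3) by (simp add: t_def)
  ultimately have eq: "u' = u" "x = (i t, j t)" "y = (i (Suc t), j (Suc t))" "v' = v"
    by (metis append_eq_append_conv list.inject)+
  have mem: "i \<in> multiindices m n r" "j \<in> multiindices m n r"
    unfolding ij by (rule word_left_right_mem[OF assms(2,3)])+
  have tr: "transpose t (Suc t) permutes {1..r}"
    using t by (rule permutes_swap_id)
  have "index_word r (i \<circ> transpose t (Suc t)) (j \<circ> transpose t (Suc t)) = u @ y # x # v"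
    using uv(2) by (simp only: eq)
  then show ?L ?R
    using word_of_index_word[OF multiindices_compose[OF mem(1) tr] multiindices_compose[OF mem(2) tr]]
    by (simp_all only: ij)
  show ?x ?y
    using eq(2,3) unfolding ij .
qed

text \<open>The elements \<open>chi\<close> satisfy linear relations in general, so values on them
  cannot be chosen freely. Values are instead chosen on words: with the Koszul sign built in,
  equivariance under adjacent transpositions becomes the exchange rule, and the universal property
  applies.\<close>

lemma chi_extension:
  fixes scale :: "rat \<Rightarrow> 'b \<Rightarrow> 'b::ab_group_add"
  assumes vs: "vector_space scale"
    and equivariant: "\<And>i j \<pi>. i \<in> multiindices m n r \<Longrightarrow> j \<in> multiindices m n r \<Longrightarrow>
      \<pi> permutes {1..r} \<Longrightarrow>
      f (i \<circ> \<pi>) (j \<circ> \<pi>) = scale (of_int (star_sign m r i \<pi> * star_sign m r j \<pi>)) (f i j)"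
  obtains F where "linear_on scale (A_deg m n r) F"
    and "\<And>i j. i \<in> multiindices m n r \<Longrightarrow> j \<in> multiindices m n r \<Longrightarrow> F (chi m r i j) = f i j"
proof -
  interpret vector_space scale by fact
  \<comment> \<open>A letter of the ambient algebra has an arbitrary parity flag and label;
    \<open>ok\<close> singles out those that occur as some \<open>c m a b\<close> with symbols in
    range.\<close>
  define ok where "ok z \<longleftrightarrow> fst z = odd (par m (fst (snd z)) + par m (snd (snd z))) \<and>
      snd z \<in> {1..m + n} \<times> {1..m + n}" for z :: "bool \<times> nat \<times> nat"
  define valid where "valid w \<longleftrightarrow> length w = r \<and> Ball (set w) ok" for w
  \<comment> \<open>Words that are not valid get the value 0. Validity does not depend on the order
    of the letters, so the exchange rule is trivial for them.\<close>
  define g where "g w = (if valid w then scale ((- 1) ^ chi_exponent m (map snd w))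
      (f (word_left (map snd w)) (word_right (map snd w))) else 0)" for w
  have swap: "g (u @ x # y # v) = scale (if fst x \<and> fst y then - 1 else 1) (g (u @ y # x # v))"
    for u x y v
  proof (cases "valid (u @ x # y # v)")
    case True
    let ?u = "map snd u" and ?v = "map snd v" and ?x = "snd x" and ?y = "snd y"
    let ?W = "?u @ ?x # ?y # ?v" and ?W' = "?u @ ?y # ?x # ?v"
    define t where "t = Suc (length ?u)"
    have valid': "valid (u @ y # x # v)"
      using True by (auto simp: valid_def)
    have "length ?W = r" "set ?W \<subseteq> snd ` Collect ok"
      using True by (auto simp: valid_def)
    moreover have "snd ` Collect ok \<subseteq> {1..m + n} \<times> {1..m + n}"
      unfolding ok_def by blast
    ultimately have W: "length ?W = r" "set ?W \<subseteq> {1..m + n} \<times> {1..m + n}"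
      by (blast intro: order_trans)+
    note sw = word_left_right_swap[OF W, folded t_def]
    have t: "t \<in> {1..r}" "Suc t \<in> {1..r}"
      using W(1) by (auto simp: t_def)
    have tr: "transpose t (Suc t) permutes {1..r}"
      using t by (rule permutes_swap_id)
    have xy: "fst x = odd (par m (fst ?x) + par m (snd ?x))"
      "fst y = odd (par m (fst ?y) + par m (snd ?y))"
      using True by (simp_all add: valid_def ok_def)
    have xw: "fst ?x = word_left ?W t" "snd ?x = word_right ?W t"
      "fst ?y = word_left ?W (Suc t)" "snd ?y = word_right ?W (Suc t)"
      using sw(3,4) by (metis fst_conv snd_conv)+
    have "f (word_left ?W') (word_right ?W') =
        scale ((- 1) ^ (par m (fst ?x) * par m (fst ?y)) * (- 1) ^ (par m (snd ?x) * par m (snd ?y)))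
          (f (word_left ?W) (word_right ?W))"
      unfolding sw(1,2) equivariant[OF word_left_right_mem[OF W] tr] star_sign_adjacent[OF t] xw
      by simp
    then show ?thesis
      using True valid' xy
      by (simp add: g_def chi_exponent_swap[where 'a=rat, of m ?u ?x ?y] par_def)
  next
    case False
    then show ?thesis by (auto simp: g_def valid_def)
  qed
  obtain G :: "(nat \<times> nat) salg \<Rightarrow> 'b" where G: "\<And>x y. G (x + y) = G x + G y"
    "\<And>q x. G (qscale q x) = scale q (G x)" "\<And>w. G (prod_list (map salg_gen w)) = g w"
    using linear_map_from_words[OF vs swap] by blast
  \<comment> \<open>\<open>G\<close> is linear on the whole algebra; \<open>linear_on\<close> asks
    for extension by zero off the degree \<open>r\<close> part.\<close>
  define F where "F x = (if x \<in> A_deg m n r then G x else 0)" for x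
  have "linear_on scale (A_deg m n r) F"
    unfolding linear_on_def F_def using G q_mod.subspace_add[OF subspace_A_deg]
      q_mod.subspace_scale[OF subspace_A_deg]
    by simp
  moreover have "F (chi m r i j) = f i j"
    if ij: "i \<in> multiindices m n r" "j \<in> multiindices m n r" for i j
  proof -
    let ?w = "index_word r i j"
    let ?w' = "map (\<lambda>(a, b). (odd (par m a + par m b), (a, b))) ?w"
    have w': "map snd ?w' = ?w"
      by (simp add: comp_def case_prod_unfold)
    have "monomial m ?w = prod_list (map salg_gen ?w')"
      by (simp add: monomial_def c_def comp_def case_prod_unfold)
    moreover have "valid ?w'"
      using index_word_range[OF ij] by (auto simp: valid_def ok_def)
    ultimately have "G (monomial m ?w) = scale ((- 1) ^ chi_exponent m ?w) (f i j)"
      by (simp only: G(3) g_def w' word_of_index_word[OF ij] if_True)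
    then show ?thesis
      using chi_in_A_deg[OF ij]
      by (simp add: F_def chi_eq qscale_neg_one_power G(2) power_add[symmetric])
  qed
  ultimately show thesis by (rule that)
qed

section \<open>The actions on symmetrizers\<close>

lemma salg_const_of_int: "salg_const (of_int k) = of_int k"
proof -
  have zero: "salg_const 0 = (0 :: 'a salg)"
    using salg_const_add[of 0 0, where 'a='a] by simp
  have nat: "salg_const (of_nat n) = (of_nat n :: 'a salg)" for n
    by (induction n) (simp_all add: zero salg_const_add salg_const_one)
  have "salg_const (- q) = - (salg_const q :: 'a salg)" for q
    using salg_const_add[of "- q" q, where 'a='a] zero by (simp add: add_eq_0_iff2)
  then show ?thesis
    by (cases k) (use nat in \<open>simp_all del: of_nat_Suc\<close>)
qed

lemma of_int_mult_eq_qscale: "of_int k * x = qscale (of_int k) x"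
  by (simp add: qscale_def salg_const_of_int)

section \<open>Well-definedness of the left and right actions\<close>

lemma sum_multiindices_compose:
  assumes "\<pi> permutes {1..r}"
  shows "(\<Sum>a\<in>multiindices m n r. f (a \<circ> \<pi>)) = (\<Sum>a\<in>multiindices m n r. f a)"
proof (rule sum.reindex_bij_witness[of _ "\<lambda>a. a \<circ> inv \<pi>" "\<lambda>a. a \<circ> \<pi>"])
  fix a assume "a \<in> multiindices m n r"
  then show "a \<circ> \<pi> \<in> multiindices m n r" "a \<circ> inv \<pi> \<in> multiindices m n r"
    using assms by (blast intro: multiindices_compose permutes_inv)+
  show "(a \<circ> \<pi>) \<circ> inv \<pi> = a" "(a \<circ> inv \<pi>) \<circ> \<pi> = a"
    using permutes_inv_o[OF assms] by (simp_all add: comp_assoc)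
qed simp

abbreviation rat_sign :: "nat \<Rightarrow> nat \<Rightarrow> (nat \<Rightarrow> nat) \<Rightarrow> (nat \<Rightarrow> nat) \<Rightarrow> rat" where
  "rat_sign m r j \<pi> \<equiv> of_int (star_sign m r j \<pi>)"

lemma rat_sign_mult_self [simp]: "rat_sign m r j \<pi> * rat_sign m r j \<pi> = 1"
  by (simp only: of_int_mult[symmetric] star_sign_mult_self of_int_1)

text \<open>Here \<open>x\<close> is the sign that occurs twice when a sum is reindexed. The first
  two identities serve the left and right actions on \<open>chi\<close>, the last two those on
  symmetrizers.\<close>

lemma sign_cancel:
  fixes w x y z q :: rat
  assumes "x * x = 1"
  shows "(x * y * q) * (z * x) = z * y * q" "(z * x * q) * (x * y) = z * y * q"
    "(z * y * x) * (w * x * q) = q * (z * y * w)" "(z * x * y) * (x * w * q) = q * (z * w * y)"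
  using assms by algebra+

lemma chi_permutes_scale:
  assumes "\<pi> permutes {1..r}"
  shows "chi m r (i \<circ> \<pi>) (j \<circ> \<pi>) = qscale (rat_sign m r i \<pi> * rat_sign m r j \<pi>) (chi m r i j)"
  by (simp only: chi_permutes[OF assms]
      of_int_mult_eq_qscale[of "star_sign m r i \<pi> * star_sign m r j \<pi>"])
    (simp only: of_int_mult)

lemma S_Q_chi_permutes:
  assumes "\<xi> \<in> S_Q m n r" "i \<in> multiindices m n r" "j \<in> multiindices m n r" "\<pi> permutes {1..r}"
  shows "\<xi> (chi m r (i \<circ> \<pi>) (j \<circ> \<pi>)) = rat_sign m r i \<pi> * rat_sign m r j \<pi> * \<xi> (chi m r i j)"
  using assms(1) chi_in_A_deg[OF assms(2,3)]
  by (simp add: S_Q_def linear_on_scale chi_permutes_scale[OF assms(4)])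

text \<open>Existence is \<open>chi_extension\<close> and uniqueness is
  \<open>linear_on_eqI\<close>, so the definite descriptions that define the two actions denote the
  intended maps.\<close>

lemma chi_extension_The:
  fixes scale :: "rat \<Rightarrow> 'b \<Rightarrow> 'b::ab_group_add"
  assumes "vector_space scale"
    and "\<And>i j \<pi>. i \<in> multiindices m n r \<Longrightarrow> j \<in> multiindices m n r \<Longrightarrow> \<pi> permutes {1..r} \<Longrightarrow>
      f (i \<circ> \<pi>) (j \<circ> \<pi>) = scale (rat_sign m r i \<pi> * rat_sign m r j \<pi>) (f i j)"
  defines "F0 \<equiv> (THE F. linear_on scale (A_deg m n r) F \<and>
    (\<forall>i\<in>multiindices m n r. \<forall>j\<in>multiindices m n r. F (chi m r i j) = f i j))"
  shows "linear_on scale (A_deg m n r) F0"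
    and "\<And>i j. i \<in> multiindices m n r \<Longrightarrow> j \<in> multiindices m n r \<Longrightarrow> F0 (chi m r i j) = f i j"
proof -
  let ?P = "\<lambda>F. linear_on scale (A_deg m n r) F \<and>
    (\<forall>i\<in>multiindices m n r. \<forall>j\<in>multiindices m n r. F (chi m r i j) = f i j)"
  obtain F where F: "linear_on scale (A_deg m n r) F"
    "\<And>i j. i \<in> multiindices m n r \<Longrightarrow> j \<in> multiindices m n r \<Longrightarrow> F (chi m r i j) = f i j"
    by (rule chi_extension[OF assms(1), of m n r f]) (simp_all add: assms(2))
  have "?P F0"
    unfolding F0_def
  proof (rule theI[of ?P F])
    show "?P F" using F by simp
    fix G assume G: "?P G"
    show "G = F"
      by (rule linear_on_eqI[of scale m n r]) (use F G in simp_all)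
  qed
  then show "linear_on scale (A_deg m n r) F0"
    "\<And>i j. i \<in> multiindices m n r \<Longrightarrow> j \<in> multiindices m n r \<Longrightarrow> F0 (chi m r i j) = f i j"
    by blast+
qed

lemma vector_space_qscale: "vector_space (qscale :: rat \<Rightarrow> 'g salg \<Rightarrow> 'g salg)"
  by (rule q_mod.vector_space_axioms)

text \<open>Substituting \<open>a \<circ> \<pi>\<close> for the summation index lets equivariance be
  applied to both factors, and the sign of \<open>a\<close> cancels because it occurs twice.\<close>

lemma left_act_chi:
  assumes \<xi>: "\<xi> \<in> S_Q m n r"
  shows "linear_on qscale (A_deg m n r) (left_act m n r \<xi>)"
    and "\<And>i j. i \<in> multiindices m n r \<Longrightarrow> j \<in> multiindices m n r \<Longrightarrow>
      left_act m n r \<xi> (chi m r i j) =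
        (\<Sum>a\<in>multiindices m n r. qscale (\<xi> (chi m r a j)) (chi m r i a))"
proof -
  define f where "f i j = (\<Sum>a\<in>multiindices m n r. qscale (\<xi> (chi m r a j)) (chi m r i a))" for i j
  have equivariant: "f (i \<circ> \<pi>) (j \<circ> \<pi>) = qscale (rat_sign m r i \<pi> * rat_sign m r j \<pi>) (f i j)"
    if ij: "i \<in> multiindices m n r" "j \<in> multiindices m n r" and \<pi>: "\<pi> permutes {1..r}" for i j \<pi>
  proof -
    have "f (i \<circ> \<pi>) (j \<circ> \<pi>) =
        (\<Sum>a\<in>multiindices m n r. qscale (\<xi> (chi m r (a \<circ> \<pi>) (j \<circ> \<pi>))) (chi m r (i \<circ> \<pi>) (a \<circ> \<pi>)))"
      unfolding f_def by (rule sum_multiindices_compose[OF \<pi>, symmetric])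
    also have "\<dots> = (\<Sum>a\<in>multiindices m n r.
        qscale (rat_sign m r i \<pi> * rat_sign m r j \<pi>) (qscale (\<xi> (chi m r a j)) (chi m r i a)))"
      using ij by (intro sum.cong refl)
        (simp only: S_Q_chi_permutes[OF \<xi> _ _ \<pi>],
          simp only: chi_permutes_scale[OF \<pi>] q_mod.scale_scale sign_cancel[OF rat_sign_mult_self])
    finally show ?thesis
      by (simp add: f_def q_mod.scale_sum_right)
  qed
  have eq: "left_act m n r \<xi> = (THE F. linear_on qscale (A_deg m n r) F \<and>
      (\<forall>i\<in>multiindices m n r. \<forall>j\<in>multiindices m n r. F (chi m r i j) = f i j))"
    unfolding left_act_def f_def ..
  show "linear_on qscale (A_deg m n r) (left_act m n r \<xi>)"
    unfolding eq by (rule chi_extension_The(1)[OF vector_space_qscale equivariant])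
  show "left_act m n r \<xi> (chi m r i j) =
      (\<Sum>a\<in>multiindices m n r. qscale (\<xi> (chi m r a j)) (chi m r i a))"
    if "i \<in> multiindices m n r" "j \<in> multiindices m n r" for i j
    using chi_extension_The(2)[OF vector_space_qscale equivariant that]
    unfolding eq f_def[of i j] .
qed

lemma right_act_chi:
  assumes \<xi>: "\<xi> \<in> S_Q m n r"
  shows "linear_on qscale (A_deg m n r) (\<lambda>x. right_act m n r x \<xi>)"
    and "\<And>i j. i \<in> multiindices m n r \<Longrightarrow> j \<in> multiindices m n r \<Longrightarrow>
      right_act m n r (chi m r i j) \<xi> =
        (\<Sum>b\<in>multiindices m n r. qscale (\<xi> (chi m r i b)) (chi m r b j))"
proof -
  define f where "f i j = (\<Sum>b\<in>multiindices m n r. qscale (\<xi> (chi m r i b)) (chi m r b j))" for i j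
  have equivariant: "f (i \<circ> \<pi>) (j \<circ> \<pi>) = qscale (rat_sign m r i \<pi> * rat_sign m r j \<pi>) (f i j)"
    if ij: "i \<in> multiindices m n r" "j \<in> multiindices m n r" and \<pi>: "\<pi> permutes {1..r}" for i j \<pi>
  proof -
    have "f (i \<circ> \<pi>) (j \<circ> \<pi>) =
        (\<Sum>b\<in>multiindices m n r. qscale (\<xi> (chi m r (i \<circ> \<pi>) (b \<circ> \<pi>))) (chi m r (b \<circ> \<pi>) (j \<circ> \<pi>)))"
      unfolding f_def by (rule sum_multiindices_compose[OF \<pi>, symmetric])
    also have "\<dots> = (\<Sum>b\<in>multiindices m n r.
        qscale (rat_sign m r i \<pi> * rat_sign m r j \<pi>) (qscale (\<xi> (chi m r i b)) (chi m r b j)))"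
      using ij by (intro sum.cong refl)
        (simp only: S_Q_chi_permutes[OF \<xi> _ _ \<pi>],
          simp only: chi_permutes_scale[OF \<pi>] q_mod.scale_scale sign_cancel[OF rat_sign_mult_self])
    finally show ?thesis
      by (simp add: f_def q_mod.scale_sum_right)
  qed
  \<comment> \<open>\<open>right_act\<close> takes the element before the functional, so the
    described linear map appears under an abstraction over \<open>x\<close>.\<close>
  have eq: "(\<lambda>x. right_act m n r x \<xi>) = (THE F. linear_on qscale (A_deg m n r) F \<and>
      (\<forall>i\<in>multiindices m n r. \<forall>j\<in>multiindices m n r. F (chi m r i j) = f i j))"
    unfolding right_act_def f_def ..
  show "linear_on qscale (A_deg m n r) (\<lambda>x. right_act m n r x \<xi>)"
    unfolding eq by (rule chi_extension_The(1)[OF vector_space_qscale equivariant])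
  show "right_act m n r (chi m r i j) \<xi> =
      (\<Sum>b\<in>multiindices m n r. qscale (\<xi> (chi m r i b)) (chi m r b j))"
    if "i \<in> multiindices m n r" "j \<in> multiindices m n r" for i j
    using chi_extension_The(2)[OF vector_space_qscale equivariant that]
    unfolding eq[symmetric] f_def[of i j] .
qed

section \<open>Row and column groups as groups preserving a labelling\<close>

text \<open>Row groups, column groups and the stabilizers of multiindices in them are all of this
  form for suitable labels \<open>h\<close>, so group laws, orders and Lagrange's theorem are proved
  once for all of them.\<close>

definition fiber_group :: "nat \<Rightarrow> (nat \<Rightarrow> 'a) \<Rightarrow> (nat \<Rightarrow> nat) set" where
  "fiber_group r h = {\<pi>. \<pi> permutes {1..r} \<and> (\<forall>t\<in>{1..r}. h (\<pi> t) = h t)}"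

lemma fiber_group_permutes: "\<pi> \<in> fiber_group r h \<Longrightarrow> \<pi> permutes {1..r}"
  by (simp add: fiber_group_def)

lemma finite_fiber_group [simp]: "finite (fiber_group r h)"
  by (rule finite_subset[OF _ finite_permutations[of "{1..r}"]]) (auto simp: fiber_group_def)

lemma id_fiber_group: "id \<in> fiber_group r h"
  by (simp add: fiber_group_def permutes_id)

lemma compose_fiber_group:
  assumes "\<pi> \<in> fiber_group r h" "\<sigma> \<in> fiber_group r h"
  shows "\<pi> \<circ> \<sigma> \<in> fiber_group r h"
  using assms permutes_in_image[OF fiber_group_permutes[OF assms(2)]]
  by (simp add: fiber_group_def permutes_compose del: atLeastAtMost_iff)

lemma inv_fiber_group:
  assumes "\<pi> \<in> fiber_group r h"
  shows "inv \<pi> \<in> fiber_group r h"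
proof -
  note \<pi> = fiber_group_permutes[OF assms]
  have "h (inv \<pi> t) = h t" if "t \<in> {1..r}" for t
  proof -
    have "inv \<pi> t \<in> {1..r}"
      using that permutes_in_image[OF permutes_inv[OF \<pi>]] by blast
    then have "h (\<pi> (inv \<pi> t)) = h (inv \<pi> t)"
      using assms unfolding fiber_group_def by blast
    then show ?thesis
      by (simp only: permutes_inverses(1)[OF \<pi>])
  qed
  then show ?thesis
    using permutes_inv[OF \<pi>] by (simp add: fiber_group_def)
qed

lemma sum_fiber_group_compose:
  assumes "\<pi> \<in> fiber_group r h"
  shows "(\<Sum>\<sigma>\<in>fiber_group r h. f (\<pi> \<circ> \<sigma>)) = (\<Sum>\<sigma>\<in>fiber_group r h. f \<sigma>)"
proof (rule sum.reindex_bij_witness[of _ "\<lambda>\<sigma>. inv \<pi> \<circ> \<sigma>" "\<lambda>\<sigma>. \<pi> \<circ> \<sigma>"])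
  fix \<sigma> assume "\<sigma> \<in> fiber_group r h"
  then show "\<pi> \<circ> \<sigma> \<in> fiber_group r h" "inv \<pi> \<circ> \<sigma> \<in> fiber_group r h"
    using assms by (auto intro: compose_fiber_group inv_fiber_group)
  show "inv \<pi> \<circ> (\<pi> \<circ> \<sigma>) = \<sigma>" "\<pi> \<circ> (inv \<pi> \<circ> \<sigma>) = \<sigma>"
    using permutes_inv_o[OF fiber_group_permutes[OF assms]] by (simp_all add: comp_assoc[symmetric])
qed simp

definition tableau_row :: "nat list \<Rightarrow> (nat \<times> nat \<Rightarrow> nat) \<Rightarrow> nat \<Rightarrow> nat" where
  "tableau_row lam T t = fst (inv_into (diagram lam) T t)"

definition tableau_col :: "nat list \<Rightarrow> (nat \<times> nat \<Rightarrow> nat) \<Rightarrow> nat \<Rightarrow> nat" where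
  "tableau_col lam T t = snd (inv_into (diagram lam) T t)"

lemma tableau_row_apply:
  assumes "basic_tableau r lam T" "b \<in> diagram lam"
  shows "tableau_row lam T (T b) = fst b"
  using assms by (simp add: tableau_row_def basic_tableau_def bij_betw_def)

lemma tableau_col_apply:
  assumes "basic_tableau r lam T" "b \<in> diagram lam"
  shows "tableau_col lam T (T b) = snd b"
  using assms by (simp add: tableau_col_def basic_tableau_def bij_betw_def)

lemma basic_tableau_obtain:
  assumes "basic_tableau r lam T" "t \<in> {1..r}"
  obtains b where "b \<in> diagram lam" "t = T b"
proof -
  have "t \<in> T ` diagram lam"
    using assms by (simp add: basic_tableau_def bij_betw_def)
  then show thesis
    using that by blast
qed

lemma basic_tableau_range: "basic_tableau r lam T \<Longrightarrow> b \<in> diagram lam \<Longrightarrow> T b \<in> {1..r}"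
  unfolding basic_tableau_def by (rule bij_betwE[THEN bspec])

lemma row_group_eq:
  assumes T: "basic_tableau r lam T"
  shows "row_group r lam T = fiber_group r (tableau_row lam T)"
proof (rule set_eqI, unfold row_group_def fiber_group_def mem_Collect_eq, rule conj_cong[OF refl])
  fix \<pi> assume \<pi>: "\<pi> permutes {1..r}"
  show "(\<forall>b\<in>diagram lam. \<exists>b'\<in>diagram lam. fst b' = fst b \<and> \<pi> (T b) = T b') \<longleftrightarrow>
      (\<forall>t\<in>{1..r}. tableau_row lam T (\<pi> t) = tableau_row lam T t)"
  proof safe
    fix t assume L: "\<forall>b\<in>diagram lam. \<exists>b'\<in>diagram lam. fst b' = fst b \<and> \<pi> (T b) = T b'"
      and "t \<in> {1..r}"
    then obtain b where "b \<in> diagram lam" "t = T b"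
      using basic_tableau_obtain[OF T] by blast
    with L show "tableau_row lam T (\<pi> t) = tableau_row lam T t"
      using tableau_row_apply[OF T] by metis
  next
    fix q d assume R: "\<forall>t\<in>{1..r}. tableau_row lam T (\<pi> t) = tableau_row lam T t"
      and b: "(q, d) \<in> diagram lam"
    then have Tb: "T (q, d) \<in> {1..r}" "\<pi> (T (q, d)) \<in> {1..r}"
      using basic_tableau_range[OF T] permutes_in_image[OF \<pi>] by blast+
    then obtain b' where b': "b' \<in> diagram lam" "\<pi> (T (q, d)) = T b'"
      using basic_tableau_obtain[OF T] by metis
    have "tableau_row lam T (T b') = tableau_row lam T (T (q, d))"
      using R Tb(1) b'(2) by metis
    then have "fst b' = q"
      by (simp add: tableau_row_apply[OF T] b b'(1))
    with b' show "\<exists>b'\<in>diagram lam. fst b' = fst (q, d) \<and> \<pi> (T (q, d)) = T b'"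
      by auto
  qed
qed

lemma col_group_eq:
  assumes T: "basic_tableau r lam T"
  shows "col_group r lam T = fiber_group r (tableau_col lam T)"
proof (rule set_eqI, unfold col_group_def fiber_group_def mem_Collect_eq, rule conj_cong[OF refl])
  fix \<pi> assume \<pi>: "\<pi> permutes {1..r}"
  show "(\<forall>b\<in>diagram lam. \<exists>b'\<in>diagram lam. snd b' = snd b \<and> \<pi> (T b) = T b') \<longleftrightarrow>
      (\<forall>t\<in>{1..r}. tableau_col lam T (\<pi> t) = tableau_col lam T t)"
  proof safe
    fix t assume L: "\<forall>b\<in>diagram lam. \<exists>b'\<in>diagram lam. snd b' = snd b \<and> \<pi> (T b) = T b'"
      and "t \<in> {1..r}"
    then obtain b where "b \<in> diagram lam" "t = T b"
      using basic_tableau_obtain[OF T] by blast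
    with L show "tableau_col lam T (\<pi> t) = tableau_col lam T t"
      using tableau_col_apply[OF T] by metis
  next
    fix q d assume R: "\<forall>t\<in>{1..r}. tableau_col lam T (\<pi> t) = tableau_col lam T t"
      and b: "(q, d) \<in> diagram lam"
    then have Tb: "T (q, d) \<in> {1..r}" "\<pi> (T (q, d)) \<in> {1..r}"
      using basic_tableau_range[OF T] permutes_in_image[OF \<pi>] by blast+
    then obtain b' where b': "b' \<in> diagram lam" "\<pi> (T (q, d)) = T b'"
      using basic_tableau_obtain[OF T] by metis
    have "tableau_col lam T (T b') = tableau_col lam T (T (q, d))"
      using R Tb(1) b'(2) by metis
    then have "snd b' = d"
      by (simp add: tableau_col_apply[OF T] b b'(1))
    with b' show "\<exists>b'\<in>diagram lam. snd b' = snd (q, d) \<and> \<pi> (T (q, d)) = T b'"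
      by auto
  qed
qed

section \<open>Behaviour of symmetrizers under permutations and under the actions\<close>

lemma symmetrizer_eq:
  assumes "basic_tableau r lam T"
  shows "symmetrizer m r lam T i j =
    (\<Sum>\<rho>\<in>fiber_group r (tableau_row lam T). \<Sum>\<kappa>\<in>fiber_group r (tableau_col lam T).
      qscale (of_int (sign \<kappa>) * rat_sign m r i \<rho> * rat_sign m r j \<kappa>) (chi m r (i \<circ> \<rho>) (j \<circ> \<kappa>)))"
proof -
  have "of_int (sign \<kappa>) * chi_signed m r (star m r i \<rho>) (star m r j \<kappa>) =
      qscale (of_int (sign \<kappa>) * rat_sign m r i \<rho> * rat_sign m r j \<kappa>) (chi m r (i \<circ> \<rho>) (j \<circ> \<kappa>))"
    for \<rho> \<kappa>
  proof -
    have "snd (star m r k \<pi>) = k \<circ> \<pi>" for k \<pi>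
      by (simp add: star_def)
    then show ?thesis
      by (simp only: chi_signed_def star_sign_def[symmetric] of_int_mult_eq_qscale)
        (simp only: q_mod.scale_scale of_int_mult mult.assoc)
  qed
  then show ?thesis
    by (simp only: symmetrizer_def row_group_eq[OF assms] col_group_eq[OF assms])
qed

text \<open>Translating the summation variable of the column group by \<kappa> changes every term by
  the same factor, namely the alternating sign times the cocycle sign.\<close>

lemma symmetrizer_right_permute:
  assumes T: "basic_tableau r lam T" and \<kappa>: "\<kappa> \<in> fiber_group r (tableau_col lam T)"
  shows "symmetrizer m r lam T i (j \<circ> \<kappa>) =
    qscale (of_int (sign \<kappa>) * rat_sign m r j \<kappa>) (symmetrizer m r lam T i j)"
proof -
  note \<kappa>' = fiber_group_permutes[OF \<kappa>]
  let ?q = "of_int (sign \<kappa>) * rat_sign m r j \<kappa>"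
  \<comment> \<open>The factor is its own inverse, so it can be moved to the other side at the
    end.\<close>
  have q: "?q * ?q = 1"
    using rat_sign_mult_self[of m r j \<kappa>] sign_idempotent[of \<kappa>, THEN arg_cong[of _ _ rat_of_int]]
    unfolding of_int_mult of_int_1 by algebra
  have "symmetrizer m r lam T i j =
    (\<Sum>\<rho>\<in>fiber_group r (tableau_row lam T). \<Sum>\<sigma>\<in>fiber_group r (tableau_col lam T).
      qscale (of_int (sign (\<kappa> \<circ> \<sigma>)) * rat_sign m r i \<rho> * rat_sign m r j (\<kappa> \<circ> \<sigma>))
        (chi m r (i \<circ> \<rho>) (j \<circ> (\<kappa> \<circ> \<sigma>))))"
    unfolding symmetrizer_eq[OF T] by (intro sum.cong refl sum_fiber_group_compose[OF \<kappa>, symmetric])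
  also have "\<dots> = (\<Sum>\<rho>\<in>fiber_group r (tableau_row lam T). \<Sum>\<sigma>\<in>fiber_group r (tableau_col lam T).
      qscale ?q (qscale (of_int (sign \<sigma>) * rat_sign m r i \<rho> * rat_sign m r (j \<circ> \<kappa>) \<sigma>)
        (chi m r (i \<circ> \<rho>) (j \<circ> \<kappa> \<circ> \<sigma>))))"
  proof (intro sum.cong refl)
    fix \<rho> \<sigma> assume "\<sigma> \<in> fiber_group r (tableau_col lam T)"
    then have \<sigma>: "\<sigma> permutes {1..r}" by (rule fiber_group_permutes)
    have "sign (\<kappa> \<circ> \<sigma>) = sign \<kappa> * sign \<sigma>"
      using \<kappa>' \<sigma> by (intro sign_compose permutes_imp_permutation[of "{1..r}"]) auto
    then show "qscale (of_int (sign (\<kappa> \<circ> \<sigma>)) * rat_sign m r i \<rho> * rat_sign m r j (\<kappa> \<circ> \<sigma>))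
        (chi m r (i \<circ> \<rho>) (j \<circ> (\<kappa> \<circ> \<sigma>))) =
      qscale ?q (qscale (of_int (sign \<sigma>) * rat_sign m r i \<rho> * rat_sign m r (j \<circ> \<kappa>) \<sigma>)
        (chi m r (i \<circ> \<rho>) (j \<circ> \<kappa> \<circ> \<sigma>)))"
      by (simp only: star_sign_compose[OF \<kappa>' \<sigma>] q_mod.scale_scale o_assoc of_int_mult)
        (simp only: mult.assoc mult.commute mult.left_commute)
  qed
  also have "\<dots> = qscale ?q (symmetrizer m r lam T i (j \<circ> \<kappa>))"
    unfolding symmetrizer_eq[OF T] by (simp only: q_mod.scale_sum_right)
  finally show ?thesis
    by (simp only: q_mod.scale_scale q q_mod.scale_one)
qed

text \<open>Translation in the row group works as for columns; the row sum is not alternating, so no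
  \<open>sign\<close> appears.\<close>

lemma symmetrizer_left_permute:
  assumes T: "basic_tableau r lam T" and \<rho>: "\<rho> \<in> fiber_group r (tableau_row lam T)"
  shows "symmetrizer m r lam T (i \<circ> \<rho>) j = qscale (rat_sign m r i \<rho>) (symmetrizer m r lam T i j)"
proof -
  note \<rho>' = fiber_group_permutes[OF \<rho>]
  let ?q = "rat_sign m r i \<rho>"
  have "symmetrizer m r lam T i j =
    (\<Sum>\<sigma>\<in>fiber_group r (tableau_row lam T). \<Sum>\<kappa>\<in>fiber_group r (tableau_col lam T).
      qscale (of_int (sign \<kappa>) * rat_sign m r i (\<rho> \<circ> \<sigma>) * rat_sign m r j \<kappa>)
        (chi m r (i \<circ> (\<rho> \<circ> \<sigma>)) (j \<circ> \<kappa>)))"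
    unfolding symmetrizer_eq[OF T] by (rule sum_fiber_group_compose[OF \<rho>, symmetric])
  also have "\<dots> = (\<Sum>\<sigma>\<in>fiber_group r (tableau_row lam T). \<Sum>\<kappa>\<in>fiber_group r (tableau_col lam T).
      qscale ?q (qscale (of_int (sign \<kappa>) * rat_sign m r (i \<circ> \<rho>) \<sigma> * rat_sign m r j \<kappa>)
        (chi m r (i \<circ> \<rho> \<circ> \<sigma>) (j \<circ> \<kappa>))))"
    by (intro sum.cong refl)
      (simp only: star_sign_compose[OF \<rho>' fiber_group_permutes] q_mod.scale_scale o_assoc
        of_int_mult, simp only: mult.assoc mult.commute mult.left_commute)
  also have "\<dots> = qscale ?q (symmetrizer m r lam T (i \<circ> \<rho>) j)"
    unfolding symmetrizer_eq[OF T] by (simp only: q_mod.scale_sum_right)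
  finally show ?thesis
    by (simp only: q_mod.scale_scale rat_sign_mult_self q_mod.scale_one)
qed

lemma symmetrizer_in_A_deg:
  assumes T: "basic_tableau r lam T" and "i \<in> multiindices m n r" "j \<in> multiindices m n r"
  shows "symmetrizer m r lam T i j \<in> A_deg m n r"
  unfolding symmetrizer_eq[OF T]
  by (intro q_mod.subspace_sum[OF subspace_A_deg] q_mod.subspace_scale[OF subspace_A_deg]
      chi_in_A_deg multiindices_compose[OF assms(2)] multiindices_compose[OF assms(3)])
    (simp_all only: fiber_group_permutes)

text \<open>The target is arbitrary, to cover the two actions as well as the rational functional
  that detects nonvanishing.\<close>

lemma linear_on_symmetrizer:
  assumes T: "basic_tableau r lam T" and F: "linear_on scale (A_deg m n r) F"
    and ij: "i \<in> multiindices m n r" "j \<in> multiindices m n r"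
  shows "F (symmetrizer m r lam T i j) =
    (\<Sum>\<rho>\<in>fiber_group r (tableau_row lam T). \<Sum>\<kappa>\<in>fiber_group r (tableau_col lam T).
      scale (of_int (sign \<kappa>) * rat_sign m r i \<rho> * rat_sign m r j \<kappa>)
        (F (chi m r (i \<circ> \<rho>) (j \<circ> \<kappa>))))"
proof -
  note sub = q_mod.subspace_sum[OF subspace_A_deg] q_mod.subspace_scale[OF subspace_A_deg]
    chi_in_A_deg multiindices_compose[OF ij(1) fiber_group_permutes]
    multiindices_compose[OF ij(2) fiber_group_permutes]
  show ?thesis
    unfolding symmetrizer_eq[OF T]
    by (simp add: linear_on_sum[OF F subspace_A_deg] linear_on_scale[OF F] sub)
qed

text \<open>For each fixed \<kappa> the sum over \<open>a\<close> is reindexed by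
  \<open>a \<circ> \<kappa>\<close>. Equivariance of \<xi> cancels the sign of \<open>j\<close> and
  introduces that of \<open>a\<close>, which is the one required in the symmetrizer of
  \<open>i\<close> and \<open>a\<close>.\<close>

lemma left_act_symmetrizer:
  assumes T: "basic_tableau r lam T" and \<xi>: "\<xi> \<in> S_Q m n r"
    and ij: "i \<in> multiindices m n r" "j \<in> multiindices m n r"
  shows "left_act m n r \<xi> (symmetrizer m r lam T i j) =
    (\<Sum>a\<in>multiindices m n r. qscale (\<xi> (chi m r a j)) (symmetrizer m r lam T i a))"
proof -
  let ?R = "fiber_group r (tableau_row lam T)" and ?C = "fiber_group r (tableau_col lam T)"
  let ?I = "multiindices m n r"
  have "left_act m n r \<xi> (symmetrizer m r lam T i j) =
    (\<Sum>\<rho>\<in>?R. \<Sum>\<kappa>\<in>?C. qscale (of_int (sign \<kappa>) * rat_sign m r i \<rho> * rat_sign m r j \<kappa>)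
      (left_act m n r \<xi> (chi m r (i \<circ> \<rho>) (j \<circ> \<kappa>))))"
    by (rule linear_on_symmetrizer[OF T left_act_chi(1)[OF \<xi>] ij])
  also have "\<dots> = (\<Sum>\<rho>\<in>?R. \<Sum>\<kappa>\<in>?C. \<Sum>a\<in>?I. qscale (\<xi> (chi m r a j))
      (qscale (of_int (sign \<kappa>) * rat_sign m r i \<rho> * rat_sign m r a \<kappa>) (chi m r (i \<circ> \<rho>) (a \<circ> \<kappa>))))"
  proof (intro sum.cong refl)
    fix \<rho> \<kappa> assume "\<rho> \<in> ?R" "\<kappa> \<in> ?C"
    then have \<rho>: "\<rho> permutes {1..r}" and \<kappa>: "\<kappa> permutes {1..r}"
      by (simp_all only: fiber_group_permutes)
    have "left_act m n r \<xi> (chi m r (i \<circ> \<rho>) (j \<circ> \<kappa>)) =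
        (\<Sum>a\<in>?I. qscale (\<xi> (chi m r a (j \<circ> \<kappa>))) (chi m r (i \<circ> \<rho>) a))"
      by (rule left_act_chi(2)[OF \<xi> multiindices_compose[OF ij(1) \<rho>] multiindices_compose[OF ij(2) \<kappa>]])
    also have "\<dots> = (\<Sum>a\<in>?I. qscale (\<xi> (chi m r (a \<circ> \<kappa>) (j \<circ> \<kappa>))) (chi m r (i \<circ> \<rho>) (a \<circ> \<kappa>)))"
      by (rule sum_multiindices_compose[OF \<kappa>, symmetric])
    finally show "qscale (of_int (sign \<kappa>) * rat_sign m r i \<rho> * rat_sign m r j \<kappa>)
        (left_act m n r \<xi> (chi m r (i \<circ> \<rho>) (j \<circ> \<kappa>))) = (\<Sum>a\<in>?I. qscale (\<xi> (chi m r a j))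
      (qscale (of_int (sign \<kappa>) * rat_sign m r i \<rho> * rat_sign m r a \<kappa>) (chi m r (i \<circ> \<rho>) (a \<circ> \<kappa>))))"
      by (simp only: q_mod.scale_sum_right q_mod.scale_scale)
        (intro sum.cong refl, simp only: S_Q_chi_permutes[OF \<xi> _ ij(2) \<kappa>] sign_cancel[OF rat_sign_mult_self])
  qed
  also have "\<dots> = (\<Sum>a\<in>?I. \<Sum>\<rho>\<in>?R. \<Sum>\<kappa>\<in>?C. qscale (\<xi> (chi m r a j))
      (qscale (of_int (sign \<kappa>) * rat_sign m r i \<rho> * rat_sign m r a \<kappa>) (chi m r (i \<circ> \<rho>) (a \<circ> \<kappa>))))"
    by (simp only: sum.swap[of _ ?I ?C] sum.swap[of _ ?I ?R])
  finally show ?thesis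
    by (simp only: symmetrizer_eq[OF T] q_mod.scale_sum_right)
qed

text \<open>For each fixed \<rho> the sum is reindexed by \<open>b \<circ> \<rho>\<close>; now the
  sign of \<open>i\<close> is exchanged for that of \<open>b\<close>.\<close>

lemma right_act_symmetrizer:
  assumes T: "basic_tableau r lam T" and \<xi>: "\<xi> \<in> S_Q m n r"
    and ij: "i \<in> multiindices m n r" "j \<in> multiindices m n r"
  shows "right_act m n r (symmetrizer m r lam T i j) \<xi> =
    (\<Sum>b\<in>multiindices m n r. qscale (\<xi> (chi m r i b)) (symmetrizer m r lam T b j))"
proof -
  let ?R = "fiber_group r (tableau_row lam T)" and ?C = "fiber_group r (tableau_col lam T)"
  let ?I = "multiindices m n r"
  have "right_act m n r (symmetrizer m r lam T i j) \<xi> =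
    (\<Sum>\<rho>\<in>?R. \<Sum>\<kappa>\<in>?C. qscale (of_int (sign \<kappa>) * rat_sign m r i \<rho> * rat_sign m r j \<kappa>)
      (right_act m n r (chi m r (i \<circ> \<rho>) (j \<circ> \<kappa>)) \<xi>))"
    by (rule linear_on_symmetrizer[OF T right_act_chi(1)[OF \<xi>] ij])
  also have "\<dots> = (\<Sum>\<rho>\<in>?R. \<Sum>\<kappa>\<in>?C. \<Sum>b\<in>?I. qscale (\<xi> (chi m r i b))
      (qscale (of_int (sign \<kappa>) * rat_sign m r b \<rho> * rat_sign m r j \<kappa>) (chi m r (b \<circ> \<rho>) (j \<circ> \<kappa>))))"
  proof (intro sum.cong refl)
    fix \<rho> \<kappa> assume "\<rho> \<in> ?R" "\<kappa> \<in> ?C"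
    then have \<rho>: "\<rho> permutes {1..r}" and \<kappa>: "\<kappa> permutes {1..r}"
      by (simp_all only: fiber_group_permutes)
    have "right_act m n r (chi m r (i \<circ> \<rho>) (j \<circ> \<kappa>)) \<xi> =
        (\<Sum>b\<in>?I. qscale (\<xi> (chi m r (i \<circ> \<rho>) b)) (chi m r b (j \<circ> \<kappa>)))"
      by (rule right_act_chi(2)[OF \<xi> multiindices_compose[OF ij(1) \<rho>] multiindices_compose[OF ij(2) \<kappa>]])
    also have "\<dots> = (\<Sum>b\<in>?I. qscale (\<xi> (chi m r (i \<circ> \<rho>) (b \<circ> \<rho>))) (chi m r (b \<circ> \<rho>) (j \<circ> \<kappa>)))"
      by (rule sum_multiindices_compose[OF \<rho>, symmetric])
    finally show "qscale (of_int (sign \<kappa>) * rat_sign m r i \<rho> * rat_sign m r j \<kappa>)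
        (right_act m n r (chi m r (i \<circ> \<rho>) (j \<circ> \<kappa>)) \<xi>) = (\<Sum>b\<in>?I. qscale (\<xi> (chi m r i b))
      (qscale (of_int (sign \<kappa>) * rat_sign m r b \<rho> * rat_sign m r j \<kappa>) (chi m r (b \<circ> \<rho>) (j \<circ> \<kappa>))))"
      by (simp only: q_mod.scale_sum_right q_mod.scale_scale)
        (intro sum.cong refl, simp only: S_Q_chi_permutes[OF \<xi> ij(1) _ \<rho>] sign_cancel[OF rat_sign_mult_self])
  qed
  also have "\<dots> = (\<Sum>b\<in>?I. \<Sum>\<rho>\<in>?R. \<Sum>\<kappa>\<in>?C. qscale (\<xi> (chi m r i b))
      (qscale (of_int (sign \<kappa>) * rat_sign m r b \<rho> * rat_sign m r j \<kappa>) (chi m r (b \<circ> \<rho>) (j \<circ> \<kappa>))))"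
    by (simp only: sum.swap[of _ ?I ?C] sum.swap[of _ ?I ?R])
  finally show ?thesis
    by (simp only: symmetrizer_eq[OF T] q_mod.scale_sum_right)
qed

section \<open>Integral functionals\<close>

lemma equiv_pair_sym:
  assumes "equiv_pair r i j k l"
  shows "equiv_pair r k l i j"
proof -
  obtain \<pi> where \<pi>: "\<pi> permutes {1..r}" "k = i \<circ> \<pi>" "l = j \<circ> \<pi>"
    using assms by (auto simp: equiv_pair_def)
  then have "i = k \<circ> inv \<pi>" "j = l \<circ> inv \<pi>"
    using permutes_inv_o(1)[OF \<pi>(1)] by (simp_all add: comp_assoc)
  then show ?thesis
    unfolding equiv_pair_def using permutes_inv[OF \<pi>(1)] by blast
qed

lemma equiv_pair_compose:
  assumes "\<pi> permutes {1..r}"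
  shows "equiv_pair r i j (k \<circ> \<pi>) (l \<circ> \<pi>) \<longleftrightarrow> equiv_pair r i j k l"
proof
  assume "equiv_pair r i j (k \<circ> \<pi>) (l \<circ> \<pi>)"
  then obtain \<sigma> where \<sigma>: "\<sigma> permutes {1..r}" "k \<circ> \<pi> = i \<circ> \<sigma>" "l \<circ> \<pi> = j \<circ> \<sigma>"
    by (auto simp: equiv_pair_def)
  have "k = k \<circ> \<pi> \<circ> inv \<pi>" "l = l \<circ> \<pi> \<circ> inv \<pi>"
    using permutes_inv_o(1)[OF assms] by (simp_all add: comp_assoc)
  then have "k = i \<circ> (\<sigma> \<circ> inv \<pi>)" "l = j \<circ> (\<sigma> \<circ> inv \<pi>)"
    unfolding \<sigma> by (simp_all add: comp_assoc)
  then show "equiv_pair r i j k l"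
    unfolding equiv_pair_def using permutes_compose[OF permutes_inv[OF assms] \<sigma>(1)] by blast
next
  assume "equiv_pair r i j k l"
  then obtain \<sigma> where \<sigma>: "\<sigma> permutes {1..r}" "k = i \<circ> \<sigma>" "l = j \<circ> \<sigma>"
    by (auto simp: equiv_pair_def)
  then show "equiv_pair r i j (k \<circ> \<pi>) (l \<circ> \<pi>)"
    unfolding equiv_pair_def using permutes_compose[OF assms \<sigma>(1)] by (metis comp_assoc)
qed

lemma vector_space_rat: "vector_space ((*) :: rat \<Rightarrow> rat \<Rightarrow> rat)"
  by standard (simp_all add: algebra_simps)

text \<open>On the class of \<open>(i, j)\<close> every \<open>chi m r k l\<close> is plus or minus
  \<open>chi m r i j\<close>, and elsewhere the functional vanishes, so its values are 0, 1 or
  -1.\<close>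

lemma xi_integral:
  assumes ij: "i \<in> multiindices m n r" "j \<in> multiindices m n r" and nz: "chi m r i j \<noteq> 0"
  shows "xi m n r i j \<in> S_Q m n r"
    and "\<And>k l. k \<in> multiindices m n r \<Longrightarrow> l \<in> multiindices m n r \<Longrightarrow>
      xi m n r i j (chi m r k l) \<in> \<int>"
proof -
  let ?I = "multiindices m n r"
  \<comment> \<open>The value is read off as a scalar rather than from a permutation, since several
    permutations may carry \<open>(i, j)\<close> to \<open>(k, l)\<close>; the scalar is unique
    because \<open>chi m r i j\<close> is nonzero.\<close>
  define f where "f k l = (if equiv_pair r i j k l
    then (THE q. chi m r k l = qscale q (chi m r i j)) else 0)" for k l
  have the: "(THE q. qscale q' (chi m r i j) = qscale q (chi m r i j)) = q'" for q'
    using nz by (intro the_equality) auto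
  have f: "f (i \<circ> \<pi>) (j \<circ> \<pi>) = rat_sign m r i \<pi> * rat_sign m r j \<pi>" if "\<pi> permutes {1..r}" for \<pi>
  proof -
    have "equiv_pair r i j (i \<circ> \<pi>) (j \<circ> \<pi>)"
      using that unfolding equiv_pair_def by blast
    then show ?thesis
      by (simp only: f_def chi_permutes_scale[OF that] the if_True)
  qed
  have f_equiv: "f (k \<circ> \<pi>) (l \<circ> \<pi>) = rat_sign m r k \<pi> * rat_sign m r l \<pi> * f k l"
    if \<pi>: "\<pi> permutes {1..r}" for k l \<pi>
  proof (cases "equiv_pair r i j k l")
    case True
    then obtain \<sigma> where \<sigma>: "\<sigma> permutes {1..r}" "k = i \<circ> \<sigma>" "l = j \<circ> \<sigma>"
      by (auto simp: equiv_pair_def)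
    show ?thesis
      using f[OF permutes_compose[OF \<pi> \<sigma>(1)]]
      by (simp only: \<sigma>(2,3) f[OF \<sigma>(1)] star_sign_compose[OF \<sigma>(1) \<pi>] o_assoc of_int_mult)
        (simp only: mult.commute mult.left_commute mult.assoc)
  next
    case False
    then show ?thesis
      by (simp add: f_def equiv_pair_compose[OF \<pi>])
  qed
  obtain \<xi> where \<xi>: "linear_on (*) (A_deg m n r) \<xi>"
    "\<And>k l. k \<in> ?I \<Longrightarrow> l \<in> ?I \<Longrightarrow> \<xi> (chi m r k l) = f k l"
    by (rule chi_extension[OF vector_space_rat, of m n r f]) (simp_all add: f_equiv)
  have "xi m n r i j = \<xi>"
    unfolding xi_def
  proof (rule the_equality)
    show "\<xi> \<in> S_Q m n r \<and> \<xi> (chi m r i j) = 1 \<and>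
        (\<forall>k\<in>?I. \<forall>l\<in>?I. \<not> equiv_pair r k l i j \<longrightarrow> \<xi> (chi m r k l) = 0)"
      using \<xi> ij f[OF permutes_id] equiv_pair_sym by (auto simp: S_Q_def f_def)
  next
    fix \<eta> assume \<eta>: "\<eta> \<in> S_Q m n r \<and> \<eta> (chi m r i j) = 1 \<and>
        (\<forall>k\<in>?I. \<forall>l\<in>?I. \<not> equiv_pair r k l i j \<longrightarrow> \<eta> (chi m r k l) = 0)"
    show "\<eta> = \<xi>"
    proof (rule linear_on_eqI)
      show "linear_on (*) (A_deg m n r) \<eta>" "linear_on (*) (A_deg m n r) \<xi>"
        using \<eta> \<xi> by (simp_all add: S_Q_def)
      fix k l assume kl: "k \<in> ?I" "l \<in> ?I"
      show "\<eta> (chi m r k l) = \<xi> (chi m r k l)"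
      proof (cases "equiv_pair r i j k l")
        case True
        then obtain \<sigma> where \<sigma>: "\<sigma> permutes {1..r}" "k = i \<circ> \<sigma>" "l = j \<circ> \<sigma>"
          by (auto simp: equiv_pair_def)
        have "\<eta> (chi m r k l) = rat_sign m r i \<sigma> * rat_sign m r j \<sigma>"
          using S_Q_chi_permutes[OF _ ij \<sigma>(1), of \<eta>] \<eta> by (simp add: \<sigma>)
        then show ?thesis
          using \<xi>(2)[OF kl] f[OF \<sigma>(1)] by (simp add: \<sigma>)
      next
        case False
        then show ?thesis
          using \<eta> kl equiv_pair_sym[of r k l i j] \<xi>(2)[OF kl] by (auto simp: f_def)
      qed
    qed
  qed
  then show "xi m n r i j \<in> S_Q m n r"
    using \<xi>(1) by (simp add: S_Q_def)
  fix k l assume kl: "k \<in> ?I" "l \<in> ?I"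
  have "f k l \<in> \<int>"
  proof (cases "equiv_pair r i j k l")
    case True
    then obtain \<sigma> where "\<sigma> permutes {1..r}" "k = i \<circ> \<sigma>" "l = j \<circ> \<sigma>"
      by (auto simp: equiv_pair_def)
    then show ?thesis using f by simp
  qed (simp add: f_def)
  then show "xi m n r i j (chi m r k l) \<in> \<int>"
    using \<open>xi m n r i j = \<xi>\<close> \<xi>(2)[OF kl] by simp
qed

text \<open>Integer multiples in \<open>S_Z\<close> are products in the pointwise ring of functions,
  so \<open>of_int\<close> there has to be evaluated as a constant function.\<close>

lemma of_int_fun_apply: "(of_int k :: 'a \<Rightarrow> rat) x = of_int k"
proof -
  have "(of_nat n :: 'a \<Rightarrow> rat) x = of_nat n" for n
    by (induction n) simp_all
  then show ?thesis
    by (cases k) (simp_all del: of_nat_Suc)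
qed

lemma S_Z_integral:
  assumes "\<xi> \<in> S_Z m n r"
  shows "\<xi> \<in> S_Q m n r"
    and "\<And>k l. k \<in> multiindices m n r \<Longrightarrow> l \<in> multiindices m n r \<Longrightarrow> \<xi> (chi m r k l) \<in> \<int>"
proof -
  let ?I = "multiindices m n r"
  let ?U = "{\<xi>\<in>S_Q m n r. \<forall>k\<in>?I. \<forall>l\<in>?I. \<xi> (chi m r k l) \<in> \<int>}"
  have "z_mod.subspace ?U"
    by (rule z_mod.subspaceI)
      (auto simp: S_Q_def linear_on_def of_int_fun_apply algebra_simps intro!: Ints_add Ints_mult)
  moreover have "{xi m n r i j | i j. i \<in> ?I \<and> j \<in> ?I \<and> chi m r i j \<noteq> 0} \<subseteq> ?U"
    using xi_integral by blast
  ultimately have "S_Z m n r \<subseteq> ?U"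
    unfolding S_Z_def by (rule z_mod.span_minimal[rotated])
  with assms show "\<xi> \<in> S_Q m n r" "\<And>k l. k \<in> ?I \<Longrightarrow> l \<in> ?I \<Longrightarrow> \<xi> (chi m r k l) \<in> \<int>"
    by blast+
qed

text \<open>Positions \<open>t\<close> and \<open>u\<close> carry the same odd generator, whose
  square vanishes. In terms of signs, the transposition of \<open>t\<close> and \<open>u\<close>
  fixes both multiindices while exactly one of the two action signs is -1, so the value equals its
  own negative.\<close>

lemma S_Q_chi_eq_zero:
  assumes \<xi>: "\<xi> \<in> S_Q m n r" and ij: "i \<in> multiindices m n r" "j \<in> multiindices m n r"
    and tu: "t \<in> {1..r}" "u \<in> {1..r}" "t \<noteq> u" "i t = i u" "j t = j u"
    and par: "odd_sym m (i t) \<noteq> odd_sym m (j t)"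
  shows "\<xi> (chi m r i j) = 0"
proof -
  let ?\<tau> = "transpose t u"
  have \<tau>: "?\<tau> permutes {1..r}"
    using tu by (intro permutes_swap_id)
  have sign: "star_sign m r k ?\<tau> = (if odd_sym m (k t) then - 1 else 1)" if "k t = k u" for k
  proof (cases "odd_sym m (k t)")
    case True
    then show ?thesis
      using star_sign_transpose[of t r u m k] tu that by simp
  next
    case False
    then have "star_sign m r k ?\<tau> = 1"
      using that by (intro star_sign_fixes_odd[OF \<tau>]) (auto simp: transpose_def)
    then show ?thesis using False by simp
  qed
  have "k \<circ> ?\<tau> = k" if "k t = k u" for k :: "nat \<Rightarrow> nat"
    using that by (auto simp: fun_eq_iff transpose_def)
  then have "\<xi> (chi m r i j) = rat_sign m r i ?\<tau> * rat_sign m r j ?\<tau> * \<xi> (chi m r i j)"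
    using S_Q_chi_permutes[OF \<xi> ij \<tau>] tu by simp
  then show ?thesis
    using par tu by (auto simp: sign split: if_splits)
qed

section \<open>Young subgroups and orbit sums\<close>

text \<open>Lagrange's theorem: left translation is injective, so all classes of the left coset
  relation have the size of the smaller group.\<close>

lemma fiber_group_card_dvd:
  assumes "fiber_group r g \<subseteq> fiber_group r h"
  shows "card (fiber_group r g) dvd card (fiber_group r h)"
proof (rule equiv_imp_dvd_card)
  let ?R = "{(\<pi>, \<sigma>). \<pi> \<in> fiber_group r h \<and> \<sigma> \<in> fiber_group r h \<and>
    (\<exists>\<tau>\<in>fiber_group r g. \<sigma> = \<pi> \<circ> \<tau>)}"
  show "equiv (fiber_group r h) ?R"
  proof (rule equivI)
    show "?R \<subseteq> fiber_group r h \<times> fiber_group r h" by auto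
    show "refl_on (fiber_group r h) ?R"
      using id_fiber_group[of r g] by (auto simp: refl_on_def intro!: bexI[of _ id])
    show "sym ?R"
    proof (rule symI, clarify)
      fix \<pi> \<tau> assume "\<pi> \<in> fiber_group r h" and \<tau>: "\<tau> \<in> fiber_group r g"
      have "\<pi> = \<pi> \<circ> \<tau> \<circ> inv \<tau>"
        using permutes_inv_o(1)[OF fiber_group_permutes[OF \<tau>]] by (simp add: comp_assoc)
      then show "\<exists>\<tau>'\<in>fiber_group r g. \<pi> = \<pi> \<circ> \<tau> \<circ> \<tau>'"
        using inv_fiber_group[OF \<tau>] by blast
    qed
    show "trans ?R"
    proof (rule transI, clarify)
      fix \<pi> \<sigma> \<tau> assume "\<sigma> \<in> fiber_group r g" "\<tau> \<in> fiber_group r g"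
      then show "\<exists>\<tau>'\<in>fiber_group r g. \<pi> \<circ> \<sigma> \<circ> \<tau> = \<pi> \<circ> \<tau>'"
        using compose_fiber_group by (metis comp_assoc)
    qed
  qed
  fix X assume "X \<in> fiber_group r h // ?R"
  then obtain \<pi> where \<pi>: "\<pi> \<in> fiber_group r h" and X: "X = ?R `` {\<pi>}"
    by (auto elim: quotientE)
  have "X = (\<lambda>\<tau>. \<pi> \<circ> \<tau>) ` fiber_group r g"
    unfolding X using \<pi> assms compose_fiber_group[OF \<pi>] by auto
  moreover have "inj_on (\<lambda>\<tau>. \<pi> \<circ> \<tau>) (fiber_group r g)"
    using permutes_inj[OF fiber_group_permutes[OF \<pi>]] by (intro inj_onI) (simp add: inj_eq fun_eq_iff)
  ultimately show "card (fiber_group r g) dvd card X"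
    by (simp add: card_image)
qed simp

text \<open>The permutations carrying \<open>a\<close> to a given point of its orbit form a coset of
  the stabilizer, via composition on the right with one of them.\<close>

lemma orbit_stabilizer_card:
  fixes a :: "nat \<Rightarrow> nat"
  shows "card (fiber_group r g) =
    card ((\<lambda>\<pi>. a \<circ> \<pi>) ` fiber_group r g) * card {\<pi>\<in>fiber_group r g. a \<circ> \<pi> = a}"
proof -
  let ?G = "fiber_group r g"
  have fib: "card {\<pi>\<in>?G. a \<circ> \<pi> = b} = card {\<pi>\<in>?G. a \<circ> \<pi> = a}" if b: "b \<in> (\<lambda>\<pi>. a \<circ> \<pi>) ` ?G" for b
  proof -
    obtain \<sigma> where \<sigma>: "\<sigma> \<in> ?G" "b = a \<circ> \<sigma>"
      using b by blast
    note inv = permutes_inv_o[OF fiber_group_permutes[OF \<sigma>(1)]]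
    have "bij_betw (\<lambda>\<pi>. \<pi> \<circ> \<sigma>) {\<pi>\<in>?G. a \<circ> \<pi> = a} {\<pi>\<in>?G. a \<circ> \<pi> = b}"
    proof (rule bij_betw_byWitness[of _ "\<lambda>\<pi>. \<pi> \<circ> inv \<sigma>"])
      show "\<forall>\<pi>\<in>{\<pi>\<in>?G. a \<circ> \<pi> = a}. \<pi> \<circ> \<sigma> \<circ> inv \<sigma> = \<pi>"
        "\<forall>\<pi>\<in>{\<pi>\<in>?G. a \<circ> \<pi> = b}. \<pi> \<circ> inv \<sigma> \<circ> \<sigma> = \<pi>"
        using inv by (simp_all add: comp_assoc)
      show "(\<lambda>\<pi>. \<pi> \<circ> \<sigma>) ` {\<pi>\<in>?G. a \<circ> \<pi> = a} \<subseteq> {\<pi>\<in>?G. a \<circ> \<pi> = b}"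
        using \<sigma> compose_fiber_group by (auto simp: comp_assoc[symmetric])
      have "a \<circ> (\<pi> \<circ> inv \<sigma>) = a" if "a \<circ> \<pi> = b" for \<pi>
        using that inv(1) \<sigma>(2) by (metis comp_assoc comp_id)
      then show "(\<lambda>\<pi>. \<pi> \<circ> inv \<sigma>) ` {\<pi>\<in>?G. a \<circ> \<pi> = b} \<subseteq> {\<pi>\<in>?G. a \<circ> \<pi> = a}"
        using compose_fiber_group inv_fiber_group[OF \<sigma>(1)] by blast
    qed
    then show ?thesis by (rule bij_betw_same_card[symmetric])
  qed
  have "card ?G = (\<Sum>\<pi>\<in>?G. 1)" by simp
  also have "\<dots> = (\<Sum>b\<in>(\<lambda>\<pi>. a \<circ> \<pi>) ` ?G. \<Sum>\<pi>\<in>{\<pi>\<in>?G. a \<circ> \<pi> = b}. 1)"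
    by (rule sum.image_gen) simp
  also have "\<dots> = (\<Sum>b\<in>(\<lambda>\<pi>. a \<circ> \<pi>) ` ?G. card {\<pi>\<in>?G. a \<circ> \<pi> = a})"
    by (intro sum.cong refl) (simp only: sum_constant fib mult_1_right of_nat_id)
  finally show ?thesis by simp
qed

text \<open>An orbit contributes its size times the common value of \<open>f\<close> on it; dividing
  by the order of the group leaves one over the order of the stabilizer. Membership then has to be
  checked at single multiindices only.\<close>

lemma orbit_sum_mem:
  fixes f :: "(nat \<Rightarrow> nat) \<Rightarrow> 'g salg"
  assumes L: "z_mod.subspace L"
    and inv: "\<And>a \<pi>. a \<in> multiindices m n r \<Longrightarrow> \<pi> \<in> fiber_group r g \<Longrightarrow> f (a \<circ> \<pi>) = f a"
    and mem: "\<And>a. a \<in> multiindices m n r \<Longrightarrow>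
      qscale (1 / of_nat (card {\<pi>\<in>fiber_group r g. a \<circ> \<pi> = a})) (f a) \<in> L"
  shows "qscale (1 / of_nat (card (fiber_group r g))) (\<Sum>a\<in>multiindices m n r. f a) \<in> L"
proof -
  let ?G = "fiber_group r g" and ?I = "multiindices m n r"
  define orb where "orb a = (\<lambda>\<pi>. a \<circ> \<pi>) ` ?G" for a :: "nat \<Rightarrow> nat"
  have self: "a \<in> orb a" for a
    unfolding orb_def using id_fiber_group by (metis comp_id image_eqI)
  have orb_sub: "orb b \<subseteq> orb a" if "b \<in> orb a" for a b
    using that unfolding orb_def
    by (auto simp: comp_assoc intro!: imageI compose_fiber_group)
  have orb_sym: "a \<in> orb b" if "b \<in> orb a" for a b
  proof -
    obtain \<pi> where \<pi>: "\<pi> \<in> ?G" "b = a \<circ> \<pi>"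
      using \<open>b \<in> orb a\<close> unfolding orb_def by blast
    then have "a = b \<circ> inv \<pi>"
      using permutes_inv_o(1)[OF fiber_group_permutes[OF \<pi>(1)]] by (simp add: comp_assoc)
    then show ?thesis
      unfolding orb_def using inv_fiber_group[OF \<pi>(1)] by blast
  qed
  have "(\<Sum>a\<in>?I. f a) = (\<Sum>X\<in>orb ` ?I. \<Sum>a\<in>{a\<in>?I. orb a = X}. f a)"
    by (rule sum.image_gen) simp
  then have "qscale (1 / of_nat (card ?G)) (\<Sum>a\<in>?I. f a) =
      (\<Sum>X\<in>orb ` ?I. qscale (1 / of_nat (card ?G)) (\<Sum>a\<in>{a\<in>?I. orb a = X}. f a))"
    by (simp add: q_mod.scale_sum_right)
  also have "\<dots> \<in> L"
  proof (rule z_mod.subspace_sum[OF L])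
    fix X assume "X \<in> orb ` ?I"
    then obtain a where a: "a \<in> ?I" "X = orb a"
      by blast
    have I: "orb a \<subseteq> ?I"
      unfolding orb_def using multiindices_compose[OF a(1) fiber_group_permutes] by blast
    have "{b\<in>?I. orb b = X} = orb a"
      using self orb_sub orb_sym I unfolding a(2) by blast
    moreover have "(\<Sum>b\<in>orb a. f b) = (\<Sum>b\<in>orb a. f a)"
      by (rule sum.cong) (auto simp: orb_def inv[OF a(1)])
    moreover have "(\<Sum>b\<in>orb a. f a) = qscale (of_nat (card (orb a))) (f a)"
      using of_int_mult_eq_qscale[of "int (card (orb a))" "f a"] by simp
    moreover have "1 / of_nat (card ?G) * of_nat (card (orb a)) =
        (1 / of_nat (card {\<pi>\<in>?G. a \<circ> \<pi> = a}) :: rat)"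
    proof -
      have "finite (orb a)" "orb a \<noteq> {}"
        using self[of a] unfolding orb_def by auto
      then have "card (orb a) \<noteq> 0" by simp
      then show ?thesis
        using orbit_stabilizer_card[of r g a] by (simp add: orb_def)
    qed
    ultimately have "qscale (1 / of_nat (card ?G)) (\<Sum>b\<in>{b\<in>?I. orb b = X}. f b) =
        qscale (1 / of_nat (card {\<pi>\<in>?G. a \<circ> \<pi> = a})) (f a)"
      by (simp only: q_mod.scale_scale)
    then show "qscale (1 / of_nat (card ?G)) (\<Sum>b\<in>{b\<in>?I. orb b = X}. f b) \<in> L"
      using mem[OF a(1)] by simp
  qed
  finally show ?thesis .
qed

section \<open>Orders of Young subgroups\<close>

text \<open>The symmetric group of the fiber over \<open>y\<close> splits off as a direct factor.
  Labels in \<open>B\<close> that do not occur contribute \<open>fact 0\<close>, so \<open>B\<close>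
  may be larger than the image.\<close>

lemma card_permutes_fibers_aux:
  assumes "finite B" "finite S" "g ` S \<subseteq> B"
  shows "card {\<pi>. \<pi> permutes S \<and> (\<forall>t\<in>S. g (\<pi> t) = g t)} = (\<Prod>y\<in>B. fact (card {t\<in>S. g t = y}))"
  using assms
proof (induction B arbitrary: S rule: finite_induct)
  case empty
  then show ?case by simp
next
  case (insert y B)
  let ?P = "\<lambda>S. {\<pi>. \<pi> permutes S \<and> (\<forall>t\<in>S. g (\<pi> t) = g t)}"
  define U where "U = {t\<in>S. g t = y}"
  define S' where "S' = {t\<in>S. g t \<noteq> y}"
  have S: "S = U \<union> S'" "U \<inter> S' = {}" and fin: "finite U" "finite S'"
    using insert.prems by (auto simp: U_def S'_def)
  have IH: "card (?P S') = (\<Prod>y\<in>B. fact (card {t\<in>S'. g t = y}))"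
    using insert.prems fin by (intro insert.IH) (auto simp: S'_def)
  have "bij_betw (\<lambda>(\<sigma>, \<pi>). \<sigma> \<circ> \<pi>) ({\<sigma>. \<sigma> permutes U} \<times> ?P S') (?P S)"
  proof (rule bij_betwI')
    fix p q assume "p \<in> {\<sigma>. \<sigma> permutes U} \<times> ?P S'" "q \<in> {\<sigma>. \<sigma> permutes U} \<times> ?P S'"
    then obtain \<sigma> \<pi> \<sigma>' \<pi>' where pq: "p = (\<sigma>, \<pi>)" "q = (\<sigma>', \<pi>')" and
      perm: "\<sigma> permutes U" "\<sigma>' permutes U" "\<pi> permutes S'" "\<pi>' permutes S'"
      by auto
    have "\<sigma> = \<sigma>' \<and> \<pi> = \<pi>'" if eq: "\<sigma> \<circ> \<pi> = \<sigma>' \<circ> \<pi>'"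
    proof -
      have "\<pi> t = \<pi>' t" for t
      proof (cases "t \<in> S'")
        case True
        then have "\<pi> t \<notin> U" "\<pi>' t \<notin> U"
          using permutes_in_image[OF perm(3)] permutes_in_image[OF perm(4)] S(2) by blast+
        then show ?thesis
          using fun_cong[OF eq, of t] perm(1,2) by (simp add: permutes_def)
      next
        case False
        then show ?thesis using perm(3,4) by (simp add: permutes_def)
      qed
      then have "\<pi> = \<pi>'" by blast
      moreover have "\<sigma> \<circ> \<pi> \<circ> inv \<pi> = \<sigma>' \<circ> \<pi> \<circ> inv \<pi>"
        using eq \<open>\<pi> = \<pi>'\<close> by simp
      ultimately show ?thesis
        using permutes_inv_o(1)[OF perm(3)] by (simp add: comp_assoc)
    qed
    then show "(case p of (\<sigma>, \<pi>) \<Rightarrow> \<sigma> \<circ> \<pi>) = (case q of (\<sigma>, \<pi>) \<Rightarrow> \<sigma> \<circ> \<pi>) \<longleftrightarrow> p = q"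
      by (auto simp: pq)
  next
    fix p assume "p \<in> {\<sigma>. \<sigma> permutes U} \<times> ?P S'"
    then obtain \<sigma> \<pi> where p: "p = (\<sigma>, \<pi>)" and \<sigma>: "\<sigma> permutes U" and
      \<pi>: "\<pi> permutes S'" "\<And>t. t \<in> S' \<Longrightarrow> g (\<pi> t) = g t"
      by auto
    have "\<sigma> \<circ> \<pi> permutes S"
      using permutes_subset[OF \<sigma>, of S] permutes_subset[OF \<pi>(1), of S] S(1)
      by (intro permutes_compose) auto
    moreover have "g (\<sigma> (\<pi> t)) = g t" if "t \<in> S" for t
    proof (cases "t \<in> S'")
      case True
      then have "\<pi> t \<notin> U"
        using permutes_in_image[OF \<pi>(1)] S(2) by blast
      then show ?thesis
        using True \<sigma> \<pi>(2) by (simp add: permutes_def)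
    next
      case False
      then have "t \<in> U" "\<pi> t = t"
        using that S(1) \<pi>(1) by (auto simp: permutes_def)
      then have "\<sigma> (\<pi> t) \<in> U"
        using permutes_in_image[OF \<sigma>] by simp
      with \<open>t \<in> U\<close> show ?thesis by (simp add: U_def)
    qed
    ultimately show "(case p of (\<sigma>, \<pi>) \<Rightarrow> \<sigma> \<circ> \<pi>) \<in> ?P S"
      by (simp add: p)
  next
    fix \<rho> assume "\<rho> \<in> ?P S"
    then have \<rho>: "\<rho> permutes S" "\<And>t. t \<in> S \<Longrightarrow> g (\<rho> t) = g t"
      by auto
    \<comment> \<open>Each factor is \<rho> on one of the two invariant parts and the identity
      elsewhere.\<close>
    define \<sigma> where "\<sigma> t = (if t \<in> U then \<rho> t else t)" for t
    define \<pi> where "\<pi> t = (if t \<in> S' then \<rho> t else t)" for t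
    have part: "(\<lambda>t. if t \<in> V then \<rho> t else t) permutes V"
      if V: "finite V" "\<And>t. t \<in> V \<Longrightarrow> \<rho> t \<in> V" for V
    proof (rule bij_imp_permutes)
      have "inj_on \<rho> V"
        using permutes_inj[OF \<rho>(1)] by (rule inj_on_subset) simp
      then have "bij_betw \<rho> V V"
        using endo_inj_surj[OF V(1)] V(2) by (simp add: bij_betw_def image_subset_iff)
      then show "bij_betw (\<lambda>t. if t \<in> V then \<rho> t else t) V V"
        by (subst bij_betw_cong[where g=\<rho>]) simp_all
    qed simp
    have "\<rho> t \<in> U" if "t \<in> U" for t
      using that \<rho>(2) permutes_in_image[OF \<rho>(1)] by (simp add: U_def)
    then have "\<sigma> permutes U"
      unfolding \<sigma>_def by (rule part[OF fin(1)])
    moreover have S'_closed: "\<rho> t \<in> S'" if "t \<in> S'" for t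
      using that \<rho>(2) permutes_in_image[OF \<rho>(1)] by (simp add: S'_def)
    then have "\<pi> permutes S'"
      unfolding \<pi>_def by (rule part[OF fin(2)])
    moreover have "g (\<pi> t) = g t" if "t \<in> S'" for t
      using that \<rho>(2) S(1) by (simp add: \<pi>_def)
    moreover have "\<rho> t = \<sigma> (\<pi> t)" for t
    proof -
      consider "t \<in> U" "t \<notin> S'" | "t \<in> S'" "\<rho> t \<notin> U" | "t \<notin> S" "t \<notin> U" "t \<notin> S'"
        using S S'_closed by blast
      then show ?thesis
        by cases (use \<rho>(1) in \<open>simp_all add: \<sigma>_def \<pi>_def permutes_def\<close>)
    qed
    ultimately show "\<exists>p\<in>{\<sigma>. \<sigma> permutes U} \<times> ?P S'. \<rho> = (case p of (\<sigma>, \<pi>) \<Rightarrow> \<sigma> \<circ> \<pi>)"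
      by (intro bexI[of _ "(\<sigma>, \<pi>)"]) (auto simp: fun_eq_iff)
  qed
  then have "card ({\<sigma>. \<sigma> permutes U} \<times> ?P S') = card (?P S)"
    by (rule bij_betw_same_card)
  then have "card (?P S) = fact (card U) * card (?P S')"
    by (simp only: card_cartesian_product card_permutations[OF refl fin(1)])
  moreover have "{t\<in>S'. g t = z} = {t\<in>S. g t = z}" if "z \<in> B" for z
    using that insert.hyps by (auto simp: S'_def)
  ultimately show ?case
    using insert.hyps by (simp add: IH U_def)
qed

lemma card_fiber_group:
  assumes "finite B" "g ` {1..r} \<subseteq> B"
  shows "card (fiber_group r g) = (\<Prod>y\<in>B. fact (card {t\<in>{1..r}. g t = y}))"
  unfolding fiber_group_def using assms by (intro card_permutes_fibers_aux) auto

text \<open>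
  For \<open>h\<close> the column function of a tableau and \<open>p = True\<close>, or the row function and \<open>p = False\<close>,
  the order of the following group is the normalizing factor of the modified symmetrizers.
\<close>

definition young_label ::
    "nat \<Rightarrow> (nat \<Rightarrow> nat) \<Rightarrow> bool \<Rightarrow> (nat \<Rightarrow> nat) \<Rightarrow> nat \<Rightarrow> nat \<times> nat + nat" where
  "young_label m h p j t = (if odd_sym m (j t) = p then Inl (h t, j t) else Inr t)"

abbreviation young_group ::
    "nat \<Rightarrow> nat \<Rightarrow> (nat \<Rightarrow> nat) \<Rightarrow> bool \<Rightarrow> (nat \<Rightarrow> nat) \<Rightarrow> (nat \<Rightarrow> nat) set" where
  "young_group m r h p j \<equiv> fiber_group r (young_label m h p j)"

text \<open>Positions whose parity differs from \<open>p\<close> carry pairwise distinct labels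
  \<open>Inr t\<close> and are therefore fixed; the \<open>Inl\<close> labels record both the value
  of \<open>h\<close> and the symbol.\<close>

lemma mem_young_group_iff:
  "\<pi> \<in> young_group m r h p j \<longleftrightarrow>
    \<pi> \<in> fiber_group r h \<and> j \<circ> \<pi> = j \<and> (\<forall>t\<in>{1..r}. odd_sym m (j t) \<noteq> p \<longrightarrow> \<pi> t = t)"
  (is "?L \<longleftrightarrow> ?R")
proof
  assume L: ?L
  then have \<pi>: "\<pi> permutes {1..r}" and lab: "\<And>t. t \<in> {1..r} \<Longrightarrow>
      young_label m h p j (\<pi> t) = young_label m h p j t"
    by (auto simp: fiber_group_def)
  have *: "h (\<pi> t) = h t \<and> j (\<pi> t) = j t \<and> (odd_sym m (j t) \<noteq> p \<longrightarrow> \<pi> t = t)" if "t \<in> {1..r}" for t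
    using lab[OF that] by (auto simp: young_label_def split: if_splits)
  moreover have "j (\<pi> t) = j t" for t
    using * \<pi> by (cases "t \<in> {1..r}") (auto simp: permutes_def)
  ultimately show ?R
    using \<pi> by (auto simp: fiber_group_def)
next
  assume R: ?R
  then have "\<pi> permutes {1..r}" "\<And>t. t \<in> {1..r} \<Longrightarrow> h (\<pi> t) = h t" "\<And>t. j (\<pi> t) = j t"
    by (auto simp: fiber_group_def fun_eq_iff)
  then show ?L
    using R by (auto simp: fiber_group_def young_label_def)
qed

text \<open>Recording the value of \<open>a\<close> in the label forces \<open>a\<close> to be
  stabilized; in this form stabilizers are accessible to
  \<open>fiber_group_card_dvd\<close>.\<close>

lemma stabilizer_fiber_group:
  "{\<pi>\<in>fiber_group r g. a \<circ> \<pi> = a} = fiber_group r (\<lambda>t. (g t, a t))"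
proof (intro set_eqI iffI)
  fix \<pi> assume "\<pi> \<in> {\<pi>\<in>fiber_group r g. a \<circ> \<pi> = a}"
  then show "\<pi> \<in> fiber_group r (\<lambda>t. (g t, a t))"
    by (auto simp: fiber_group_def fun_eq_iff)
next
  fix \<pi> assume \<pi>: "\<pi> \<in> fiber_group r (\<lambda>t. (g t, a t))"
  then have "a (\<pi> t) = a t" for t
    by (cases "t \<in> {1..r}") (auto simp: fiber_group_def permutes_def)
  with \<pi> show "\<pi> \<in> {\<pi>\<in>fiber_group r g. a \<circ> \<pi> = a}"
    by (auto simp: fiber_group_def)
qed

text \<open>A position moved by the stabilizer shares its values of \<open>a\<close> and of
  \<open>j\<close> with its image, so the assumption equates the two parities; its parity for
  \<open>j\<close> is \<open>p\<close>, hence also for \<open>a\<close>. The stabilizer is thus a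
  subgroup of the group attached to \<open>a\<close>.\<close>

lemma young_stabilizer_card_dvd:
  assumes "\<And>t u. t \<in> {1..r} \<Longrightarrow> u \<in> {1..r} \<Longrightarrow> t \<noteq> u \<Longrightarrow> a t = a u \<Longrightarrow> j t = j u \<Longrightarrow>
    odd_sym m (a t) = odd_sym m (j t)"
  shows "card {\<pi>\<in>young_group m r h p j. a \<circ> \<pi> = a} dvd card (young_group m r h p a)"
proof -
  have "{\<pi>\<in>young_group m r h p j. a \<circ> \<pi> = a} \<subseteq> young_group m r h p a"
  proof clarify
    fix \<pi> assume \<pi>: "\<pi> \<in> young_group m r h p j" and a: "a \<circ> \<pi> = a"
    note \<pi>' = \<pi>[unfolded mem_young_group_iff]
    have "\<pi> t = t" if t: "t \<in> {1..r}" "odd_sym m (a t) \<noteq> p" for t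
    proof (rule ccontr)
      assume ne: "\<pi> t \<noteq> t"
      have "\<pi> t \<in> {1..r}"
        using permutes_in_image[OF fiber_group_permutes[OF \<pi>]] t(1) by blast
      moreover have "a (\<pi> t) = a t" "j (\<pi> t) = j t"
        using a \<pi>' by (metis comp_apply)+
      ultimately have "odd_sym m (a t) = odd_sym m (j t)"
        using assms[of t "\<pi> t"] t(1) ne by simp
      moreover have "odd_sym m (j t) = p"
        using \<pi>' t(1) ne by blast
      ultimately show False using t(2) by simp
    qed
    then show "\<pi> \<in> young_group m r h p a"
      using \<pi>' a by (simp add: mem_young_group_iff)
  qed
  then show ?thesis
    unfolding stabilizer_fiber_group by (rule fiber_group_card_dvd)
qed

text \<open>The \<open>Inl\<close> labels give the factorials, while each \<open>Inr\<close> label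
  occurs at most once and gives 1. \<open>Q\<close> and \<open>A\<close> may exceed what occurs, to
  match products over all rows or columns and all symbols of one parity.\<close>

lemma card_young_group:
  assumes "finite Q" "finite A" "h ` {1..r} \<subseteq> Q"
    and "\<And>t. t \<in> {1..r} \<Longrightarrow> odd_sym m (j t) = p \<Longrightarrow> j t \<in> A" "\<And>a. a \<in> A \<Longrightarrow> odd_sym m a = p"
  shows "card (young_group m r h p j) =
    (\<Prod>a\<in>A. \<Prod>q\<in>Q. fact (card {t\<in>{1..r}. h t = q \<and> j t = a}))"
proof -
  let ?g = "young_label m h p j"
  let ?B = "Inl ` (Q \<times> A) \<union> Inr ` {1..r}"
  have "?g ` {1..r} \<subseteq> ?B"
    using assms(3,4) by (auto simp: young_label_def)
  then have "card (young_group m r h p j) = (\<Prod>y\<in>?B. fact (card {t\<in>{1..r}. ?g t = y}))"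
    using assms(1,2) by (intro card_fiber_group) auto
  also have "\<dots> = (\<Prod>y\<in>Inl ` (Q \<times> A). fact (card {t\<in>{1..r}. ?g t = y})) *
      (\<Prod>y\<in>Inr ` {1..r}. fact (card {t\<in>{1..r}. ?g t = y}))"
    using assms(1,2) by (intro prod.union_disjoint) auto
  also have "(\<Prod>y\<in>Inr ` {1..r}. fact (card {t\<in>{1..r}. ?g t = y})) = (1 :: nat)"
  proof (rule prod.neutral, clarify)
    fix s
    define N where "N = card {t\<in>{1..r}. ?g t = Inr s}"
    have "N \<le> card {s}"
      unfolding N_def by (rule card_mono) (auto simp: young_label_def split: if_splits)
    then have "N = 0 \<or> N = 1"
      by auto
    then show "fact (card {t\<in>{1..r}. ?g t = Inr s}) = (1 :: nat)"
      unfolding N_def[symmetric] by auto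
  qed
  also have "(\<Prod>y\<in>Inl ` (Q \<times> A). fact (card {t\<in>{1..r}. ?g t = y})) =
      (\<Prod>(q, a)\<in>Q \<times> A. fact (card {t\<in>{1..r}. h t = q \<and> j t = a}) :: nat)"
  proof (subst prod.reindex, simp, rule prod.cong[OF refl], clarsimp simp only: o_apply prod.case)
    fix q a assume "a \<in> A"
    then have "{t\<in>{1..r}. ?g t = Inl (q, a)} = {t\<in>{1..r}. h t = q \<and> j t = a}"
      using assms(5) by (auto simp: young_label_def split: if_splits)
    then show "fact (card {t\<in>{1..r}. ?g t = Inl (q, a)}) =
        (fact (card {t\<in>{1..r}. h t = q \<and> j t = a}) :: nat)"
      by simp
  qed
  also have "\<dots> = (\<Prod>q\<in>Q. \<Prod>a\<in>A. fact (card {t\<in>{1..r}. h t = q \<and> j t = a}))"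
    by (rule prod.cartesian_product[symmetric])
  also have "\<dots> = (\<Prod>a\<in>A. \<Prod>q\<in>Q. fact (card {t\<in>{1..r}. h t = q \<and> j t = a}))"
    by (rule prod.swap)
  finally show ?thesis by simp
qed

lemma part_antimono:
  assumes "is_partition r lam" "1 \<le> p" "p \<le> q"
  shows "part lam q \<le> part lam p"
proof (cases "p < q \<and> q \<le> length lam")
  case True
  then have "p - 1 < q - 1" "q - 1 < length lam"
    using assms(2) by auto
  then have "lam ! (p - 1) \<ge> lam ! (q - 1)"
    using assms sorted_wrt_nth_less[of "(\<ge>)" lam "p - 1" "q - 1"] by (simp add: is_partition_def)
  then show ?thesis
    using True assms(2) by (simp add: part_def)
next
  case False
  then show ?thesis
    using assms(3) by (auto simp: part_def)
qed

lemma card_tableau_boxes: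
  assumes T: "basic_tableau r lam T" and P: "\<And>b. b \<in> diagram lam \<Longrightarrow> P (T b) = Q b"
  shows "card {t\<in>{1..r}. P t} = card {b\<in>diagram lam. Q b}"
proof -
  have "{t\<in>{1..r}. P t} = T ` {b\<in>diagram lam. Q b}"
    using P basic_tableau_obtain[OF T] basic_tableau_range[OF T] by blast
  moreover have "inj_on T {b\<in>diagram lam. Q b}"
    using T unfolding basic_tableau_def bij_betw_def by (blast intro: inj_on_subset)
  ultimately show ?thesis
    by (simp add: card_image)
qed

lemma row_fact_eq_card:
  assumes T: "basic_tableau r lam T" and i: "i \<in> multiindices m n r"
  shows "row_fact m lam T i = card (young_group m r (tableau_row lam T) False i)"
proof -
  have "tableau_row lam T ` {1..r} \<subseteq> {1..length lam}"
  proof clarify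
    fix t assume "t \<in> {1..r}"
    then obtain b where "b \<in> diagram lam" "t = T b"
      using basic_tableau_obtain[OF T] by blast
    then show "tableau_row lam T t \<in> {1..length lam}"
      by (auto simp: tableau_row_apply[OF T] diagram_def)
  qed
  then have "card (young_group m r (tableau_row lam T) False i) =
    (\<Prod>a = 1..m. \<Prod>q = 1..length lam. fact (card {t\<in>{1..r}. tableau_row lam T t = q \<and> i t = a}))"
    using multiindices_range[OF i] by (intro card_young_group) (auto simp: odd_sym_def)
  also have "\<dots> = row_fact m lam T i"
    unfolding row_fact_def row_count_def
    by (intro prod.cong refl arg_cong[where f=fact] card_tableau_boxes[OF T])
      (simp add: tableau_row_apply[OF T])
  finally show ?thesis ..
qed

text \<open>Parity \<open>True\<close> selects the odd symbols. The partition property bounds every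
  column number by the first part.\<close>

lemma col_fact_eq_card:
  assumes T: "basic_tableau r lam T" and lam: "is_partition r lam" and j: "j \<in> multiindices m n r"
  shows "col_fact m n lam T j = card (young_group m r (tableau_col lam T) True j)"
proof -
  have "tableau_col lam T ` {1..r} \<subseteq> {1..part lam 1}"
  proof clarify
    fix t assume "t \<in> {1..r}"
    then obtain b where "b \<in> diagram lam" "t = T b"
      using basic_tableau_obtain[OF T] by blast
    then show "tableau_col lam T t \<in> {1..part lam 1}"
      using part_antimono[OF lam, of 1 "fst b"]
      by (auto simp: tableau_col_apply[OF T] diagram_def)
  qed
  then have "card (young_group m r (tableau_col lam T) True j) =
    (\<Prod>a = m + 1..m + n. \<Prod>d = 1..part lam 1.
      fact (card {t\<in>{1..r}. tableau_col lam T t = d \<and> j t = a}))"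
    using multiindices_range[OF j] by (intro card_young_group) (auto simp: odd_sym_def)
  also have "\<dots> = col_fact m n lam T j"
    unfolding col_fact_def col_count_def
    by (intro prod.cong refl arg_cong[where f=fact] card_tableau_boxes[OF T])
      (simp add: tableau_col_apply[OF T])
  finally show ?thesis ..
qed

section \<open>The integral form\<close>

lemma qscale_subspace_imp_int_subspace:
  assumes "q_mod.subspace V"
  shows "z_mod.subspace V"
  using assms
  by (intro z_mod.subspaceI)
    (auto simp: of_int_mult_eq_qscale q_mod.subspace_0 q_mod.subspace_add q_mod.subspace_scale)

lemma linear_on_of_int_mult:
  assumes "linear_on qscale V F" "x \<in> V"
  shows "F (of_int k * x) = of_int k * F x"
  using assms by (simp add: of_int_mult_eq_qscale linear_on_scale)

lemma linear_on_maps_span: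
  assumes F: "linear_on qscale (A_deg m n r) F" and G: "G \<subseteq> A_deg m n r"
    and V: "q_mod.subspace V" and gen: "\<And>g. g \<in> G \<Longrightarrow> F g \<in> V" and x: "x \<in> q_mod.span G"
  shows "F x \<in> V"
proof -
  let ?E = "{x\<in>A_deg m n r. F x \<in> V}"
  have "q_mod.subspace ?E"
    using subspace_A_deg[of m n r] V
    by (intro q_mod.subspaceI)
      (auto simp: linear_on_zero[OF F] linear_on_add[OF F] linear_on_scale[OF F]
        intro: q_mod.subspace_0 q_mod.subspace_add q_mod.subspace_scale)
  moreover have "G \<subseteq> ?E" using G gen by blast
  ultimately show ?thesis
    using q_mod.span_minimal x by blast
qed

lemma linear_on_maps_int_span:
  assumes F: "linear_on qscale (A_deg m n r) F" and G: "G \<subseteq> A_deg m n r"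
    and V: "z_mod.subspace V" and gen: "\<And>g. g \<in> G \<Longrightarrow> F g \<in> V" and x: "x \<in> z_mod.span G"
  shows "F x \<in> V"
proof -
  let ?E = "{x\<in>A_deg m n r. F x \<in> V}"
  note A = qscale_subspace_imp_int_subspace[OF subspace_A_deg[of m n r]]
  have "z_mod.subspace ?E"
    using A V
    by (intro z_mod.subspaceI)
      (auto simp: linear_on_zero[OF F subspace_A_deg] linear_on_add[OF F] linear_on_of_int_mult[OF F]
        intro: z_mod.subspace_0 z_mod.subspace_add z_mod.subspace_scale)
  moreover have "G \<subseteq> ?E" using G gen by blast
  ultimately show ?thesis
    using z_mod.span_minimal x by blast
qed

section \<open>The grading by parity\<close>

lemma subspace_A_part: "q_mod.subspace (A_part m n r e)"
  unfolding A_part_def by simp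

lemma chi_in_A_part:
  assumes "i \<in> multiindices m n r" "j \<in> multiindices m n r"
  shows "chi m r i j \<in> A_part m n r (odd ((\<Sum>t = 1..r. par m (i t)) + (\<Sum>t = 1..r. par m (j t))))"
proof -
  have "(\<Sum>(a, b)\<leftarrow>index_word r i j. par m a + par m b) = (\<Sum>t\<leftarrow>[1..<r + 1]. par m (i t) + par m (j t))"
    by (simp add: index_word_def comp_def del: upt_Suc)
  also have "\<dots> = (\<Sum>t = 1..r. par m (i t)) + (\<Sum>t = 1..r. par m (j t))"
    by (simp add: interv_sum_list_conv_sum_set_nat atLeastLessThanSuc_atLeastAtMost sum.distrib
        del: upt_Suc)
  finally have "monomial m (index_word r i j) \<in>
      A_part m n r (odd ((\<Sum>t = 1..r. par m (i t)) + (\<Sum>t = 1..r. par m (j t))))"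
    unfolding A_part_def monomial_def
    using index_word_range[OF assms] by (intro q_mod.span_base) auto
  then show ?thesis
    unfolding chi_eq qscale_neg_one_power by (rule q_mod.subspace_scale[OF subspace_A_part])
qed

text \<open>Permuting the two multiindices independently preserves the number of odd symbols in
  each, so all terms have the same parity.\<close>

lemma symmetrizer_in_A_part:
  assumes T: "basic_tableau r lam T" and ij: "i \<in> multiindices m n r" "j \<in> multiindices m n r"
  obtains e where "symmetrizer m r lam T i j \<in> A_part m n r e"
proof
  let ?e = "odd ((\<Sum>t = 1..r. par m (i t)) + (\<Sum>t = 1..r. par m (j t)))"
  have "chi m r (i \<circ> \<rho>) (j \<circ> \<kappa>) \<in> A_part m n r ?e"
    if "\<rho> permutes {1..r}" "\<kappa> permutes {1..r}" for \<rho> \<kappa>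
  proof -
    have "(\<Sum>t = 1..r. par m ((k \<circ> \<pi>) t)) = (\<Sum>t = 1..r. par m (k t))"
      if "\<pi> permutes {1..r}" for k \<pi>
      using sum.permute[OF that, of "\<lambda>t. par m (k t)"] by (simp add: comp_def)
    then show ?thesis
      using chi_in_A_part[OF multiindices_compose[OF ij(1) that(1)] multiindices_compose[OF ij(2) that(2)]]
        that by simp
  qed
  then show "symmetrizer m r lam T i j \<in> A_part m n r ?e"
    unfolding symmetrizer_eq[OF T]
    by (intro q_mod.subspace_sum[OF subspace_A_part] q_mod.subspace_scale[OF subspace_A_part])
      (simp_all only: fiber_group_permutes)
qed

text \<open>Sums of an even and an odd element of the span form a subspace, and it contains the
  generators because each of them is homogeneous.\<close>

lemma graded_span:
  assumes "\<And>g. g \<in> G \<Longrightarrow> \<exists>e. g \<in> A_part m n r e"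
  shows "graded m n r (q_mod.span G)"
proof -
  let ?V = "q_mod.span G"
  let ?W = "{x0 + x1 | x0 x1. x0 \<in> ?V \<inter> A_part m n r False \<and> x1 \<in> ?V \<inter> A_part m n r True}"
  have sub: "q_mod.subspace (?V \<inter> A_part m n r e)" for e
    by (intro q_mod.subspace_inter q_mod.subspace_span subspace_A_part)
  have "G \<subseteq> ?W"
  proof
    fix g assume g: "g \<in> G"
    obtain e where "g \<in> A_part m n r e" using assms[OF g] by blast
    then have "g \<in> ?V \<inter> A_part m n r e" using q_mod.span_base[OF g] by blast
    then show "g \<in> ?W"
      using q_mod.subspace_0[OF sub] by (cases e) (force intro: exI[of _ 0] exI[of _ g])+
  qed
  then have "?V \<subseteq> ?W"
    by (rule q_mod.span_minimal) (rule q_mod.subspace_sums[OF sub sub])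
  then show ?thesis
    unfolding graded_def by blast
qed

lemma int_subspace_sums:
  fixes S U :: "'a::ring_1 set"
  assumes "z_mod.subspace S" "z_mod.subspace U"
  shows "z_mod.subspace {x + y | x y. x \<in> S \<and> y \<in> U}"
proof (rule z_mod.subspaceI)
  show "0 \<in> {x + y | x y. x \<in> S \<and> y \<in> U}"
    using assms[THEN z_mod.subspace_0] by force
next
  fix v w assume "v \<in> {x + y | x y. x \<in> S \<and> y \<in> U}" "w \<in> {x + y | x y. x \<in> S \<and> y \<in> U}"
  then obtain x y x' y' where "x \<in> S" "y \<in> U" "x' \<in> S" "y' \<in> U" "v + w = (x + x') + (y + y')"
    by (auto simp: algebra_simps)
  then show "v + w \<in> {x + y | x y. x \<in> S \<and> y \<in> U}"
    using assms[THEN z_mod.subspace_add] by blast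
next
  fix k :: int and v assume "v \<in> {x + y | x y. x \<in> S \<and> y \<in> U}"
  then obtain x y where "x \<in> S" "y \<in> U" "of_int k * v = of_int k * x + of_int k * y"
    by (auto simp: distrib_left)
  then show "of_int k * v \<in> {x + y | x y. x \<in> S \<and> y \<in> U}"
    using assms[THEN z_mod.subspace_scale] by blast
qed

lemma graded_int_span:
  assumes "\<And>g. g \<in> G \<Longrightarrow> \<exists>e. g \<in> A_part m n r e"
  shows "graded m n r (z_mod.span G)"
proof -
  let ?V = "z_mod.span G"
  let ?W = "{x0 + x1 | x0 x1. x0 \<in> ?V \<inter> A_part m n r False \<and> x1 \<in> ?V \<inter> A_part m n r True}"
  have sub: "z_mod.subspace (?V \<inter> A_part m n r e)" for e
    by (intro z_mod.subspace_inter z_mod.subspace_span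
        qscale_subspace_imp_int_subspace subspace_A_part)
  have "G \<subseteq> ?W"
  proof
    fix g assume g: "g \<in> G"
    obtain e where "g \<in> A_part m n r e" using assms[OF g] by blast
    then have "g \<in> ?V \<inter> A_part m n r e" using z_mod.span_base[OF g] by blast
    then show "g \<in> ?W"
      using z_mod.subspace_0[OF sub] by (cases e) (force intro: exI[of _ 0] exI[of _ g])+
  qed
  then have "?V \<subseteq> ?W"
    by (rule z_mod.span_minimal) (rule int_subspace_sums[OF sub sub])
  then show ?thesis
    unfolding graded_def by blast
qed

section \<open>Integrality of the action on modified symmetrizers\<close>

lemma row_fact_pos: "row_fact m lam T i \<noteq> 0"
  by (simp add: row_fact_def)

lemma col_fact_pos: "col_fact m n lam T j \<noteq> 0"
  by (simp add: col_fact_def)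

lemma modified_symmetrizer_in_A_lam_Z:
  assumes "i \<in> multiindices m n r" "j \<in> multiindices m n r"
  shows "modified_symmetrizer m n r lam T i j \<in> A_lam_Z m n r lam T"
  unfolding A_lam_Z_def using assms by (intro z_mod.span_base) blast

lemma subspace_A_lam_Z: "z_mod.subspace (A_lam_Z m n r lam T)"
  unfolding A_lam_Z_def by simp

lemma int_multiple_in_A_lam_Z:
  assumes "i \<in> multiindices m n r" "j \<in> multiindices m n r"
    and "q = of_int k / of_nat (row_fact m lam T i * col_fact m n lam T j)"
  shows "qscale q (symmetrizer m r lam T i j) \<in> A_lam_Z m n r lam T"
proof -
  have "of_int k * modified_symmetrizer m n r lam T i j \<in> A_lam_Z m n r lam T"
    by (intro z_mod.subspace_scale[OF subspace_A_lam_Z] modified_symmetrizer_in_A_lam_Z assms)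
  then show ?thesis
    by (simp add: modified_symmetrizer_def of_int_mult_eq_qscale assms(3))
qed

lemma left_act_modified_symmetrizer:
  assumes T: "basic_tableau r lam T" and lam: "is_partition r lam" and \<xi>: "\<xi> \<in> S_Z m n r"
    and ij: "i \<in> multiindices m n r" "j \<in> multiindices m n r"
  shows "left_act m n r \<xi> (modified_symmetrizer m n r lam T i j) \<in> A_lam_Z m n r lam T"
proof -
  note \<xi>Q = S_Z_integral(1)[OF \<xi>] and \<xi>Z = S_Z_integral(2)[OF \<xi>]
  let ?G = "young_group m r (tableau_col lam T) True j"
  let ?I = "multiindices m n r" and ?ri = "row_fact m lam T i"
  \<comment> \<open>The row factor belongs to \<open>i\<close>, which stays fixed, and goes into the
    coefficient. The column factor is the order of \<open>?G\<close> and becomes the averaging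
    factor.\<close>
  define f where "f a = qscale (\<xi> (chi m r a j) / of_nat ?ri) (symmetrizer m r lam T i a)" for a
  have "left_act m n r \<xi> (modified_symmetrizer m n r lam T i j) =
      qscale (1 / of_nat (?ri * card ?G))
        (\<Sum>a\<in>?I. qscale (\<xi> (chi m r a j)) (symmetrizer m r lam T i a))"
    unfolding modified_symmetrizer_def col_fact_eq_card[OF T lam ij(2)]
    by (simp only: linear_on_scale[OF left_act_chi(1)[OF \<xi>Q] symmetrizer_in_A_deg[OF T ij]]
        left_act_symmetrizer[OF T \<xi>Q ij])
  also have "\<dots> = qscale (1 / of_nat (card ?G)) (\<Sum>a\<in>?I. f a)"
    by (simp add: f_def q_mod.scale_sum_right mult.commute)
  also have "\<dots> \<in> A_lam_Z m n r lam T"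
  proof (rule orbit_sum_mem[OF subspace_A_lam_Z])
    fix a \<pi> assume a: "a \<in> ?I" and \<pi>: "\<pi> \<in> ?G"
    then have \<pi>C: "\<pi> \<in> fiber_group r (tableau_col lam T)" and j: "j \<circ> \<pi> = j"
      and fixes_even: "\<And>t. t \<in> {1..r} \<Longrightarrow> \<not> odd_sym m (j t) \<Longrightarrow> \<pi> t = t"
      by (simp_all add: mem_young_group_iff)
    note perm = fiber_group_permutes[OF \<pi>C]
    have "\<pi> permutes {t\<in>{1..r}. odd_sym m (j t)}"
      using perm by (rule permutes_superset) (use fixes_even in auto)
    \<comment> \<open>\<pi> moves only odd symbols of \<open>j\<close>, so the alternating sign from
      the symmetrizer equals the action sign of \<open>j\<close> coming from \<xi> and cancels
      it.\<close>
    then have sign: "star_sign m r j \<pi> = sign \<pi>"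
      by (rule star_sign_odd_permutes)
    have "\<xi> (chi m r (a \<circ> \<pi>) j) = rat_sign m r a \<pi> * rat_sign m r j \<pi> * \<xi> (chi m r a j)"
      using S_Q_chi_permutes[OF \<xi>Q a ij(2) perm] by (simp only: j)
    moreover have "rat_sign m r a \<pi> * rat_sign m r j \<pi> * \<xi> (chi m r a j) / of_nat ?ri *
        (rat_sign m r j \<pi> * rat_sign m r a \<pi>) = \<xi> (chi m r a j) / of_nat ?ri"
      using rat_sign_mult_self[of m r a \<pi>] rat_sign_mult_self[of m r j \<pi>]
      unfolding divide_inverse by algebra
    ultimately show "f (a \<circ> \<pi>) = f a"
      by (simp only: f_def symmetrizer_right_permute[OF T \<pi>C] sign[symmetric] q_mod.scale_scale)
  next
    fix a assume a: "a \<in> ?I"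
    let ?s = "card {\<pi>\<in>?G. a \<circ> \<pi> = a}"
    show "qscale (1 / of_nat ?s) (f a) \<in> A_lam_Z m n r lam T"
    proof (cases "\<xi> (chi m r a j) = 0")
      case True
      then show ?thesis
        using z_mod.subspace_0[OF subspace_A_lam_Z] by (simp add: f_def)
    next
      case False
      \<comment> \<open>A nonzero value excludes a repeated odd generator, which is the assumption
        needed for divisibility.\<close>
      have "?s dvd col_fact m n lam T a"
        unfolding col_fact_eq_card[OF T lam a]
        using S_Q_chi_eq_zero[OF \<xi>Q a ij(2)] False by (intro young_stabilizer_card_dvd) blast
      \<comment> \<open>With \<open>d\<close> the index of the stabilizer, \<open>1 / ?s\<close>
        becomes \<open>d\<close> over the column factor of \<open>a\<close>.\<close>
      then obtain d where d: "col_fact m n lam T a = ?s * d" ..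
      obtain k where k: "\<xi> (chi m r a j) = of_int k"
        using \<xi>Z[OF a ij(2)] by (rule Ints_cases)
      have "?s \<noteq> 0" "d \<noteq> 0"
        using d col_fact_pos[of m n lam T a] by auto
      then have "1 / of_nat ?s * (\<xi> (chi m r a j) / of_nat ?ri) =
          of_int (k * int d) / of_nat (?ri * col_fact m n lam T a)"
        unfolding d k by simp
      then show ?thesis
        unfolding f_def q_mod.scale_scale by (rule int_multiple_in_A_lam_Z[OF ij(1) a])
    qed
  qed
  finally show ?thesis .
qed

text \<open>The mirror image of the left action: the group now moves even symbols of
  \<open>i\<close> within rows and row sums carry no sign, so it suffices that its elements have
  action sign 1 on \<open>i\<close>.\<close>

lemma right_act_modified_symmetrizer:
  assumes T: "basic_tableau r lam T" and \<xi>: "\<xi> \<in> S_Z m n r"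
    and ij: "i \<in> multiindices m n r" "j \<in> multiindices m n r"
  shows "right_act m n r (modified_symmetrizer m n r lam T i j) \<xi> \<in> A_lam_Z m n r lam T"
proof -
  note \<xi>Q = S_Z_integral(1)[OF \<xi>] and \<xi>Z = S_Z_integral(2)[OF \<xi>]
  let ?G = "young_group m r (tableau_row lam T) False i"
  let ?I = "multiindices m n r" and ?cj = "col_fact m n lam T j"
  define f where "f b = qscale (\<xi> (chi m r i b) / of_nat ?cj) (symmetrizer m r lam T b j)" for b
  have "right_act m n r (modified_symmetrizer m n r lam T i j) \<xi> =
      qscale (1 / of_nat (card ?G * ?cj))
        (\<Sum>b\<in>?I. qscale (\<xi> (chi m r i b)) (symmetrizer m r lam T b j))"
    unfolding modified_symmetrizer_def row_fact_eq_card[OF T ij(1)]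
    by (simp only: linear_on_scale[OF right_act_chi(1)[OF \<xi>Q] symmetrizer_in_A_deg[OF T ij]]
        right_act_symmetrizer[OF T \<xi>Q ij])
  also have "\<dots> = qscale (1 / of_nat (card ?G)) (\<Sum>b\<in>?I. f b)"
    by (simp add: f_def q_mod.scale_sum_right)
  also have "\<dots> \<in> A_lam_Z m n r lam T"
  proof (rule orbit_sum_mem[OF subspace_A_lam_Z])
    fix b \<pi> assume b: "b \<in> ?I" and \<pi>: "\<pi> \<in> ?G"
    then have \<pi>R: "\<pi> \<in> fiber_group r (tableau_row lam T)" and i: "i \<circ> \<pi> = i"
      and fixes_odd: "\<And>t. t \<in> {1..r} \<Longrightarrow> odd_sym m (i t) \<Longrightarrow> \<pi> t = t"
      by (simp_all add: mem_young_group_iff)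
    note perm = fiber_group_permutes[OF \<pi>R]
    have sign: "star_sign m r i \<pi> = 1"
      using perm fixes_odd by (rule star_sign_fixes_odd)
    have "\<xi> (chi m r i (b \<circ> \<pi>)) = rat_sign m r b \<pi> * \<xi> (chi m r i b)"
      using S_Q_chi_permutes[OF \<xi>Q ij(1) b perm] by (simp add: i sign)
    moreover have "rat_sign m r b \<pi> * \<xi> (chi m r i b) / of_nat ?cj * rat_sign m r b \<pi> =
        \<xi> (chi m r i b) / of_nat ?cj"
      using rat_sign_mult_self[of m r b \<pi>] unfolding divide_inverse by algebra
    ultimately show "f (b \<circ> \<pi>) = f b"
      by (simp only: f_def symmetrizer_left_permute[OF T \<pi>R] q_mod.scale_scale)
  next
    fix b assume b: "b \<in> ?I"
    let ?s = "card {\<pi>\<in>?G. b \<circ> \<pi> = b}"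
    show "qscale (1 / of_nat ?s) (f b) \<in> A_lam_Z m n r lam T"
    proof (cases "\<xi> (chi m r i b) = 0")
      case True
      then show ?thesis
        using z_mod.subspace_0[OF subspace_A_lam_Z] by (simp add: f_def)
    next
      case False
      have "?s dvd row_fact m lam T b"
        unfolding row_fact_eq_card[OF T b]
        using S_Q_chi_eq_zero[OF \<xi>Q ij(1) b] False by (intro young_stabilizer_card_dvd) metis
      then obtain d where d: "row_fact m lam T b = ?s * d" ..
      obtain k where k: "\<xi> (chi m r i b) = of_int k"
        using \<xi>Z[OF ij(1) b] by (rule Ints_cases)
      have "?s \<noteq> 0" "d \<noteq> 0"
        using d row_fact_pos[of m lam T b] by auto
      then have "1 / of_nat ?s * (\<xi> (chi m r i b) / of_nat ?cj) =
          of_int (k * int d) / of_nat (row_fact m lam T b * ?cj)"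
        unfolding d k by simp
      then show ?thesis
        unfolding f_def q_mod.scale_scale by (rule int_multiple_in_A_lam_Z[OF b ij(2)])
    qed
  qed
  finally show ?thesis .
qed

section \<open>A symmetrizer that does not vanish\<close>

lemma tableau_position_eqI:
  assumes T: "basic_tableau r lam T" and "t \<in> {1..r}" "u \<in> {1..r}"
    and "tableau_row lam T t = tableau_row lam T u" "tableau_col lam T t = tableau_col lam T u"
  shows "t = u"
proof -
  obtain b b' where b: "b \<in> diagram lam" "t = T b" and b': "b' \<in> diagram lam" "u = T b'"
    using basic_tableau_obtain[OF T] assms(2,3) by metis
  have "b = b'"
    using assms(4,5) unfolding b(2) b'(2) tableau_row_apply[OF T b(1)] tableau_col_apply[OF T b(1)]
      tableau_row_apply[OF T b'(1)] tableau_col_apply[OF T b'(1)] by (rule prod_eqI)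
  then show ?thesis by (simp only: b(2) b'(2))
qed

text \<open>Even entries determine the row and odd entries the column of a box, which is what the
  sign computation exploits; \<open>restrict\<close> yields an extensional function.\<close>

definition hook_filling :: "nat \<Rightarrow> nat \<Rightarrow> nat list \<Rightarrow> (nat \<times> nat \<Rightarrow> nat) \<Rightarrow> nat \<Rightarrow> nat" where
  "hook_filling m r lam T = restrict (\<lambda>t. if tableau_row lam T t \<le> m then tableau_row lam T t
     else m + tableau_col lam T t) {1..r}"

text \<open>The hook condition enters here: rows below the first \<open>m\<close> have length at
  most \<open>part lam (m + 1)\<close>, hence at most \<open>n\<close>, so their column numbers give
  admissible odd symbols.\<close>

lemma hook_filling_mem:
  assumes lam: "hook_partition m n r lam" and T: "basic_tableau r lam T"
  shows "hook_filling m r lam T \<in> multiindices m n r"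
proof -
  have "hook_filling m r lam T t \<in> {1..m + n}" if t: "t \<in> {1..r}" for t
  proof -
    obtain b where b: "b \<in> diagram lam" "t = T b"
      using basic_tableau_obtain[OF T t] by blast
    have "snd b \<le> n" if "\<not> fst b \<le> m"
    proof -
      have "snd b \<le> part lam (fst b)"
        using b(1) by (auto simp: diagram_def)
      also have "\<dots> \<le> part lam (m + 1)"
        using lam that by (intro part_antimono[of r]) (auto simp: hook_partition_def)
      also have "\<dots> \<le> n"
        using lam by (simp add: hook_partition_def)
      finally show ?thesis .
    qed
    moreover have "1 \<le> fst b" "1 \<le> snd b"
      using b(1) by (auto simp: diagram_def)
    ultimately show ?thesis
      using t unfolding b(2)
      by (simp add: hook_filling_def tableau_row_apply[OF T b(1)] tableau_col_apply[OF T b(1)])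
  qed
  then show ?thesis
    by (simp add: multiindices_def PiE_iff hook_filling_def)
qed

text \<open>Equality of the rearrangements forces \<kappa> to fix the first \<open>m\<close> rows
  pointwise and \<rho> the remaining ones. Then \<rho> moves only even symbols and has action sign
  1, whereas \<kappa> moves only odd symbols and its two signs cancel.\<close>

lemma hook_filling_sign:
  assumes T: "basic_tableau r lam T"
    and \<rho>: "\<rho> \<in> fiber_group r (tableau_row lam T)" and \<kappa>: "\<kappa> \<in> fiber_group r (tableau_col lam T)"
    and eq: "hook_filling m r lam T \<circ> \<rho> = hook_filling m r lam T \<circ> \<kappa>"
  shows "sign \<kappa> * star_sign m r (hook_filling m r lam T) \<rho> *
    star_sign m r (hook_filling m r lam T) \<kappa> = 1"
proof -
  let ?h = "hook_filling m r lam T" and ?row = "tableau_row lam T" and ?col = "tableau_col lam T"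
  have col_pos: "1 \<le> ?col t" if t: "t \<in> {1..r}" for t
  proof -
    obtain b where "b \<in> diagram lam" "t = T b"
      using basic_tableau_obtain[OF T t] by blast
    then show ?thesis
      by (auto simp: tableau_col_apply[OF T] diagram_def)
  qed
  have odd_iff: "odd_sym m (?h t) \<longleftrightarrow> m < ?row t" if "t \<in> {1..r}" for t
    using that col_pos[OF that] by (auto simp: hook_filling_def odd_sym_def)
  have pt: "(?row t \<le> m \<longrightarrow> \<kappa> t = t) \<and> (m < ?row t \<longrightarrow> \<rho> t = t)" if t: "t \<in> {1..r}" for t
  proof -
    have mem: "\<rho> t \<in> {1..r}" "\<kappa> t \<in> {1..r}"
      using permutes_in_image[OF fiber_group_permutes[OF \<rho>]]
        permutes_in_image[OF fiber_group_permutes[OF \<kappa>]] t by blast+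
    have row: "?row (\<rho> t) = ?row t" and col: "?col (\<kappa> t) = ?col t"
      using \<rho> \<kappa> t by (auto simp: fiber_group_def)
    have h: "?h (\<rho> t) = ?h (\<kappa> t)"
      using eq by (metis comp_apply)
    have "\<kappa> t = t" if "?row t \<le> m"
    proof -
      \<comment> \<open>The even entry at \<open>\<rho> t\<close> is the row number of
        \<open>t\<close>; the same entry at \<open>\<kappa> t\<close> puts \<open>\<kappa> t\<close>
        in that row. The positive column numbers keep odd entries above \<open>m\<close>.\<close>
      have "?row (\<kappa> t) = ?row t"
        using h row that mem col_pos[OF mem(2)] by (auto simp: hook_filling_def split: if_splits)
      then show ?thesis
        by (rule tableau_position_eqI[OF T mem(2) t _ col])
    qed
    moreover have "\<rho> t = t" if "m < ?row t"
    proof -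
      \<comment> \<open>Here the common entry is odd and reveals the column, which \<kappa>
        preserves.\<close>
      have "?col (\<rho> t) = ?col t"
        using h row col that mem col_pos[OF mem(1)] by (auto simp: hook_filling_def split: if_splits)
      then show ?thesis
        by (rule tableau_position_eqI[OF T mem(1) t row])
    qed
    ultimately show ?thesis by blast
  qed
  have "star_sign m r ?h \<rho> = 1"
    using pt odd_iff by (intro star_sign_fixes_odd[OF fiber_group_permutes[OF \<rho>]]) auto
  moreover have "\<kappa> permutes {t\<in>{1..r}. odd_sym m (?h t)}"
    using fiber_group_permutes[OF \<kappa>] by (rule permutes_superset) (use pt odd_iff in force)
  then have "star_sign m r ?h \<kappa> = sign \<kappa>"
    by (rule star_sign_odd_permutes)
  ultimately show ?thesis by simp
qed

lemma symmetrizer_hook_filling_nonzero: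
  assumes lam: "hook_partition m n r lam" and T: "basic_tableau r lam T"
  shows "symmetrizer m r lam T (hook_filling m r lam T) (hook_filling m r lam T) \<noteq> 0"
proof
  let ?h = "hook_filling m r lam T"
  let ?R = "fiber_group r (tableau_row lam T)" and ?C = "fiber_group r (tableau_col lam T)"
  \<comment> \<open>The counit. Off the diagonal both sides of equivariance vanish; on it the two
    action signs coincide and multiply to 1.\<close>
  define f :: "(nat \<Rightarrow> nat) \<Rightarrow> (nat \<Rightarrow> nat) \<Rightarrow> rat" where "f k l = (if k = l then 1 else 0)" for k l
  have equivariant: "f (k \<circ> \<pi>) (l \<circ> \<pi>) = rat_sign m r k \<pi> * rat_sign m r l \<pi> * f k l"
    if \<pi>: "\<pi> permutes {1..r}" for k l \<pi>
  proof -
    have "k \<circ> \<pi> = l \<circ> \<pi> \<longleftrightarrow> k = l"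
      using surj_fun_eq[of \<pi> UNIV k l] permutes_surj[OF \<pi>] by (auto simp: fun_eq_iff)
    then show ?thesis by (simp add: f_def)
  qed
  obtain \<epsilon> where \<epsilon>: "linear_on (*) (A_deg m n r) \<epsilon>" "\<And>k l. k \<in> multiindices m n r \<Longrightarrow>
      l \<in> multiindices m n r \<Longrightarrow> \<epsilon> (chi m r k l) = f k l"
    by (rule chi_extension[OF vector_space_rat, of m n r f]) (simp_all add: equivariant)
  note h = hook_filling_mem[OF lam T]
  define v where "v \<rho> \<kappa> = of_int (sign \<kappa>) * rat_sign m r ?h \<rho> * rat_sign m r ?h \<kappa> *
    \<epsilon> (chi m r (?h \<circ> \<rho>) (?h \<circ> \<kappa>))" for \<rho> \<kappa>
  have v: "v \<rho> \<kappa> = (if ?h \<circ> \<rho> = ?h \<circ> \<kappa> then 1 else 0)" if "\<rho> \<in> ?R" "\<kappa> \<in> ?C" for \<rho> \<kappa>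
  proof -
    have "\<epsilon> (chi m r (?h \<circ> \<rho>) (?h \<circ> \<kappa>)) = f (?h \<circ> \<rho>) (?h \<circ> \<kappa>)"
      using that by (intro \<epsilon>(2) multiindices_compose[OF h] fiber_group_permutes)
    then show ?thesis
      using hook_filling_sign[OF T that, of m]
      by (auto simp: v_def f_def of_int_mult[symmetric] simp del: of_int_mult)
  qed
  assume "symmetrizer m r lam T ?h ?h = 0"
  then have zero: "(\<Sum>\<rho>\<in>?R. \<Sum>\<kappa>\<in>?C. v \<rho> \<kappa>) = 0"
    using linear_on_symmetrizer[OF T \<epsilon>(1) h h] linear_on_zero[OF \<epsilon>(1) subspace_A_deg]
    unfolding v_def by simp
  \<comment> \<open>All terms are 0 or 1, so the double sum is at least its term at the two
    identities.\<close>
  have "1 = v id id"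
    using v[OF id_fiber_group id_fiber_group] by simp
  also have "\<dots> \<le> (\<Sum>\<kappa>\<in>?C. v id \<kappa>)"
    by (rule member_le_sum[OF id_fiber_group, where f="v id"]) (simp_all add: v id_fiber_group)
  also have "\<dots> \<le> (\<Sum>\<rho>\<in>?R. \<Sum>\<kappa>\<in>?C. v \<rho> \<kappa>)"
    by (rule member_le_sum[OF id_fiber_group, where f="\<lambda>\<rho>. \<Sum>\<kappa>\<in>?C. v \<rho> \<kappa>"])
      (auto intro!: sum_nonneg simp: v)
  finally show False
    using zero by simp
qed

section \<open>The rational bimodule and its integral form\<close>

lemma subsuperbimodule_A_lam_Q:
  assumes T: "basic_tableau r lam T"
  shows "subsuperbimodule m n r (A_lam_Q m n r lam T)"
proof -
  let ?I = "multiindices m n r"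
  let ?G = "{symmetrizer m r lam T i j | i j. i \<in> ?I \<and> j \<in> ?I}"
  have G: "?G \<subseteq> A_deg m n r"
    using symmetrizer_in_A_deg[OF T] by blast
  have V: "q_mod.subspace (A_lam_Q m n r lam T)"
    unfolding A_lam_Q_def by simp
  have gen: "symmetrizer m r lam T i j \<in> A_lam_Q m n r lam T" if "i \<in> ?I" "j \<in> ?I" for i j
    unfolding A_lam_Q_def using that by (intro q_mod.span_base) blast
  have "A_lam_Q m n r lam T \<subseteq> A_deg m n r"
    unfolding A_lam_Q_def by (rule q_mod.span_minimal[OF G subspace_A_deg])
  moreover have "graded m n r (A_lam_Q m n r lam T)"
    unfolding A_lam_Q_def by (rule graded_span) (blast elim: symmetrizer_in_A_part[OF T])
  moreover have "left_act m n r \<xi> x \<in> A_lam_Q m n r lam T \<and> right_act m n r x \<xi> \<in> A_lam_Q m n r lam T"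
    if \<xi>: "\<xi> \<in> S_Q m n r" and x: "x \<in> A_lam_Q m n r lam T" for \<xi> x
  proof
    note x' = x[unfolded A_lam_Q_def]
    show "left_act m n r \<xi> x \<in> A_lam_Q m n r lam T"
    proof (rule linear_on_maps_span[OF left_act_chi(1)[OF \<xi>] G V _ x'], clarify)
      fix i j assume ij: "i \<in> ?I" "j \<in> ?I"
      show "left_act m n r \<xi> (symmetrizer m r lam T i j) \<in> A_lam_Q m n r lam T"
        unfolding left_act_symmetrizer[OF T \<xi> ij] using gen ij
        by (intro q_mod.subspace_sum[OF V] q_mod.subspace_scale[OF V]) blast
    qed
    show "right_act m n r x \<xi> \<in> A_lam_Q m n r lam T"
    proof (rule linear_on_maps_span[OF right_act_chi(1)[OF \<xi>] G V _ x'], clarify)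
      fix i j assume ij: "i \<in> ?I" "j \<in> ?I"
      show "right_act m n r (symmetrizer m r lam T i j) \<xi> \<in> A_lam_Q m n r lam T"
        unfolding right_act_symmetrizer[OF T \<xi> ij] using gen ij
        by (intro q_mod.subspace_sum[OF V] q_mod.subspace_scale[OF V]) blast
    qed
  qed
  ultimately show ?thesis
    using V by (simp add: subsuperbimodule_def bi_closed_def)
qed

theorem theorem5p1:
  fixes m n r :: nat and lam :: "nat list" and T :: "nat \<times> nat \<Rightarrow> nat"
  assumes "hook_partition m n r lam" and "basic_tableau r lam T"
  shows "Z_form m n r (A_lam_Q m n r lam T) (A_lam_Z m n r lam T)"
proof -
  note T = assms(2)
  have lam: "is_partition r lam"
    using assms(1) by (simp add: hook_partition_def)
  let ?I = "multiindices m n r" and ?V = "A_lam_Q m n r lam T" and ?L = "A_lam_Z m n r lam T"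
  let ?G = "{modified_symmetrizer m n r lam T i j | i j. i \<in> ?I \<and> j \<in> ?I}"
  have V: "q_mod.subspace ?V"
    unfolding A_lam_Q_def by simp
  have GV: "?G \<subseteq> ?V"
    unfolding modified_symmetrizer_def A_lam_Q_def
    by (clarify, rule q_mod.span_scale, rule q_mod.span_base) blast
  \<comment> \<open>The extension of closure from generators to the span uses linearity of the
    actions on the degree \<open>r\<close> part, so the generators have to lie there.\<close>
  have GA: "?G \<subseteq> A_deg m n r"
    using GV subsuperbimodule_A_lam_Q[OF T, of m n] unfolding subsuperbimodule_def by blast
  have "?L \<subseteq> ?V"
    unfolding A_lam_Z_def by (rule z_mod.span_minimal[OF GV qscale_subspace_imp_int_subspace[OF V]])
  moreover have "?L \<noteq> {0}"
  proof -
    let ?h = "hook_filling m r lam T"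
    have "modified_symmetrizer m n r lam T ?h ?h \<noteq> 0"
      using symmetrizer_hook_filling_nonzero[OF assms] row_fact_pos col_fact_pos
      by (simp add: modified_symmetrizer_def)
    then show ?thesis
      using modified_symmetrizer_in_A_lam_Z[OF hook_filling_mem[OF assms] hook_filling_mem[OF assms],
          of lam T] by auto
  qed
  moreover have "graded m n r ?L"
    unfolding A_lam_Z_def
  proof (rule graded_int_span, clarify)
    fix i j assume "i \<in> ?I" "j \<in> ?I"
    then show "\<exists>e. modified_symmetrizer m n r lam T i j \<in> A_part m n r e"
      unfolding modified_symmetrizer_def
      by (metis symmetrizer_in_A_part[OF T] q_mod.subspace_scale[OF subspace_A_part])
  qed
  moreover have "left_act m n r \<xi> x \<in> ?L \<and> right_act m n r x \<xi> \<in> ?L"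
    if \<xi>: "\<xi> \<in> S_Z m n r" and x: "x \<in> ?L" for \<xi> x
  proof
    note x' = x[unfolded A_lam_Z_def] and \<xi>Q = S_Z_integral(1)[OF \<xi>]
    show "left_act m n r \<xi> x \<in> ?L"
      by (rule linear_on_maps_int_span[OF left_act_chi(1)[OF \<xi>Q] GA subspace_A_lam_Z _ x'])
        (use left_act_modified_symmetrizer[OF T lam \<xi>] in blast)
    show "right_act m n r x \<xi> \<in> ?L"
      by (rule linear_on_maps_int_span[OF right_act_chi(1)[OF \<xi>Q] GA subspace_A_lam_Z _ x'])
        (use right_act_modified_symmetrizer[OF T \<xi>] in blast)
  qed
  ultimately show ?thesis
    using subsuperbimodule_A_lam_Q[OF T] subspace_A_lam_Z
    by (simp add: Z_form_def bi_closed_def)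
qed

end
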